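(* Let $a\in(0,1]$, let $\theta\in C^1((0,\infty))$ satisfy $\sup_{r>0}|r\theta'(r)|<\infty$, and suppose there is $R>0$ with $\theta'(r)=0$ for all $r\ge R$. Then $$\Gamma_{\theta,a}\le\frac12+\frac1{4a}.$$
   Context: Curved wedge $\Omega:=\{(r\cos[\varphi+\theta(r)],r\sin[\varphi+\theta(r)]):r>0,\ \varphi\in(0,2\pi a)\}$; $-\Delta_D^\Omega$ is the Dirichlet Laplacian in $L^2(\Omega)$ (form $\|\nabla u\|^2$ on $H_0^1(\Omega)$); $L^2_w(\Omega):=L^2(\Omega,e^{|x|^2/4}dx)$; $\Gamma_{\theta,a}:=\sup\{\gamma:\exists C_\gamma>0\ \forall t\ge0,\ \|e^{t\Delta_D^\Omega}\|_{L^2_w(\Omega)\to L^2(\Omega)}\le C_\gamma(1+t)^{-\gamma}\}$. *)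

theory Defs
  imports "HOL-Analysis.Analysis"
begin

type_synonym pt = "real \<times> real"

definition curved_wedge :: "(real \<Rightarrow> real) \<Rightarrow> real \<Rightarrow> pt set" where
  "curved_wedge \<theta> a = {(r * cos (\<phi> + \<theta> r), r * sin (\<phi> + \<theta> r)) | r \<phi>.
      0 < r \<and> 0 < \<phi> \<and> \<phi> < 2 * pi * a}"

primrec Ck :: "nat \<Rightarrow> (pt \<Rightarrow> real) \<Rightarrow> bool" where
  "Ck 0 f = continuous_on UNIV f"
| "Ck (Suc k) f = (continuous_on UNIV f \<and> (\<exists>g1 g2. Ck k g1 \<and> Ck k g2 \<and>
      (\<forall>x. (f has_derivative (\<lambda>h. fst h * g1 x + snd h * g2 x)) (at x))))"

definition smooth2 :: "(pt \<Rightarrow> real) \<Rightarrow> bool" where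
  "smooth2 f = (\<forall>k. Ck k f)"

definition test_fn :: "pt set \<Rightarrow> (pt \<Rightarrow> real) \<Rightarrow> (pt \<Rightarrow> real) \<Rightarrow> (pt \<Rightarrow> real) \<Rightarrow> bool" where
  "test_fn \<Omega> \<phi> g1 g2 = (smooth2 \<phi> \<and> compact (closure {x. \<phi> x \<noteq> 0})
      \<and> closure {x. \<phi> x \<noteq> 0} \<subseteq> \<Omega>
      \<and> (\<forall>x. (\<phi> has_derivative (\<lambda>h. fst h * g1 x + snd h * g2 x)) (at x)))"

definition wnorm2 :: "pt set \<Rightarrow> (pt \<Rightarrow> real) \<Rightarrow> (pt \<Rightarrow> real) \<Rightarrow> ennreal" where
  "wnorm2 \<Omega> w f = (\<integral>\<^sup>+ x. indicator \<Omega> x * ennreal (w x * (f x)\<^sup>2) \<partial>lborel)"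

abbreviation norm2 :: "pt set \<Rightarrow> (pt \<Rightarrow> real) \<Rightarrow> ennreal" where
  "norm2 \<Omega> f \<equiv> wnorm2 \<Omega> (\<lambda>_. 1) f"

definition in_L2 :: "pt set \<Rightarrow> (pt \<Rightarrow> real) \<Rightarrow> bool" where
  "in_L2 \<Omega> f = (f \<in> borel_measurable lborel \<and> norm2 \<Omega> f < \<infinity>)"

definition gauss_w :: "pt \<Rightarrow> real" where
  "gauss_w x = exp ((norm x)\<^sup>2 / 4)"

definition in_L2w :: "pt set \<Rightarrow> (pt \<Rightarrow> real) \<Rightarrow> bool" where
  "in_L2w \<Omega> f = (f \<in> borel_measurable lborel \<and> wnorm2 \<Omega> gauss_w f < \<infinity>)"

definition H01 :: "pt set \<Rightarrow> (pt \<Rightarrow> real) \<Rightarrow> (pt \<Rightarrow> real) \<Rightarrow> (pt \<Rightarrow> real) \<Rightarrow> bool" where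
  "H01 \<Omega> u g1 g2 = (in_L2 \<Omega> u \<and> in_L2 \<Omega> g1 \<and> in_L2 \<Omega> g2 \<and>
     (\<exists>\<phi> d1 d2. (\<forall>n. test_fn \<Omega> (\<phi> n) (d1 n) (d2 n)) \<and>
        ((\<lambda>n. norm2 \<Omega> (\<lambda>x. \<phi> n x - u x)) \<longlongrightarrow> 0) sequentially \<and>
        ((\<lambda>n. norm2 \<Omega> (\<lambda>x. d1 n x - g1 x)) \<longlongrightarrow> 0) sequentially \<and>
        ((\<lambda>n. norm2 \<Omega> (\<lambda>x. d2 n x - g2 x)) \<longlongrightarrow> 0) sequentially))"

text \<open>Dirichlet Laplacian via the form ||grad u||^2 on H_0^1: u in dom(-Delta_D) and
  (-Delta_D) u = f.\<close>
definition dirichlet_lap :: "pt set \<Rightarrow> (pt \<Rightarrow> real) \<Rightarrow> (pt \<Rightarrow> real) \<Rightarrow> bool" where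
  "dirichlet_lap \<Omega> u f = (in_L2 \<Omega> f \<and> (\<exists>g1 g2. H01 \<Omega> u g1 g2 \<and>
     (\<forall>v h1 h2. H01 \<Omega> v h1 h2 \<longrightarrow>
        (\<integral>x. indicator \<Omega> x * (g1 x * h1 x + g2 x * h2 x) \<partial>lborel)
          = (\<integral>x. indicator \<Omega> x * (f x * v x) \<partial>lborel))))"

text \<open>u is the orbit t \<mapsto> e^{t Delta_D} u0 of the heat semigroup: the (unique) classical
  L^2-solution of u' = Delta_D u, u(0) = u0.\<close>
definition heat_orbit :: "pt set \<Rightarrow> (pt \<Rightarrow> real) \<Rightarrow> (real \<Rightarrow> pt \<Rightarrow> real) \<Rightarrow> bool" where
  "heat_orbit \<Omega> u0 u = (in_L2 \<Omega> u0 \<and> u 0 = u0 \<and> (\<forall>t\<ge>0. in_L2 \<Omega> (u t)) \<and>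
     ((\<lambda>t. norm2 \<Omega> (\<lambda>x. u t x - u0 x)) \<longlongrightarrow> 0) (at_right 0) \<and>
     (\<forall>t>0. \<exists>f. dirichlet_lap \<Omega> (u t) f \<and>
        ((\<lambda>s. norm2 \<Omega> (\<lambda>x. (u s x - u t x) / (s - t) + f x)) \<longlongrightarrow> 0) (at t)))"

definition heat_opnorm :: "pt set \<Rightarrow> real \<Rightarrow> ereal" where
  "heat_opnorm \<Omega> t = (SUP (u0, u) \<in> {(u0, u). in_L2w \<Omega> u0 \<and> wnorm2 \<Omega> gauss_w u0 \<le> 1
        \<and> heat_orbit \<Omega> u0 u}. ereal (sqrt (enn2real (norm2 \<Omega> (u t)))))"

definition Gamma :: "(real \<Rightarrow> real) \<Rightarrow> real \<Rightarrow> ereal" where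
  "Gamma \<theta> a = Sup (ereal ` {\<gamma>. \<exists>C>0. \<forall>t\<ge>0.
       heat_opnorm (curved_wedge \<theta> a) t \<le> ereal (C * (1 + t) powr (- \<gamma>))})"

end

theory Submission
  imports Defs "HOL-Computational_Algebra.Polynomial" "HOL-Real_Asymp.Real_Asymp"
begin

text \<open>
  Heat flows starting from a nonnegative test function are built from the resolvent
  \<open>B = (1 - \<Delta>)\<^sup>-\<^sup>1\<close>; they are nonnegative and contractive. For \<open>\<nu> > 1 / (2 a)\<close> the sector of opening
  \<open>\<pi> / \<nu> < 2 \<pi> a\<close>, moved far out along its axis, lies in the part of the wedge where \<open>\<theta>\<close> is constant.
  In the polar coordinates of that sector put \<open>V = \<Lambda> r\<^sup>\<nu> cos (\<nu> \<phi>) exp (- r\<^sup>2 / 4 T)\<close>, so that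
  \<open>\<Delta> V \<ge> - (1 + \<nu>) V / T\<close>. For a smooth convex \<open>k\<close> vanishing on the negative axis, \<open>\<psi> = k (V - 1)\<close> is a
  compactly supported smooth subsolution up to a bounded error, and Gronwall's inequality bounds
  \<open>\<langle>u(T), \<psi>\<rangle>\<close> from below by a fixed fraction of \<open>\<langle>u(0), \<psi>\<rangle>\<close>. With \<open>\<Lambda> = T\<^sup>2\<close> the support of \<open>\<psi>\<close> lies
  within radius \<open>T\<^bsup>1/\<kappa>\<^esup>\<close> for every \<open>\<kappa> < 2\<close> and large \<open>T\<close>, so the Cauchy-Schwarz inequality forces the
  norm of \<open>u(T)\<close> to be at least a multiple of \<open>T\<close> to the power \<open>- (1 + \<nu>) / \<kappa>\<close>. Let \<open>\<kappa> \<rightarrow> 2\<close> and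
  \<open>\<nu> \<rightarrow> 1 / (2 a)\<close>.
\<close>

subsection \<open>Projections and evolution equations in Hilbert space\<close>

text \<open>The operator norm is a supremum over heat orbits, so one orbit with a fixed datum bounds
  it from below at every \<open>T\<close>. The number \<open>1 + \<nu>\<close> arises twice. The
  Laplacian of \<open>V\<close> loses at most the rate \<open>(1 + \<nu>) / T\<close>, where
  \<open>\<nu>\<close> is the cross term of a function homogeneous of degree \<open>\<nu>\<close>
  with the Gaussian and 1 is half the planar dimension; over time \<open>T\<close> this costs only
  the constant factor \<open>exp (1 + \<nu>)\<close>. And \<open>\<psi>\<close>, supported in a disc
  of radius \<open>\<rho>\<close>, has norm of order
  \<open>\<Lambda> * \<rho> powr (1 + \<nu>)\<close>. The pairing of \<open>\<psi>\<close> with the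
  datum also grows like \<open>\<Lambda>\<close>, so \<open>\<Lambda>\<close> cancels in the
  quotient. It is taken large for another reason: subtracting 1 from \<open>V\<close>, which pushes
  the support of \<open>\<psi>\<close> off the edges of the sector and makes it bounded, costs an
  error of order \<open>\<rho>\<close>, and \<open>T^2\<close> dominates it. In the limit
  \<open>\<rho>\<close> is nearly \<open>T^(1/2)\<close> and the exponent is
  \<open>(1 + 1 / (2 a)) / 2\<close>.\<close>

lemma orthogonal_projection_exists:
  fixes V :: "'a::{real_inner, complete_space} set" and x :: 'a
  assumes "subspace V" "closed V"
  shows "\<exists>p\<in>V. \<forall>v\<in>V. inner (x - p) v = 0"
proof -
  define D where "D = (\<lambda>v. (norm (x - v))\<^sup>2) ` V"
  define d where "d = Inf D"
  have ne: "D \<noteq> {}" using subspace_0[OF assms(1)] by (auto simp: D_def)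
  have bdd: "bdd_below D" unfolding D_def by (rule bdd_belowI[of _ 0]) auto
  have lb: "d \<le> (norm (x - v))\<^sup>2" if "v \<in> V" for v
    unfolding d_def by (rule cInf_lower[OF _ bdd]) (auto simp: D_def that)
  have "\<exists>v\<in>V. (norm (x - v))\<^sup>2 < d + 1 / Suc n" for n
  proof -
    have "\<exists>y\<in>D. y < d + 1 / Suc n"
      using cInf_less_iff[OF ne bdd, of "d + 1 / Suc n"] by (simp add: d_def)
    then show ?thesis by (auto simp: D_def)
  qed
  then obtain v where vV: "\<And>n. v n \<in> V" and v: "\<And>n. (norm (x - v n))\<^sup>2 < d + 1 / Suc n" by metis
  \<comment> \<open>Parallelogram identity: the midpoint lies in \<open>V\<close>, so four times its
    squared distance from \<open>x\<close> is at least \<open>4 * d\<close>, which cancels the main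
    part of the two almost minimal terms.\<close>
  have par: "(norm (v n - v m))\<^sup>2 \<le> 2 / Suc n + 2 / Suc m" for n m
  proof -
    have mid: "(1/2) *\<^sub>R (v n + v m) \<in> V" by (intro subspace_scale subspace_add assms vV)
    have "(norm (v n - v m))\<^sup>2 = 2 * (norm (x - v n))\<^sup>2 + 2 * (norm (x - v m))\<^sup>2
            - 4 * (norm (x - (1/2) *\<^sub>R (v n + v m)))\<^sup>2"
      by (simp add: power2_norm_eq_inner inner_simps inner_commute algebra_simps)
    then show ?thesis using v[of n] v[of m] lb[OF mid] by simp
  qed
  have "Cauchy v"
  proof (rule metric_CauchyI)
    fix e :: real assume e: "e > 0"
    obtain N where N: "4 / e\<^sup>2 < real N" using reals_Archimedean2 by blast
    show "\<exists>M. \<forall>m\<ge>M. \<forall>n\<ge>M. dist (v m) (v n) < e"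
    proof (intro exI allI impI)
      fix m n assume mn: "N \<le> m" "N \<le> n"
      have "2 / Suc n \<le> 2 / Suc N" "2 / Suc m \<le> 2 / Suc N" using mn by (auto intro!: divide_left_mono)
      then have "(norm (v m - v n))\<^sup>2 \<le> 4 / Suc N" using par[of m n] by linarith
      also have "\<dots> < e\<^sup>2" using N e by (simp add: field_simps) (smt (verit) zero_less_power)
      finally show "dist (v m) (v n) < e" using e by (simp add: dist_norm power_less_imp_less_base)
    qed
  qed
  then obtain p where p: "v \<longlonglongrightarrow> p" using Cauchy_convergent_iff convergent_def by blast
  have pV: "p \<in> V" using closed_sequentially[OF assms(2)] vV p by blast
  have "(\<lambda>n. (norm (x - v n))\<^sup>2) \<longlonglongrightarrow> (norm (x - p))\<^sup>2" by (intro tendsto_intros p)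
  moreover have "(\<lambda>n. d + 1 / Suc n) \<longlonglongrightarrow> d + 0" by (intro tendsto_intros LIMSEQ_inverse_real_of_nat[unfolded inverse_eq_divide])
  ultimately have pd: "(norm (x - p))\<^sup>2 \<le> d"
    using LIMSEQ_le[of _ _ "\<lambda>n. d + 1 / Suc n"] v by (metis (no_types, lifting) add.right_neutral less_imp_le)
  have "inner (x - p) w = 0" if w: "w \<in> V" for w
  proof (rule ccontr)
    assume ne: "inner (x - p) w \<noteq> 0"
    define i where "i = inner (x - p) w"
    \<comment> \<open>The minimiser of the quadratic \<open>norm (x - p - t w)^2\<close> in
      \<open>t\<close>; there the value drops by \<open>i^2 / (norm w)^2\<close>.\<close>
    define t where "t = i / (norm w)\<^sup>2"
    have w0: "w \<noteq> 0" using ne by auto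
    have "p + t *\<^sub>R w \<in> V" by (intro subspace_scale subspace_add assms pV w)
    from lb[OF this] pd have "(norm (x - p))\<^sup>2 \<le> (norm (x - (p + t *\<^sub>R w)))\<^sup>2" by linarith
    also have "\<dots> = (norm (x - p))\<^sup>2 - 2 * t * i + t\<^sup>2 * (norm w)\<^sup>2"
      unfolding power2_norm_eq_inner i_def
      by (simp add: inner_simps inner_commute algebra_simps power2_eq_square)
    also have "\<dots> = (norm (x - p))\<^sup>2 - i\<^sup>2 / (norm w)\<^sup>2" using w0
      by (simp add: t_def power2_eq_square field_simps)
    finally have "i\<^sup>2 / (norm w)\<^sup>2 \<le> 0" by simp
    then show False using ne w0 by (simp add: i_def divide_le_0_iff)
  qed
  with pV show ?thesis by blast
qed

text \<open>A copy of the bounded operators that can be an instance of the Banach algebra classes, which makes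
  the library's exponential function available.\<close>

typedef (overloaded) 'a oper = "UNIV :: ('a::real_normed_vector \<Rightarrow>\<^sub>L 'a) set"
  by simp

setup_lifting type_definition_oper

lift_definition app :: "'a::real_normed_vector oper \<Rightarrow> 'a \<Rightarrow> 'a" is blinfun_apply .

text \<open>The sort \<open>perfect_space\<close> makes the underlying space nontrivial, so that the
  identity has norm 1 and differs from 0.\<close>

instantiation oper :: ("{banach, perfect_space}") real_normed_algebra_1
begin

lift_definition zero_oper :: "'a oper" is 0 .
lift_definition one_oper :: "'a oper" is id_blinfun .
lift_definition plus_oper :: "'a oper \<Rightarrow> 'a oper \<Rightarrow> 'a oper" is "(+)" .
lift_definition minus_oper :: "'a oper \<Rightarrow> 'a oper \<Rightarrow> 'a oper" is "(-)" .
lift_definition uminus_oper :: "'a oper \<Rightarrow> 'a oper" is uminus .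
lift_definition times_oper :: "'a oper \<Rightarrow> 'a oper \<Rightarrow> 'a oper" is "(o\<^sub>L)" .
lift_definition scaleR_oper :: "real \<Rightarrow> 'a oper \<Rightarrow> 'a oper" is "(*\<^sub>R)" .
lift_definition norm_oper :: "'a oper \<Rightarrow> real" is norm .
definition sgn_oper :: "'a oper \<Rightarrow> 'a oper" where "sgn_oper a = inverse (norm a) *\<^sub>R a"
definition dist_oper :: "'a oper \<Rightarrow> 'a oper \<Rightarrow> real" where "dist_oper a b = norm (a - b)"
definition uniformity_oper :: "('a oper \<times> 'a oper) filter" where
  "uniformity_oper = (INF e\<in>{0<..}. principal {(x, y). dist x y < e})"
definition open_oper :: "'a oper set \<Rightarrow> bool" where
  "open_oper S = (\<forall>x\<in>S. \<forall>\<^sub>F (x', y) in uniformity. x' = x \<longrightarrow> y \<in> S)"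

instance
proof
  fix a b c :: "'a oper" and r s :: real
  show "a + b + c = a + (b + c)" "a + b = b + a" "0 + a = a" "- a + a = 0" "a - b = a + - b"
    "r *\<^sub>R (a + b) = r *\<^sub>R a + r *\<^sub>R b" "(r + s) *\<^sub>R a = r *\<^sub>R a + s *\<^sub>R a"
    "r *\<^sub>R s *\<^sub>R a = (r * s) *\<^sub>R a" "1 *\<^sub>R a = a"
    by (transfer; simp add: algebra_simps)+
  show "a * b * c = a * (b * c)" by transfer (auto intro: blinfun_eqI)
  show "1 * a = a" "a * 1 = a" by (transfer; auto intro: blinfun_eqI)+
  show "(a + b) * c = a * c + b * c" "a * (b + c) = a * b + a * c"
    "r *\<^sub>R a * b = r *\<^sub>R (a * b)" "a * r *\<^sub>R b = r *\<^sub>R (a * b)"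
    by (transfer; auto intro!: blinfun_eqI simp: blinfun.bilinear_simps)+
  show "(0::'a oper) \<noteq> 1"
    by transfer (metis norm_blinfun_id norm_zero zero_neq_one)
  show "dist a b = norm (a - b)" by (rule dist_oper_def)
  show "sgn a = inverse (norm a) *\<^sub>R a" by (rule sgn_oper_def)
  show "uniformity = (INF e\<in>{0<..}. principal {(x, y :: 'a oper). dist x y < e})" by (rule uniformity_oper_def)
  show "open U = (\<forall>x\<in>U. \<forall>\<^sub>F (x', y) in uniformity. x' = x \<longrightarrow> y \<in> U)" for U :: "'a oper set"
    by (rule open_oper_def)
  show "(norm a = 0) = (a = 0)" "norm (r *\<^sub>R a) = \<bar>r\<bar> * norm a" "norm (1::'a oper) = 1"
    by (transfer; simp)+
  show "norm (a + b) \<le> norm a + norm b" by transfer (rule norm_triangle_ineq)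
  show "norm (a * b) \<le> norm a * norm b" by transfer (rule norm_blinfun_compose)
qed

end

instance oper :: ("{banach, perfect_space}") banach
proof
  fix X :: "nat \<Rightarrow> 'a oper"
  assume X: "Cauchy X"
  have d: "dist a b = dist (Rep_oper a) (Rep_oper b)" for a b :: "'a oper"
    unfolding dist_norm by transfer simp
  have "Cauchy (\<lambda>n. Rep_oper (X n))" using X by (simp add: Cauchy_def d)
  then obtain L where L: "(\<lambda>n. Rep_oper (X n)) \<longlonglongrightarrow> L" using Cauchy_convergent_iff convergent_def by blast
  have "X \<longlonglongrightarrow> Abs_oper L"
    using L by (simp add: lim_sequentially d Abs_oper_inverse)
  then show "convergent X" by (auto simp: convergent_def)
qed

lemma app_simps:
  fixes a b :: "'a::{banach, perfect_space} oper"
  shows "app (a * b) x = app a (app b x)" "app 1 x = x" "app 0 x = 0"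
    "app (a + b) x = app a x + app b x" "app (a - b) x = app a x - app b x"
    "app (- a) x = - app a x" "app (r *\<^sub>R a) x = r *\<^sub>R app a x"
  by (transfer; simp add: blinfun.bilinear_simps)+

lemma bounded_bilinear_app: "bounded_bilinear (app :: 'a::{banach, perfect_space} oper \<Rightarrow> _)"
proof
  fix a b :: "'a oper" and x y :: 'a and r :: real
  show "app (a + b) x = app a x + app b x" "app (r *\<^sub>R a) x = r *\<^sub>R app a x" by (simp_all add: app_simps)
  show "app a (x + y) = app a x + app a y" "app a (r *\<^sub>R x) = r *\<^sub>R app a x"
    by (transfer; simp add: blinfun.bilinear_simps)+
  show "\<exists>K. \<forall>a x. norm (app a x :: 'a) \<le> norm a * norm x * K"
    by (rule exI[of _ 1], transfer) (auto simp: norm_blinfun)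
qed

interpretation app: bounded_bilinear "app :: 'a::{banach, perfect_space} oper \<Rightarrow> _"
  by (rule bounded_bilinear_app)

lemma exp_commute:
  fixes a b :: "'a::{real_normed_algebra_1, banach}"
  assumes "a * b = b * a"
  shows "exp a * b = b * exp a"
proof -
  have "(\<Sum>n. (a ^ n /\<^sub>R fact n) * b) = (\<Sum>n. b * (a ^ n /\<^sub>R fact n))"
    using power_commuting_commutes[OF assms] by simp
  then show ?thesis
    unfolding exp_def
    by (simp only: suminf_mult[OF summable_exp_generic] suminf_mult2[OF summable_exp_generic])
qed

text \<open>The resolvent of \<open>f\<close> is the first component of the orthogonal projection of \<open>(f, 0)\<close> onto \<open>V\<close>.\<close>

lemma weak_resolvent_exists:
  fixes V :: "('a::{real_inner, banach, perfect_space} \<times> 'b::{real_inner, banach}) set"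
  assumes V: "subspace V" "closed V"
  obtains B :: "'a oper" and G :: "'a \<Rightarrow> 'b" where
    "\<And>f. (app B f, G f) \<in> V"
    "\<And>f v h. (v, h) \<in> V \<Longrightarrow> inner (app B f) v + inner (G f) h = inner f v"
    "\<And>f u g. (u, g) \<in> V \<Longrightarrow> (\<And>v h. (v, h) \<in> V \<Longrightarrow> inner u v + inner g h = inner f v) \<Longrightarrow> app B f = u"
proof -
  have "\<exists>p\<in>V. \<forall>v\<in>V. inner ((f, 0) - p) v = 0" for f :: 'a
    by (rule orthogonal_projection_exists[OF V])
  then obtain P where P: "\<And>f::'a. P f \<in> V" "\<And>f v. v \<in> V \<Longrightarrow> inner ((f, 0) - P f) v = 0" by metis
  \<comment> \<open>Orthogonality of \<open>(f, 0) - P f\<close> to \<open>V\<close> is the weak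
    form of \<open>(1 - \<Delta>) u = f\<close>, because the inner product of the product space is
    the form plus the inner product of \<open>'a\<close>.\<close>
  have w: "inner (fst (P f)) v + inner (snd (P f)) h = inner f v" if "(v, h) \<in> V" for f v h
    using P(2)[OF that, of f] by (simp add: inner_prod_def inner_diff_left)
  have uniq: "(u, g) = P f"
    if "(u, g) \<in> V" "\<And>v h. (v, h) \<in> V \<Longrightarrow> inner u v + inner g h = inner f v" for f u g
  proof -
    define q where "q = (u, g) - P f"
    have qV: "q \<in> V" unfolding q_def by (intro subspace_diff V that P)
    have "inner q q = (inner u (fst q) + inner g (snd q)) - (inner (fst (P f)) (fst q) + inner (snd (P f)) (snd q))"
      by (simp add: q_def inner_prod_def inner_diff_left)
    also have "\<dots> = 0" using qV that(2)[of "fst q" "snd q"] w[of "fst q" "snd q" f] by simp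
    finally show ?thesis by (simp add: q_def)
  qed
  define b where "b f = fst (P f)" for f
  have add: "P (x + y) = P x + P y" for x y
  proof -
    have "(fst (P x + P y), snd (P x + P y)) = P (x + y)"
    proof (rule uniq)
      show "(fst (P x + P y), snd (P x + P y)) \<in> V" using subspace_add[OF V(1) P(1)[of x] P(1)[of y]] by (simp only: prod.collapse)
      show "inner (fst (P x + P y)) v + inner (snd (P x + P y)) h = inner (x + y) v" if "(v, h) \<in> V" for v h
        using w[OF that, of x] w[OF that, of y] by (simp add: inner_add_left)
    qed
    then show ?thesis by (simp only: prod.collapse)
  qed
  have scale: "P (r *\<^sub>R x) = r *\<^sub>R P x" for r x
  proof -
    have "(fst (r *\<^sub>R P x), snd (r *\<^sub>R P x)) = P (r *\<^sub>R x)"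
    proof (rule uniq)
      show "(fst (r *\<^sub>R P x), snd (r *\<^sub>R P x)) \<in> V" using subspace_scale[OF V(1) P(1)[of x], of r] by (simp only: prod.collapse)
      show "inner (fst (r *\<^sub>R P x)) v + inner (snd (r *\<^sub>R P x)) h = inner (r *\<^sub>R x) v" if "(v, h) \<in> V" for v h
        using w[OF that, of x, symmetric] by (simp add: distrib_left)
    qed
    then show ?thesis by (simp only: prod.collapse)
  qed
  \<comment> \<open>The weak equation tested with its own solution: \<open>inner f (b f)\<close>
    equals \<open>norm (P f)^2\<close>, hence dominates \<open>norm (b f)^2\<close>.\<close>
  have bnd: "norm (b f) \<le> norm f" for f
  proof -
    have "inner (P f) (P f) = inner f (b f)"
      using w[of "fst (P f)" "snd (P f)" f] P(1)[of f] by (simp add: inner_prod_def b_def)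
    moreover have "inner (b f) (b f) \<le> inner (P f) (P f)" by (simp add: inner_prod_def b_def)
    moreover have "inner f (b f) \<le> norm f * norm (b f)" by (rule norm_cauchy_schwarz)
    ultimately have "(norm (b f))\<^sup>2 \<le> norm f * norm (b f)" by (simp add: power2_norm_eq_inner)
    then show ?thesis by (cases "norm (b f) = 0") (auto simp: power2_eq_square)
  qed
  have bl: "bounded_linear b"
    by (rule bounded_linear_intro[of _ 1]) (use bnd in \<open>auto simp: b_def add scale\<close>)
  define B where "B = Abs_oper (Blinfun b)"
  have B: "app B f = fst (P f)" for f
    unfolding B_def by (simp add: app.rep_eq Abs_oper_inverse bounded_linear_Blinfun_apply[OF bl] b_def)
  show ?thesis
  proof (rule that[of B "\<lambda>f. snd (P f)"])
    show "app B f = u" if "(u, g) \<in> V" "\<And>v h. (v, h) \<in> V \<Longrightarrow> inner u v + inner g h = inner f v" for f u g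
      using uniq[OF that] B by (metis fst_conv)
    show "(app B f, snd (P f)) \<in> V" for f using P(1)[of f] by (simp add: B)
    show "inner (app B f) v + inner (snd (P f)) h = inner f v" if "(v, h) \<in> V" for f v h
      using w[OF that] by (simp add: B)
  qed
qed

section \<open>Flows of bounded dissipative operators and their limit\<close>

lemma app_exp_has_vector_derivative:
  fixes A :: "'a::{banach, perfect_space} oper"
  shows "((\<lambda>t. app (exp (t *\<^sub>R A)) x) has_vector_derivative app A (app (exp (t *\<^sub>R A)) x)) (at t within S)"
  by (rule has_vector_derivative_eq_rhs[OF app.has_vector_derivative[OF
        exp_scaleR_has_vector_derivative_right has_vector_derivative_const]])
     (simp only: app.zero_right add_0_left exp_times_scaleR_commute app_simps(1))

text \<open>The derivative of the squared norm along the flow is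
  \<open>2 * inner (app A y) y\<close>, which dissipativity makes nonpositive.\<close>

lemma dissipative_exp_le:
  fixes A :: "'a::{real_inner, banach, perfect_space} oper"
  assumes diss: "\<And>x. inner (app A x) x \<le> 0" and t: "0 \<le> t"
  shows "norm (app (exp (t *\<^sub>R A)) x) \<le> norm x"
proof -
  define y where "y t = app (exp (t *\<^sub>R A)) x" for t
  have y: "(y has_vector_derivative app A (y t)) (at t)" for t
    unfolding y_def by (rule app_exp_has_vector_derivative)
  have d: "((\<lambda>t. inner (y t) (y t)) has_real_derivative 2 * inner (app A (y t)) (y t)) (at t)" for t
    unfolding has_real_derivative_iff_has_vector_derivative
    by (rule has_vector_derivative_eq_rhs, rule bounded_bilinear.has_vector_derivative[OF bounded_bilinear_inner y y])
       (simp add: inner_commute)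
  have "inner (y t) (y t) \<le> inner (y 0) (y 0)"
    by (rule DERIV_nonpos_imp_nonincreasing[OF t]) (use d diss in \<open>force intro: mult_nonneg_nonpos\<close>)
  then have "norm (y t) \<le> norm (y 0)" by (simp add: norm_le)
  then show ?thesis by (simp add: y_def app_simps)
qed

text \<open>The difference \<open>D\<close> solves \<open>D' = A D + (A - A') z\<close>. Since
  \<open>A - A'\<close> commutes with the contractive flow of \<open>A'\<close>, the forcing term
  never exceeds its initial size \<open>c\<close>, and Gronwall's inequality applies. No operator
  norm enters the bound, which is what allows approximation of an unbounded generator.\<close>

lemma dissipative_exp_diff_le:
  fixes A A' :: "'a::{real_inner, banach, perfect_space} oper"
  assumes diss: "\<And>x. inner (app A x) x \<le> 0" "\<And>x. inner (app A' x) x \<le> 0"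
    and comm: "A * A' = A' * A" and t: "0 \<le> t"
  shows "(norm (app (exp (t *\<^sub>R A)) x - app (exp (t *\<^sub>R A')) x))\<^sup>2 \<le> (exp t - 1) * (norm (app A x - app A' x))\<^sup>2"
proof -
  define y where "y t = app (exp (t *\<^sub>R A)) x" for t
  define z where "z t = app (exp (t *\<^sub>R A')) x" for t
  define D where "D t = y t - z t" for t
  define c where "c = norm (app A x - app A' x)"
  have y: "(y has_vector_derivative app A (y t)) (at t)" for t
    unfolding y_def by (rule app_exp_has_vector_derivative)
  have z: "(z has_vector_derivative app A' (z t)) (at t)" for t
    unfolding z_def by (rule app_exp_has_vector_derivative)
  have D: "(D has_vector_derivative app A (y t) - app A' (z t)) (at t)" for t
    unfolding D_def by (intro has_vector_derivative_diff y z)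
  have dd: "((\<lambda>t. inner (D t) (D t)) has_real_derivative 2 * inner (app A (y t) - app A' (z t)) (D t)) (at t)" for t
    unfolding has_real_derivative_iff_has_vector_derivative
    by (rule has_vector_derivative_eq_rhs, rule bounded_bilinear.has_vector_derivative[OF bounded_bilinear_inner D D])
       (simp add: inner_commute)
  have bd: "2 * inner (app A (y s) - app A' (z s)) (D s) \<le> inner (D s) (D s) + c\<^sup>2" if "0 \<le> s" for s
  proof -
    have c1: "(s *\<^sub>R A') * (A - A') = (A - A') * (s *\<^sub>R A')" using comm by (simp add: algebra_simps)
    have "app (A - A') (z s) = app (exp (s *\<^sub>R A')) (app (A - A') x)"
      unfolding z_def using exp_commute[OF c1] by (metis app_simps(1))
    then have cz: "norm (app (A - A') (z s)) \<le> c"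
      using dissipative_exp_le[OF diss(2) that, of "app (A - A') x"] by (simp add: c_def app_simps)
    have "app A (y s) - app A' (z s) = app A (D s) + app (A - A') (z s)"
      by (simp add: D_def app_simps app.diff_right)
    then have "inner (app A (y s) - app A' (z s)) (D s) \<le> inner (app (A - A') (z s)) (D s)"
      using diss(1)[of "D s"] by (simp add: inner_add_left)
    also have "\<dots> \<le> norm (app (A - A') (z s)) * norm (D s)" by (rule norm_cauchy_schwarz)
    also have "\<dots> \<le> c * norm (D s)" using cz by (simp add: mult_right_mono)
    finally have "2 * inner (app A (y s) - app A' (z s)) (D s) \<le> 2 * c * norm (D s)" by simp
    also have "\<dots> \<le> (norm (D s))\<^sup>2 + c\<^sup>2" using sum_squares_bound[of c "norm (D s)"] by simp
    finally show ?thesis by (simp add: power2_norm_eq_inner)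
  qed
  \<comment> \<open>Integrating factor for the inequality in \<open>bd\<close>, by which the
    derivative of \<open>norm D ^ 2\<close> is at most \<open>norm D ^ 2 + c^2\<close>.\<close>
  have "exp (- t) * (inner (D t) (D t) + c\<^sup>2) \<le> exp (- 0) * (inner (D 0) (D 0) + c\<^sup>2)"
  proof (rule DERIV_nonpos_imp_nonincreasing[OF t])
    fix s assume s: "0 \<le> s" "s \<le> t"
    have "((\<lambda>t. exp (- t) * (inner (D t) (D t) + c\<^sup>2)) has_real_derivative
       exp (- s) * (2 * inner (app A (y s) - app A' (z s)) (D s) - (inner (D s) (D s) + c\<^sup>2))) (at s)"
      by (auto intro!: derivative_eq_intros dd simp: algebra_simps)
    moreover have "exp (- s) * (2 * inner (app A (y s) - app A' (z s)) (D s) - (inner (D s) (D s) + c\<^sup>2)) \<le> 0"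
      using bd[OF s(1)] by (intro mult_nonneg_nonpos) auto
    ultimately show "\<exists>y. ((\<lambda>t. exp (- t) * (inner (D t) (D t) + c\<^sup>2)) has_real_derivative y) (at s) \<and> y \<le> 0" by blast
  qed
  moreover have "D 0 = 0" by (simp add: D_def y_def z_def app_simps)
  ultimately have "inner (D t) (D t) + c\<^sup>2 \<le> exp t * c\<^sup>2"
    by (simp add: exp_minus field_simps)
  then show ?thesis by (simp add: D_def y_def z_def c_def power2_norm_eq_inner algebra_simps)
qed

text \<open>With \<open>C = 1 - B\<close> the generator is \<open>1 - B\<^sup>-\<^sup>1 = - (C + C\<^sup>2 + \<dots>)\<close>. The partial sums of this series are
  bounded, dissipative and commute, and their exponentials converge on the range of \<open>B\<^sup>2\<close>.\<close>

theorem weak_evolution_exists: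
  fixes V :: "('a::{real_inner, banach, perfect_space} \<times> 'b::{real_inner, banach}) set"
  assumes V: "subspace V" "closed V"
    and u0: "(u0, g0) \<in> V" "\<And>v h. (v, h) \<in> V \<Longrightarrow> inner u0 v + inner g0 h = inner w1 v"
    and w1: "(w1, g1) \<in> V" "\<And>v h. (v, h) \<in> V \<Longrightarrow> inner w1 v + inner g1 h = inner w2 v"
    and w2: "(w2, g2) \<in> V" "\<And>v h. (v, h) \<in> V \<Longrightarrow> inner w2 v + inner g2 h = inner w3 v"
  obtains U F :: "real \<Rightarrow> 'a" and G :: "real \<Rightarrow> 'b" where "U 0 = u0"
    "\<And>t. 0 \<le> t \<Longrightarrow> (U has_vector_derivative - F t) (at t within {0..})"
    "\<And>t. 0 \<le> t \<Longrightarrow> (U t, G t) \<in> V"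
    "\<And>t v h. 0 \<le> t \<Longrightarrow> (v, h) \<in> V \<Longrightarrow> inner (G t) h = inner (F t) v"
    "\<And>t. 0 \<le> t \<Longrightarrow> norm (U t) \<le> norm u0"
proof -
  obtain B :: "'a oper" and GG where BV: "\<And>f. (app B f, GG f) \<in> V"
    and Bw: "\<And>f v h. (v, h) \<in> V \<Longrightarrow> inner (app B f) v + inner (GG f) h = inner f v"
    and Bu: "\<And>f u g. (u, g) \<in> V \<Longrightarrow> (\<And>v h. (v, h) \<in> V \<Longrightarrow> inner u v + inner g h = inner f v) \<Longrightarrow> app B f = u"
    by (rule weak_resolvent_exists[OF V]) blast
  \<comment> \<open>Thus \<open>u0 = B^3 w3\<close>: one factor \<open>B\<close> gives membership in
    the domain, the others buy convergence and a uniform bound on second time derivatives.\<close>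
  have B0: "app B w1 = u0" and B1: "app B w2 = w1" and B2: "app B w3 = w2"
    using Bu u0 w1 w2 by blast+
  define C where "C = 1 - B"
  have CB: "app C x = x - app B x" for x by (simp add: C_def app_simps)
  \<comment> \<open>\<open>B^2 \<le> B\<close>, since the gradient part of the form is nonnegative.
    With self-adjointness this places \<open>B\<close>, and hence \<open>C = 1 - B\<close>, between
    0 and 1.\<close>
  have Bsq: "inner (app B x) (app B x) \<le> inner (app B x) x" for x
    using Bw[OF BV[of x], of x] inner_ge_zero[of "GG x"] inner_commute[of x "app B x"] by linarith
  have Bpos: "0 \<le> inner (app B x) x" for x using Bsq[of x] inner_ge_zero order_trans by blast
  have Bsa: "inner (app B x) y = inner x (app B y)" for x y
  proof -
    have "inner (app B x) y = inner y (app B x)" by (rule inner_commute)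
    also have "\<dots> = inner (app B y) (app B x) + inner (GG y) (GG x)" using Bw[OF BV[of x], of y] by simp
    also have "\<dots> = inner (app B x) (app B y) + inner (GG x) (GG y)" by (simp add: inner_commute)
    also have "\<dots> = inner x (app B y)" using Bw[OF BV[of y], of x] by simp
    finally show ?thesis .
  qed
  have Csa: "inner (app C x) y = inner x (app C y)" for x y
    by (simp add: CB inner_diff_left inner_diff_right Bsa)
  have Csq: "inner (app C x) (app C x) \<le> inner (app C x) x" for x
    using Bsq[of x] by (simp add: CB inner_diff_left inner_diff_right inner_commute)
  have Cpos: "0 \<le> inner (app C x) x" for x using Csq[of x] inner_ge_zero order_trans by blast
  have Cnorm: "norm (app C x) \<le> norm x" for x
  proof -
    have "inner (app C x) (app C x) \<le> inner x x" using Csq[of x] Bpos[of x] by (simp add: CB inner_diff_left)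
    then show ?thesis by (simp add: norm_le)
  qed
  have Cpsa: "inner (app (C ^ k) x) y = inner x (app (C ^ k) y)" for k x y
    by (induction k arbitrary: x y) (simp_all add: app_simps Csa power_commutes[symmetric], metis app_simps(1) power_commutes)
  \<comment> \<open>For \<open>k = 2 j\<close> or \<open>k = 2 j + 1\<close> self-adjointness turns
    the expression into \<open>inner y y\<close> or \<open>inner (C y) y\<close> with
    \<open>y = C^j x\<close>.\<close>
  have Cppos: "0 \<le> inner (app (C ^ k) x) x" for k x
  proof (cases "even k")
    case True
    then obtain j where "k = j + j" by (metis evenE mult_2)
    then show ?thesis using Cpsa[of j "app (C ^ j) x" x] by (simp add: power_add app_simps)
  next
    case False
    then obtain j where "k = j + (1 + j)" by (metis oddE mult_2 add.assoc add.commute)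
    then have "app (C ^ k) x = app (C ^ j) (app C (app (C ^ j) x))"
      by (simp only: power_add power_one_right app_simps)
    then show ?thesis using Cpos[of "app (C ^ j) x"] Cpsa[of j "app C (app (C ^ j) x)" x] by simp
  qed
  have Cpnorm: "norm (app (C ^ k) x) \<le> norm x" for k x
    by (induction k) (auto simp: app_simps intro: order_trans[OF Cnorm])
  define A where "A n = - (\<Sum>k=1..n. C ^ k)" for n :: nat
  have app_sum: "app (\<Sum>k\<in>S. f k) x = (\<Sum>k\<in>S. app (f k) x)" for f :: "nat \<Rightarrow> 'a oper" and S x
    by (rule app.sum_left)
  have diss: "inner (app (A n) x) x \<le> 0" for n x
    by (simp add: A_def app_simps app_sum inner_sum_left sum_nonneg Cppos)
  have AC: "A n * C = C * A n" for n
    by (simp add: A_def sum_distrib_left sum_distrib_right power_commutes)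
  have CpA: "C ^ k * A n = A n * C ^ k" for k n
    using power_commuting_commutes[of C "A n" k] AC by simp
  have AA: "A n * A m = A m * A n" for n m
    unfolding A_def[of m] by (simp add: sum_distrib_left sum_distrib_right CpA)
  have BC: "B = 1 - C" by (simp add: C_def)
  \<comment> \<open>The geometric sum telescopes against \<open>B = 1 - C\<close>, so
    \<open>A n\<close> is bounded uniformly in \<open>n\<close> on vectors
    \<open>B y\<close>.\<close>
  have ABtel: "A n * B = C ^ Suc n - C" for n
  proof -
    have "(\<Sum>k=1..n. C ^ k) * B = C - C ^ Suc n"
    proof (induction n)
      case (Suc n)
      have "C ^ Suc n * B = C ^ Suc n - C ^ Suc (Suc n)"
        by (simp only: BC right_diff_distrib mult_1_right power_Suc2[of C "Suc n"])
      moreover have "(\<Sum>k=1..Suc n. C ^ k) * B = (\<Sum>k=1..n. C ^ k) * B + C ^ Suc n * B"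
        by (simp add: distrib_right)
      ultimately show ?case using Suc.IH by (simp only: diff_add_cancel diff_add_eq add_diff_eq)
    qed (simp add: BC)
    then show ?thesis by (simp add: A_def)
  qed
  have AB: "app (A n) (app B y) = app (C ^ Suc n) y - app C y" for n y
    by (simp only: app_simps(1)[symmetric] app_simps(5)[symmetric] ABtel)
  \<comment> \<open>\<open>norm (C^n z)^2\<close> is nonincreasing, so its decrements tend to 0; by
    \<open>C^2 \<le> C\<close> they dominate \<open>norm (C^n (1 - C) z)^2\<close>.\<close>
  have C0: "(\<lambda>n. app (C ^ n) (app B z)) \<longlonglongrightarrow> 0" for z
  proof -
    define s where "s n = (norm (app (C ^ n) z))\<^sup>2" for n
    have sdec: "s (Suc n) \<le> s n" for n
      using power_mono[OF Cnorm[of "app (C ^ n) z"] norm_ge_zero, of 2] by (simp add: s_def app_simps(1))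
    then have "decseq s" by (simp add: decseq_SucI)
    moreover have "0 \<le> s n" for n by (simp add: s_def)
    ultimately obtain L where L: "s \<longlonglongrightarrow> L" using decseq_convergent[of s 0] by blast
    have le: "(norm (app (C ^ n) (app B z)))\<^sup>2 \<le> s n - s (Suc n)" for n
    proof -
      define q where "q = app (C ^ n) z"
      have "C ^ n * B = C ^ n - C * C ^ n" by (simp only: BC right_diff_distrib mult_1_right power_commutes)
      then have "app (C ^ n) (app B z) = q - app C q"
        unfolding q_def app_simps(1)[symmetric] app_simps(5)[symmetric] by simp
      moreover have "app (C ^ Suc n) z = app C q" by (simp add: q_def app_simps)
      ultimately show ?thesis using Csq[of q]
        by (simp add: s_def power2_norm_eq_inner q_def[symmetric] inner_diff_left inner_diff_right inner_commute)
    qed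
    have "(\<lambda>n. s n - s (Suc n)) \<longlonglongrightarrow> 0" using tendsto_diff[OF L LIMSEQ_Suc[OF L]] by simp
    then have "(\<lambda>n. (norm (app (C ^ n) (app B z)))\<^sup>2) \<longlonglongrightarrow> 0"
      by (rule Lim_null_comparison[rotated]) (simp add: le)
    from tendsto_real_sqrt[OF this] show ?thesis by (simp add: tendsto_norm_zero_iff)
  qed
  define E where "E n t = exp (t *\<^sub>R A n)" for n t
  have EnB: "E n t * B = B * E n t" for n t
    unfolding E_def by (rule exp_commute) (use AC[of n] in \<open>simp add: BC left_diff_distrib right_diff_distrib scaleR_diff_right\<close>)
  have EnA: "E n t * A n = A n * E n t" for n t unfolding E_def by (rule exp_times_scaleR_commute)
  have Ele: "norm (app (E n t) x) \<le> norm x" if "0 \<le> t" for n t x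
    unfolding E_def by (rule dissipative_exp_le[OF diss that])
  \<comment> \<open>The vectors \<open>A n (B (B z))\<close> converge to \<open>- C (B z)\<close>,
    so the comparison of two commuting dissipative flows makes the approximate orbits
    Cauchy.\<close>
  have conv: "convergent (\<lambda>n. app (E n t) (app B (app B z)))" if t: "0 \<le> t" for t z
  proof -
    define a where "a n = app (A n) (app B (app B z))" for n
    have "a n = app (C ^ Suc n) (app B z) - app C (app B z)" for n unfolding a_def by (rule AB)
    then have "a \<longlonglongrightarrow> 0 - app C (app B z)"
      using tendsto_diff[OF LIMSEQ_Suc[OF C0[of z]] tendsto_const] by presburger
    then have "convergent a" by (rule convergentI)
    then have "Cauchy a" by (rule convergent_Cauchy)
    have "Cauchy (\<lambda>n. app (E n t) (app B (app B z)))"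
    proof (rule metric_CauchyI)
      fix e :: real assume e: "0 < e"
      define d where "d = e / sqrt (exp t)"
      have d: "d > 0" using e by (simp add: d_def)
      obtain M where M: "\<And>m n. m \<ge> M \<Longrightarrow> n \<ge> M \<Longrightarrow> dist (a m) (a n) < d"
        using metric_CauchyD[OF \<open>Cauchy a\<close> d] by blast
      show "\<exists>M. \<forall>m\<ge>M. \<forall>n\<ge>M. dist (app (E m t) (app B (app B z))) (app (E n t) (app B (app B z))) < e"
      proof (intro exI allI impI)
        fix m n assume mn: "M \<le> m" "M \<le> n"
        have "(dist (app (E m t) (app B (app B z))) (app (E n t) (app B (app B z))))\<^sup>2 \<le> (exp t - 1) * (dist (a m) (a n))\<^sup>2"
          unfolding dist_norm E_def a_def by (rule dissipative_exp_diff_le[OF diss diss AA t])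
        also have "\<dots> \<le> exp t * (dist (a m) (a n))\<^sup>2" by (simp add: mult_right_mono)
        also have "\<dots> < exp t * d\<^sup>2" using M[OF mn] by (simp add: power_strict_mono)
        also have "\<dots> = e\<^sup>2" by (simp add: d_def power_divide)
        finally show "dist (app (E m t) (app B (app B z))) (app (E n t) (app B (app B z))) < e"
          using e by (simp add: power_less_imp_less_base)
      qed
    qed
    then show ?thesis by (simp add: Cauchy_convergent_iff)
  qed
  \<comment> \<open>The orbit is built one resolvent step above \<open>u0\<close>. With
    \<open>U = B Y\<close> the pair \<open>(U, GG Y)\<close> lies in \<open>V\<close> at once, and
    \<open>- \<Delta> U = Y - B Y = C Y\<close> is the candidate for \<open>F\<close>.\<close>
  define Y where "Y t = lim (\<lambda>n. app (E n t) w1)" for t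
  define U where "U t = app B (Y t)" for t
  have Ylim: "(\<lambda>n. app (E n t) w1) \<longlonglongrightarrow> Y t" if "0 \<le> t" for t
    using conv[OF that, of w3] unfolding Y_def B2 B1 by (simp add: convergent_LIMSEQ_iff)
  have Ulim: "(\<lambda>n. app (E n t) u0) \<longlonglongrightarrow> U t" if "0 \<le> t" for t
  proof -
    have "app (E n t) u0 = app B (app (E n t) w1)" for n unfolding B0[symmetric] by (simp only: app_simps(1)[symmetric] EnB)
    then show ?thesis unfolding U_def using app.tendsto[OF tendsto_const Ylim[OF that]] by simp
  qed
  have Au0: "app (A n) u0 = app (C ^ Suc n) w1 - app C w1" for n
    unfolding B0[symmetric] by (rule AB)
  have dlim: "(\<lambda>n. app (E n t) (app (A n) u0)) \<longlonglongrightarrow> - app C (Y t)" if t: "0 \<le> t" for t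
  proof -
    have "(\<lambda>n. app (E n t) (app (C ^ Suc n) w1)) \<longlonglongrightarrow> 0"
      by (rule Lim_null_comparison[OF _ tendsto_norm_zero[OF LIMSEQ_Suc[OF C0[of w2, unfolded B1]]]])
         (use Ele[OF t] in auto)
    moreover have "app (E n t) (app C w1) = app C (app (E n t) w1)" for n
      unfolding CB app.diff_right by (simp only: app_simps(1)[symmetric] EnB)
    moreover have "(\<lambda>n. app C (app (E n t) w1)) \<longlonglongrightarrow> app C (Y t)"
      by (rule app.tendsto[OF tendsto_const Ylim[OF t]])
    ultimately show ?thesis
      unfolding Au0 app.diff_right using tendsto_diff by fastforce
  qed
  \<comment> \<open>Bounds the second time derivative of all approximate orbits: applying
    \<open>A n\<close> twice to \<open>u0 = B (B w2)\<close> gives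
    \<open>(C^(n+1) - C)^2 w2\<close>, and each factor has norm at most 2.\<close>
  define M where "M = 4 * norm w2"
  have AAu0: "norm (app (A n) (app (A n) u0)) \<le> M" for n
  proof -
    have sq: "A n * (A n * (B * B)) = (C ^ Suc n - C) * (C ^ Suc n - C)"
    proof -
      have comm: "A n * B = B * A n" using AC[of n] by (simp add: BC left_diff_distrib right_diff_distrib)
      have "A n * (A n * (B * B)) = A n * ((A n * B) * B)" by (simp only: mult.assoc)
      also have "\<dots> = A n * ((B * A n) * B)" by (simp only: comm)
      also have "\<dots> = (A n * B) * (A n * B)" by (simp only: mult.assoc)
      finally show ?thesis by (simp only: ABtel)
    qed
    have u: "u0 = app (B * B) w2" by (simp add: app_simps B0 B1)
    have "app (A n) (app (A n) u0) = app (A n * (A n * (B * B))) w2" unfolding u app_simps(1) ..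
    also have "\<dots> = app (C ^ Suc n - C) (app (C ^ Suc n - C) w2)" unfolding sq by (rule app_simps(1))
    finally have eq: "app (A n) (app (A n) u0) = app (C ^ Suc n - C) (app (C ^ Suc n - C) w2)" .
    have *: "norm (app (C ^ Suc n - C) x) \<le> 2 * norm x" for x
      using Cpnorm[of "Suc n" x] Cnorm[of x] norm_triangle_ineq4[of "app (C ^ Suc n) x" "app C x"]
      unfolding app_simps(5) by linarith
    have "norm (app (C ^ Suc n - C) (app (C ^ Suc n - C) w2)) \<le> 2 * (2 * norm w2)"
      using *[of "app (C ^ Suc n - C) w2"] *[of w2] by linarith
    then show ?thesis unfolding eq M_def by simp
  qed
  have der: "((\<lambda>t. app (E n t) x) has_vector_derivative app (E n t) (app (A n) x)) (at t within S)" for n t x S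
  proof -
    have "app (A n) (app (E n t) x) = app (E n t) (app (A n) x)" by (metis app_simps(1) EnA)
    then show ?thesis using app_exp_has_vector_derivative[of "A n" x t S] by (simp add: E_def)
  qed
  \<comment> \<open>Differentiability of the limit is read off from a second order Taylor estimate
    whose constant is independent of \<open>n\<close>, so that \<open>n\<close> can be sent to
    infinity.\<close>
  have quad: "norm (U s - U t - (s - t) *\<^sub>R (- app C (Y t))) \<le> M * \<bar>s - t\<bar> * \<bar>s - t\<bar>" if st: "0 \<le> s" "0 \<le> t" for s t
  proof -
    have seg: "\<And>r. r \<in> closed_segment t s \<Longrightarrow> 0 \<le> r \<and> \<bar>r - t\<bar> \<le> \<bar>s - t\<bar>"
      using st by (auto simp: closed_segment_eq_real_ivl split: if_splits)
    have "norm (app (E n s) u0 - app (E n t) u0 - (s - t) *\<^sub>R app (E n t) (app (A n) u0)) \<le> norm (s - t) * (M * \<bar>s - t\<bar>)" for n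
    proof (rule vector_differentiable_bound_linearization[where S = "closed_segment t s" and ?x0.0 = t])
      fix r assume r: "r \<in> closed_segment t s"
      show "((\<lambda>t. app (E n t) u0) has_vector_derivative app (E n r) (app (A n) u0)) (at r within closed_segment t s)"
        by (rule der)
      have "norm (app (E n r) (app (A n) u0) - app (E n t) (app (A n) u0)) \<le> M * norm (r - t)"
      proof (rule differentiable_bound[where S = "closed_segment t s" and f' = "\<lambda>r h. h *\<^sub>R app (E n r) (app (A n) (app (A n) u0))"])
        fix q assume q: "q \<in> closed_segment t s"
        show "((\<lambda>a. app (E n a) (app (A n) u0)) has_derivative (\<lambda>h. h *\<^sub>R app (E n q) (app (A n) (app (A n) u0)))) (at q within closed_segment t s)"
          using der unfolding has_vector_derivative_def .
        have "norm (app (E n q) (app (A n) (app (A n) u0))) \<le> M"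
          using order_trans[OF Ele AAu0] seg[OF q] by blast
        then show "onorm (\<lambda>h. h *\<^sub>R app (E n q) (app (A n) (app (A n) u0))) \<le> M"
          by (intro onorm_le) (simp add: mult_left_mono mult.commute[of M])
      qed (use r in auto)
      also have "\<dots> \<le> M * \<bar>s - t\<bar>" using seg[OF r] by (simp add: M_def mult_left_mono)
      finally show "norm (app (E n r) (app (A n) u0) - app (E n t) (app (A n) u0)) \<le> M * \<bar>s - t\<bar>" .
    qed auto
    moreover have "(\<lambda>n. norm (app (E n s) u0 - app (E n t) u0 - (s - t) *\<^sub>R app (E n t) (app (A n) u0)))
       \<longlonglongrightarrow> norm (U s - U t - (s - t) *\<^sub>R (- app C (Y t)))"
      by (intro tendsto_intros Ulim dlim st)
    ultimately show ?thesis
      by (intro LIMSEQ_le_const2) (auto simp: mult_ac)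
  qed
  show ?thesis
  proof (rule that[of U "\<lambda>t. app C (Y t)" "\<lambda>t. GG (Y t)"])
    show "U 0 = u0" using Ulim[of 0] by (simp add: E_def app_simps LIMSEQ_const_iff)
    show "(U has_vector_derivative - app C (Y t)) (at t within {0..})" if t: "0 \<le> t" for t
      unfolding has_vector_derivative_def has_derivative_within
    proof (intro conjI)
      show "bounded_linear (\<lambda>x. x *\<^sub>R - app C (Y t))" by (rule bounded_linear_scaleR_left)
      show "((\<lambda>y. (1 / norm (y - t)) *\<^sub>R (U y - (U t + (y - t) *\<^sub>R - app C (Y t)))) \<longlongrightarrow> 0) (at t within {0..})"
      proof (rule Lim_null_comparison)
        show "\<forall>\<^sub>F y in at t within {0..}. norm ((1 / norm (y - t)) *\<^sub>R (U y - (U t + (y - t) *\<^sub>R - app C (Y t)))) \<le> M * \<bar>y - t\<bar>"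
          unfolding eventually_at_filter
        proof (intro always_eventually allI impI)
          fix y :: real assume y: "y \<noteq> t" "y \<in> {0..}"
          define Z where "Z = U y - (U t + (y - t) *\<^sub>R - app C (Y t))"
          have "norm Z \<le> M * \<bar>y - t\<bar> * \<bar>y - t\<bar>"
            using quad[of y t] y t by (simp only: Z_def diff_diff_eq atLeast_iff)
          then show "norm ((1 / norm (y - t)) *\<^sub>R (U y - (U t + (y - t) *\<^sub>R - app C (Y t)))) \<le> M * \<bar>y - t\<bar>"
            unfolding Z_def[symmetric] using y by (simp add: pos_divide_le_eq)
        qed
        show "((\<lambda>y. M * \<bar>y - t\<bar>) \<longlongrightarrow> 0) (at t within {0..})"
          by (auto intro!: tendsto_eq_intros)
      qed
    qed
    show "(U t, GG (Y t)) \<in> V" for t by (simp add: U_def BV)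
    show "inner (GG (Y t)) h = inner (app C (Y t)) v" if "(v, h) \<in> V" for t v h
      using Bw[OF that, of "Y t"] by (simp add: CB inner_diff_left)
    show "norm (U t) \<le> norm u0" if "0 \<le> t" for t
      by (rule LIMSEQ_le_const2[OF tendsto_norm[OF Ulim[OF that]]]) (use Ele[OF that] in blast)
  qed
qed

subsection \<open>The Hilbert space of square-integrable functions\<close>

definition sqint :: "(pt \<Rightarrow> real) \<Rightarrow> bool" where
  "sqint f \<longleftrightarrow> f \<in> borel_measurable lborel \<and> integrable lborel (\<lambda>x. (f x)\<^sup>2)"

lemma sqint_measurable [measurable_dest]: "sqint f \<Longrightarrow> f \<in> borel_measurable lborel"
  by (simp add: sqint_def)

lemma sqint_iff: "sqint f \<longleftrightarrow> f \<in> borel_measurable lborel \<and> (\<integral>\<^sup>+ x. ennreal ((f x)\<^sup>2) \<partial>lborel) < \<infinity>"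
  by (auto simp: sqint_def integrable_iff_bounded)

lemma sqint_mult: assumes "sqint f" "sqint g" shows "integrable lborel (\<lambda>x. f x * g x)"
proof (rule Bochner_Integration.integrable_bound)
  show "integrable lborel (\<lambda>x. (f x)\<^sup>2 + (g x)\<^sup>2)" using assms by (auto simp: sqint_def)
  show "(\<lambda>x. f x * g x) \<in> borel_measurable lborel" using assms by (auto simp: sqint_def)
  have "\<bar>a * b\<bar> \<le> a\<^sup>2 + b\<^sup>2" for a b :: real
  proof -
    have "2 * \<bar>a * b\<bar> \<le> a\<^sup>2 + b\<^sup>2" using sum_squares_bound[of "\<bar>a\<bar>" "\<bar>b\<bar>"] by (simp add: abs_mult)
    then show ?thesis using zero_le_power2[of a] zero_le_power2[of b] by linarith
  qed
  then show "AE x in lborel. norm (f x * g x) \<le> norm ((f x)\<^sup>2 + (g x)\<^sup>2)"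
    by (intro AE_I2) (simp add: abs_of_nonneg)
qed

lemma sqint_add: assumes "sqint f" "sqint g" shows "sqint (\<lambda>x. f x + g x)"
proof -
  have "integrable lborel (\<lambda>x. (f x)\<^sup>2 + (g x)\<^sup>2 + 2 * (f x * g x))"
    using sqint_mult[OF assms] assms by (auto simp: sqint_def)
  then show ?thesis using assms by (auto simp: sqint_def power2_sum mult.assoc)
qed

lemma sqint_scale: "sqint f \<Longrightarrow> sqint (\<lambda>x. c * f x)" by (auto simp: sqint_def power_mult_distrib)
lemma sqint_zero: "sqint (\<lambda>x. 0)" by (auto simp: sqint_def)
lemma sqint_diff: "sqint f \<Longrightarrow> sqint g \<Longrightarrow> sqint (\<lambda>x. f x - g x)"
  using sqint_add[of f "\<lambda>x. -1 * g x"] sqint_scale[of g "-1"] by simp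

lemma AE_eq_comb:
  assumes "AE x in M. f x = g x" "AE x in M. f' x = g' x"
  shows "AE x in M. h (f x) (f' x) = h (g x) (g' x)"
  using assms by eventually_elim simp

\<comment> \<open>The functions live on the whole plane, so one Hilbert space serves every domain;
  the domain enters through supports and restrictions. The relation is partial in order to exclude
  functions that are not square integrable.\<close>
quotient_type l2 = "pt \<Rightarrow> real" / partial: "\<lambda>f g. sqint f \<and> sqint g \<and> (AE x in lborel. f x = g x)"
proof (rule part_equivpI)
  show "\<exists>f. sqint f \<and> sqint f \<and> (AE x in lborel. f x = f x)" using sqint_zero by auto
  show "symp (\<lambda>f g. sqint f \<and> sqint g \<and> (AE x in lborel. f x = g x))"
    by (rule sympI) (auto elim: AE_mp)
  show "transp (\<lambda>f g. sqint f \<and> sqint g \<and> (AE x in lborel. f x = g x))"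
  proof (rule transpI)
    fix f g h :: "pt \<Rightarrow> real"
    assume fg: "sqint f \<and> sqint g \<and> (AE x in lborel. f x = g x)"
      and gh: "sqint g \<and> sqint h \<and> (AE x in lborel. g x = h x)"
    then have "AE x in lborel. f x = g x" "AE x in lborel. g x = h x" by blast+
    then have "AE x in lborel. f x = h x" by eventually_elim simp
    then show "sqint f \<and> sqint h \<and> (AE x in lborel. f x = h x)" using fg gh by blast
  qed
qed

instantiation l2 :: real_inner
begin

lift_definition zero_l2 :: l2 is "\<lambda>x. 0" by (simp add: sqint_zero)
lift_definition plus_l2 :: "l2 \<Rightarrow> l2 \<Rightarrow> l2" is "\<lambda>f g x. f x + g x"
  by (auto intro: sqint_add AE_eq_comb[where h = "(+)"])
lift_definition minus_l2 :: "l2 \<Rightarrow> l2 \<Rightarrow> l2" is "\<lambda>f g x. f x - g x"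
  by (auto intro: sqint_diff AE_eq_comb[where h = "(-)"])
lift_definition uminus_l2 :: "l2 \<Rightarrow> l2" is "\<lambda>f x. - f x"
  by (auto simp: sqint_def elim!: AE_mp intro!: AE_I2)
lift_definition scaleR_l2 :: "real \<Rightarrow> l2 \<Rightarrow> l2" is "\<lambda>c f x. c * f x"
  by (auto intro: sqint_scale elim!: AE_mp intro!: AE_I2)
lift_definition inner_l2 :: "l2 \<Rightarrow> l2 \<Rightarrow> real" is "\<lambda>f g. \<integral>x. f x * g x \<partial>lborel"
  by (rule integral_cong_AE) (auto simp: sqint_def intro: AE_eq_comb[where h = "(*)"])
definition norm_l2 :: "l2 \<Rightarrow> real" where "norm_l2 f = sqrt (inner f f)"
definition sgn_l2 :: "l2 \<Rightarrow> l2" where "sgn_l2 f = inverse (norm f) *\<^sub>R f"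
definition dist_l2 :: "l2 \<Rightarrow> l2 \<Rightarrow> real" where "dist_l2 f g = norm (f - g)"
definition uniformity_l2 :: "(l2 \<times> l2) filter" where
  "uniformity_l2 = (INF e\<in>{0<..}. principal {(x, y). dist x y < e})"
definition open_l2 :: "l2 set \<Rightarrow> bool" where
  "open_l2 S = (\<forall>x\<in>S. \<forall>\<^sub>F (x', y) in uniformity. x' = x \<longrightarrow> y \<in> S)"

instance
proof
  fix f g h :: l2 and r s :: real
  show "f + g + h = f + (g + h)" "f + g = g + f" "0 + f = f" "- f + f = 0" "f - g = f + - g"
    "r *\<^sub>R (f + g) = r *\<^sub>R f + r *\<^sub>R g" "(r + s) *\<^sub>R f = r *\<^sub>R f + s *\<^sub>R f"
    "r *\<^sub>R s *\<^sub>R f = (r * s) *\<^sub>R f" "1 *\<^sub>R f = f"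
    by (transfer; auto simp: algebra_simps sqint_zero intro: sqint_add sqint_diff sqint_scale)+
  show "dist f g = norm (f - g)" by (rule dist_l2_def)
  show "sgn f = inverse (norm f) *\<^sub>R f" by (rule sgn_l2_def)
  show "uniformity = (INF e\<in>{0<..}. principal {(x, y :: l2). dist x y < e})" by (rule uniformity_l2_def)
  show "open U = (\<forall>x\<in>U. \<forall>\<^sub>F (x', y) in uniformity. x' = x \<longrightarrow> y \<in> U)" for U :: "l2 set"
    by (rule open_l2_def)
  show "inner f g = inner g f" by transfer (simp add: mult.commute)
  show "inner (f + g) h = inner f h + inner g h"
    by transfer (simp add: distrib_right sqint_mult)
  show "inner (r *\<^sub>R f) g = r * inner f g" by transfer (simp add: mult.assoc)
  show "0 \<le> inner f f" by transfer simp
  show "(inner f f = 0) = (f = 0)"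
    by transfer (auto simp: sqint_zero sqint_def power2_eq_square[symmetric] integral_nonneg_eq_0_iff_AE)
  show "norm f = sqrt (inner f f)" by (rule norm_l2_def)
qed

end

definition cls :: "(pt \<Rightarrow> real) \<Rightarrow> l2" where "cls = abs_l2"
definition rep :: "l2 \<Rightarrow> pt \<Rightarrow> real" where "rep = rep_l2"

lemma sqint_rep: "sqint (rep f)"
  using Quotient_rep_reflp[OF Quotient_l2] by (simp add: rep_def)

lemma cls_rep [simp]: "cls (rep f) = f"
  using Quotient_abs_rep[OF Quotient_l2] by (simp add: rep_def cls_def)

lemma cls_eq_iff: "sqint f \<Longrightarrow> sqint g \<Longrightarrow> cls f = cls g \<longleftrightarrow> (AE x in lborel. f x = g x)"
  using Quotient_rel[OF Quotient_l2, of f g] by (auto simp: cls_def)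

lemma rep_cls: "sqint f \<Longrightarrow> AE x in lborel. rep (cls f) x = f x"
  by (metis cls_eq_iff cls_rep sqint_rep)

lemma cls_add: "sqint f \<Longrightarrow> sqint g \<Longrightarrow> cls f + cls g = cls (\<lambda>x. f x + g x)"
  unfolding cls_def by (rule plus_l2.abs_eq) auto
lemma cls_diff: "sqint f \<Longrightarrow> sqint g \<Longrightarrow> cls f - cls g = cls (\<lambda>x. f x - g x)"
  unfolding cls_def by (rule minus_l2.abs_eq) auto
lemma cls_scale: "sqint f \<Longrightarrow> c *\<^sub>R cls f = cls (\<lambda>x. c * f x)"
  unfolding cls_def by (rule scaleR_l2.abs_eq) auto
lemma cls_zero: "0 = cls (\<lambda>x. 0)"
  unfolding cls_def by (rule zero_l2.abs_eq)
lemma inner_cls: "sqint f \<Longrightarrow> sqint g \<Longrightarrow> inner (cls f) (cls g) = (\<integral>x. f x * g x \<partial>lborel)"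
  unfolding cls_def by (rule inner_l2.abs_eq) auto
lemma norm_cls: "sqint f \<Longrightarrow> (norm (cls f))\<^sup>2 = (\<integral>x. (f x)\<^sup>2 \<partial>lborel)"
  unfolding power2_norm_eq_inner by (simp add: inner_cls power2_eq_square)

lemma nn_norm_cls: "sqint f \<Longrightarrow> (\<integral>\<^sup>+x. ennreal ((f x)\<^sup>2) \<partial>lborel) = ennreal ((norm (cls f))\<^sup>2)"
  unfolding norm_cls by (rule nn_integral_eq_integral) (auto simp: sqint_def)

text \<open>Riesz-Fischer: along a subsequence with geometrically small increments the sum of the
  absolute increments is in \<open>L^2\<close>, hence finite almost everywhere. Fatou's lemma
  identifies the pointwise limit as the \<open>L^2\<close> limit, and a Cauchy sequence with a
  convergent subsequence converges.\<close>

instance l2 :: complete_space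
proof
  fix X :: "nat \<Rightarrow> l2"
  assume X: "Cauchy X"
  have "\<exists>r. strict_mono r \<and> (\<forall>n. dist (X (r (Suc n))) (X (r n)) < (1/2)^n)"
  proof -
    obtain N where N: "\<And>k m n. m \<ge> N k \<Longrightarrow> n \<ge> N k \<Longrightarrow> dist (X m) (X n) < (1/2)^k"
      using metric_CauchyD[OF X, of "(1/2)^k" for k] by (metis zero_less_power half_gt_zero zero_less_one)
    define r where "r n = (\<Sum>k\<le>n. N k) + n" for n
    have "N n \<le> r n" for n
      unfolding r_def by (rule trans_le_add1) (rule member_le_sum; auto)
    moreover have "strict_mono r" by (auto simp: strict_mono_Suc_iff r_def)
    moreover have "r n \<le> r (Suc n)" for n by (simp add: r_def)
    ultimately show ?thesis using N by (metis order_trans)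
  qed
  then obtain r where r: "strict_mono r" and rd: "\<And>n. dist (X (r (Suc n))) (X (r n)) < (1/2)^n" by blast
  define f where "f n = rep (X (r n))" for n
  have f [measurable]: "f n \<in> borel_measurable lborel" and fs: "sqint (f n)" for n
    using sqint_rep[of "X (r n)"] by (auto simp: f_def sqint_def)
  have cf: "cls (f n) = X (r n)" for n by (simp add: f_def)
  define S where "S n x = (\<Sum>k<n. \<bar>f (Suc k) x - f k x\<bar>)" for n x
  \<comment> \<open>The right side is the sum of \<open>(1/2)^k\<close> over \<open>k < n\<close>;
    it stays below 2, whence the bound 4 on the squared norms.\<close>
  have Ss: "sqint (S n) \<and> norm (cls (S n)) \<le> 2 - 2 * (1/2)^n" for n
  proof (induction n)
    case 0 show ?case using sqint_zero cls_zero by (simp add: S_def)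
  next
    case (Suc n)
    define d where "d x = \<bar>f (Suc n) x - f n x\<bar>" for x
    have d: "sqint d" using sqint_diff[OF fs fs, of "Suc n" n] by (auto simp: sqint_def d_def[abs_def])
    have "(norm (cls d))\<^sup>2 = (norm (cls (f (Suc n)) - cls (f n)))\<^sup>2"
      unfolding cls_diff[OF fs fs] norm_cls[OF d] norm_cls[OF sqint_diff[OF fs fs]] by (simp add: d_def)
    then have nd: "norm (cls d) \<le> (1/2)^n" using rd[of n] by (simp add: cf dist_norm)
    have e: "S (Suc n) = (\<lambda>x. S n x + d x)" by (auto simp: S_def d_def)
    have "norm (cls (S (Suc n))) \<le> norm (cls (S n)) + norm (cls d)"
      unfolding e using cls_add[OF conjunct1[OF Suc] d] by (metis norm_triangle_ineq)
    then show ?case using Suc nd sqint_add[OF conjunct1[OF Suc] d] by (simp add: e)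
  qed
  have Sm [measurable]: "S n \<in> borel_measurable lborel" for n using Ss[of n] by (simp add: sqint_def)
  have S0: "0 \<le> S n x" for n x by (simp add: S_def sum_nonneg)
  have "(\<integral>\<^sup>+x. (SUP n. ennreal ((S n x)\<^sup>2)) \<partial>lborel) = (SUP n. \<integral>\<^sup>+x. ennreal ((S n x)\<^sup>2) \<partial>lborel)"
  proof (rule nn_integral_monotone_convergence_SUP)
    show "incseq (\<lambda>n x. ennreal ((S n x)\<^sup>2))"
      using S0 by (auto simp: incseq_Suc_iff le_fun_def S_def intro!: ennreal_leI power_mono sum_nonneg)
  qed measurable
  also have "\<dots> \<le> ennreal 4"
  proof (rule SUP_least)
    fix n
    have "norm (cls (S n)) \<le> 2" using Ss[of n] zero_le_power[of "1/2::real" n] by linarith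
    then have "(norm (cls (S n)))\<^sup>2 \<le> 2\<^sup>2" by (intro power_mono) auto
    then show "(\<integral>\<^sup>+x. ennreal ((S n x)\<^sup>2) \<partial>lborel) \<le> ennreal 4"
      unfolding nn_norm_cls[OF conjunct1[OF Ss]] by (intro ennreal_leI) simp
  qed
  finally have fin: "(\<integral>\<^sup>+x. (SUP n. ennreal ((S n x)\<^sup>2)) \<partial>lborel) \<noteq> \<infinity>"
    by (metis ennreal_neq_top infinity_ennreal_def top.extremum_unique)
  have "AE x in lborel. (SUP n. ennreal ((S n x)\<^sup>2)) \<noteq> \<infinity>"
    by (rule nn_integral_PInf_AE[OF _ fin]) measurable
  then have conv: "AE x in lborel. convergent (\<lambda>n. f n x)"
  proof (rule AE_mp, intro AE_I2 impI)
    fix x assume fin: "(SUP n. ennreal ((S n x)\<^sup>2)) \<noteq> \<infinity>"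
    obtain c where c: "(SUP n. ennreal ((S n x)\<^sup>2)) = ennreal c" "0 \<le> c"
      using fin by (metis ennreal_cases infinity_ennreal_def)
    have "(S n x)\<^sup>2 \<le> c" for n
      using SUP_upper[of n UNIV "\<lambda>n. ennreal ((S n x)\<^sup>2)"] c by (simp add: ennreal_le_iff)
    then have "S n x \<le> sqrt c" for n by (rule real_le_rsqrt)
    then have "(\<Sum>k\<le>n. \<bar>f (Suc k) x - f k x\<bar>) \<le> sqrt c" for n
      by (simp add: S_def lessThan_Suc_atMost[symmetric] del: sum.lessThan_Suc)
    then have "summable (\<lambda>k. \<bar>f (Suc k) x - f k x\<bar>)"
      by (intro bounded_imp_summable) auto
    then have "summable (\<lambda>k. f (Suc k) x - f k x)" by (rule summable_rabs_cancel)
    then have "convergent (\<lambda>n. \<Sum>k<n. f (Suc k) x - f k x)" by (simp add: summable_iff_convergent)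
    then have "convergent (\<lambda>n. f n x - f 0 x)" by (simp add: sum_lessThan_telescope[of "\<lambda>n. f n x"])
    then show "convergent (\<lambda>n. f n x)" using convergent_diff_const_right_iff[of "\<lambda>n. f n x" "f 0 x"] by simp
  qed
  define g where "g x = lim (\<lambda>n. f n x)" for x
  have g [measurable]: "g \<in> borel_measurable lborel" unfolding g_def by measurable
  have gl: "AE x in lborel. (\<lambda>n. f n x) \<longlonglongrightarrow> g x"
    using conv by (auto simp: g_def convergent_LIMSEQ_iff)
  \<comment> \<open>Fatou in the index \<open>m\<close>, with \<open>f n\<close> held fixed.\<close>
  have bd: "(\<integral>\<^sup>+x. ennreal ((g x - f n x)\<^sup>2) \<partial>lborel) \<le> ennreal e"
    if e: "\<And>m. m \<ge> n \<Longrightarrow> (norm (X (r m) - X (r n)))\<^sup>2 \<le> e" for n e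
  proof -
    have "(\<integral>\<^sup>+x. ennreal ((g x - f n x)\<^sup>2) \<partial>lborel) = (\<integral>\<^sup>+x. liminf (\<lambda>m. ennreal ((f m x - f n x)\<^sup>2)) \<partial>lborel)"
    proof (rule nn_integral_cong_AE)
      show "AE x in lborel. ennreal ((g x - f n x)\<^sup>2) = liminf (\<lambda>m. ennreal ((f m x - f n x)\<^sup>2))"
        using gl by (rule AE_mp) (intro AE_I2 impI lim_imp_Liminf[symmetric] tendsto_ennrealI tendsto_intros, auto)
    qed
    also have "\<dots> \<le> liminf (\<lambda>m. \<integral>\<^sup>+x. ennreal ((f m x - f n x)\<^sup>2) \<partial>lborel)"
      by (rule nn_integral_liminf) measurable
    also have "\<dots> = liminf (\<lambda>m. ennreal ((norm (X (r m) - X (r n)))\<^sup>2))"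
      using nn_norm_cls[OF sqint_diff[OF fs fs]] cls_diff[OF fs fs] by (simp add: cf)
    also have "\<dots> \<le> limsup (\<lambda>m. ennreal ((norm (X (r m) - X (r n)))\<^sup>2))" by (rule Liminf_le_Limsup) simp
    also have "\<dots> \<le> ennreal e"
      by (rule Limsup_bounded) (auto simp: eventually_sequentially intro!: exI[of _ n] ennreal_leI e)
    finally show ?thesis .
  qed
  have sgn: "sqint (\<lambda>x. g x - f n x)" for n
  proof -
    obtain B where B: "\<And>k. norm (X (r k)) \<le> B"
      using Cauchy_Bseq[OF Cauchy_subseq_Cauchy[OF X r]] by (auto simp: Bseq_def o_def)
    have "norm (X (r m) - X (r n)) \<le> B + B" for m
      using norm_triangle_ineq4[of "X (r m)" "X (r n)"] B[of m] B[of n] by linarith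
    then have "(norm (X (r m) - X (r n)))\<^sup>2 \<le> (B + B)\<^sup>2" for m by (intro power_mono) auto
    from le_less_trans[OF bd[OF this] ennreal_less_top] show ?thesis
      unfolding sqint_iff by (intro conjI borel_measurable_diff g f) simp
  qed
  have gs: "sqint g" using sqint_add[OF sgn[of 0] fs[of 0]] by simp
  have "(\<lambda>n. X (r n)) \<longlonglongrightarrow> cls g"
  proof (rule metric_LIMSEQ_I)
    fix e :: real assume e: "0 < e"
    have "Cauchy (X \<circ> r)" by (rule Cauchy_subseq_Cauchy[OF X r])
    then obtain M where M: "\<And>m n. m \<ge> M \<Longrightarrow> n \<ge> M \<Longrightarrow> dist (X (r m)) (X (r n)) < e / 2"
      using metric_CauchyD[of "X \<circ> r" "e / 2"] e by auto
    have "dist (X (r n)) (cls g) < e" if n: "n \<ge> M" for n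
    proof -
      have "(norm (X (r m) - X (r n)))\<^sup>2 \<le> (e/2)\<^sup>2" if "m \<ge> n" for m
        using M[of m n] n that by (intro power_mono) (auto simp: dist_norm)
      from bd[OF this] have "ennreal ((norm (cls g - cls (f n)))\<^sup>2) \<le> ennreal ((e/2)\<^sup>2)"
        using nn_norm_cls[OF sgn[of n]] cls_diff[OF gs fs] by simp
      then have "(norm (cls g - X (r n)))\<^sup>2 \<le> (e/2)\<^sup>2" by (simp add: cf ennreal_le_iff)
      then have "norm (cls g - X (r n)) \<le> e/2" using e by (simp add: power2_le_iff_abs_le)
      then show ?thesis using e by (simp add: dist_norm norm_minus_commute)
    qed
    then show "\<exists>no. \<forall>n\<ge>no. dist (X (r n)) (cls g) < e" by blast
  qed
  then have "X \<longlonglongrightarrow> cls g"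
    using Cauchy_converges_subseq[OF X r] by (simp add: o_def)
  then show "convergent X" by (auto simp: convergent_def)
qed

instance l2 :: banach ..

text \<open>The indicator of the unit square has a nonzero class, so every ball contains a second
  point. The operator algebra over \<open>l2\<close> demands this sort.\<close>

instance l2 :: perfect_space
proof
  fix x :: l2
  define b where "b = cls (indicator (cbox (0,0) (1,1)))"
  have e: "(\<lambda>x::pt. (indicator (cbox (0,0) (1,1)) x)\<^sup>2 :: real) = indicator (cbox (0,0) (1,1))"
    by (auto simp: indicator_def)
  have s: "sqint (indicator (cbox (0,0) (1,1)))" unfolding sqint_def e
    by (auto intro!: integrable_real_indicator simp: emeasure_lborel_cbox_eq)
  have "(norm b)\<^sup>2 = measure lborel (cbox (0,0) (1,1::real) :: pt set)"
    unfolding b_def norm_cls[OF s] e by simp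
  also have "\<dots> = 1" by (simp add: content_Pair)
  finally have "b \<noteq> 0" by auto
  show "\<not> open {x}"
  proof
    assume "open {x}"
    then obtain e where e: "e > 0" "ball x e \<subseteq> {x}" by (metis openE singletonI)
    have "x + (e / 2 / norm b) *\<^sub>R b \<in> ball x e" using e \<open>b \<noteq> 0\<close> by (simp add: dist_norm)
    then show False using e \<open>b \<noteq> 0\<close> by auto
  qed
qed

subsection \<open>Smooth functions and test functions\<close>

abbreviation has_grad :: "(pt \<Rightarrow> real) \<Rightarrow> real \<Rightarrow> real \<Rightarrow> pt \<Rightarrow> bool" where
  "has_grad f a b x \<equiv> (f has_derivative (\<lambda>h. fst h * a + snd h * b)) (at x)"

text \<open>A version of \<open>Ck\<close> localised to a set. Derivatives are taken in the full
  plane, so the notion is meant for open sets; continuity at positive orders comes from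
  differentiability.\<close>

primrec Ck_on :: "pt set \<Rightarrow> nat \<Rightarrow> (pt \<Rightarrow> real) \<Rightarrow> bool" where
  "Ck_on S 0 f = continuous_on S f"
| "Ck_on S (Suc k) f = (\<exists>g1 g2. Ck_on S k g1 \<and> Ck_on S k g2 \<and>
      (\<forall>x\<in>S. has_grad f (g1 x) (g2 x) x))"

definition smooth_on :: "pt set \<Rightarrow> (pt \<Rightarrow> real) \<Rightarrow> bool" where
  "smooth_on S f \<longleftrightarrow> (\<forall>k. Ck_on S k f)"

lemma Ck_on_SucI:
  assumes "Ck_on S k g1" "Ck_on S k g2"
    "\<And>x. x \<in> S \<Longrightarrow> has_grad f (g1 x) (g2 x) x"
  shows "Ck_on S (Suc k) f"
  unfolding Ck_on.simps using assms by blast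

lemma Ck_on_continuous: assumes "Ck_on S k f" shows "continuous_on S f"
proof (cases k)
  case 0
  then show ?thesis using assms by simp
next
  case (Suc j)
  then show ?thesis
    using assms unfolding Suc Ck_on.simps by (meson continuous_at_imp_continuous_on has_derivative_continuous)
qed

lemma Ck_iff_Ck_on: "Ck k f \<longleftrightarrow> Ck_on UNIV k f"
proof (induction k arbitrary: f)
  case (Suc k)
  have "Ck (Suc k) f \<longleftrightarrow> continuous_on UNIV f \<and> Ck_on UNIV (Suc k) f" by (simp add: Suc)
  then show ?case using Ck_on_continuous[of UNIV "Suc k" f] by blast
qed simp

lemma smooth2_iff: "smooth2 f \<longleftrightarrow> smooth_on UNIV f"
  by (simp add: smooth2_def smooth_on_def Ck_iff_Ck_on)

lemma Ck_on_Suc_imp: "Ck_on S (Suc k) f \<Longrightarrow> Ck_on S k f"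
proof (induction k arbitrary: f)
  case 0
  then show ?case using Ck_on_continuous[OF 0] by simp
next
  case (Suc k)
  obtain g1 g2 where "Ck_on S (Suc k) g1" "Ck_on S (Suc k) g2"
    "\<And>x. x \<in> S \<Longrightarrow> has_grad f (g1 x) (g2 x) x" using Suc.prems by auto
  then show ?case using Suc.IH by (intro Ck_on_SucI[of S k g1 g2]) blast+
qed

lemma Ck_on_cong:
  assumes "open S" "\<And>x. x \<in> S \<Longrightarrow> f x = g x" "Ck_on S k f"
  shows "Ck_on S k g"
proof (cases k)
  case 0
  then show ?thesis using assms by (simp cong: continuous_on_cong)
next
  case (Suc j)
  then obtain g1 g2 where g: "Ck_on S j g1" "Ck_on S j g2"
    "\<And>x. x \<in> S \<Longrightarrow> has_grad f (g1 x) (g2 x) x" using assms(3) Suc by auto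
  have "has_grad g (g1 x) (g2 x) x" if "x \<in> S" for x
    by (rule has_derivative_transform_within_open[OF g(3)[OF that] assms(1) that]) (simp add: assms(2))
  then show ?thesis unfolding Suc by (rule Ck_on_SucI[OF g(1,2)])
qed

lemma Ck_on_const: "Ck_on S k (\<lambda>_. c)"
proof (induction k arbitrary: c)
  case (Suc k)
  show ?case using Suc[of 0] by (auto intro!: exI[of _ "\<lambda>_. 0"])
qed simp

lemma Ck_on_add: "Ck_on S k f \<Longrightarrow> Ck_on S k g \<Longrightarrow> Ck_on S k (\<lambda>x. f x + g x)"
proof (induction k arbitrary: f g)
  case 0
  then show ?case by (simp add: continuous_on_add)
next
  case (Suc k)
  obtain f1 f2 where f: "Ck_on S k f1" "Ck_on S k f2"
    "\<And>x. x \<in> S \<Longrightarrow> has_grad f (f1 x) (f2 x) x" using Suc.prems(1) by auto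
  obtain g1 g2 where g: "Ck_on S k g1" "Ck_on S k g2"
    "\<And>x. x \<in> S \<Longrightarrow> has_grad g (g1 x) (g2 x) x" using Suc.prems(2) by auto
  have "has_grad (\<lambda>x. f x + g x) (f1 x + g1 x) (f2 x + g2 x) x" if "x \<in> S" for x
    by (rule has_derivative_eq_rhs[OF has_derivative_add[OF f(3)[OF that] g(3)[OF that]]]) (simp add: algebra_simps)
  then show ?case by (rule Ck_on_SucI[OF Suc.IH[OF f(1) g(1)] Suc.IH[OF f(2) g(2)]])
qed

lemma has_derivative_pt_mult:
  fixes f g :: "pt \<Rightarrow> real"
  assumes "has_grad f f1 f2 x"
    "has_grad g g1 g2 x"
  shows "has_grad (\<lambda>x. f x * g x) (f1 * g x + f x * g1) (f2 * g x + f x * g2) x"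
  by (rule has_derivative_eq_rhs[OF has_derivative_mult[OF assms]]) (simp add: algebra_simps)

lemma has_derivative_pt_comp:
  fixes f :: "pt \<Rightarrow> real"
  assumes "has_grad f f1 f2 x"
    "(J has_real_derivative j) (at (f x))"
  shows "has_grad (\<lambda>x. J (f x)) (j * f1) (j * f2) x"
  by (rule has_derivative_eq_rhs[OF has_derivative_compose[OF assms(1) assms(2)[unfolded has_field_derivative_def]]])
     (simp add: algebra_simps)

lemma has_derivative_pt_unique:
  fixes f :: "pt \<Rightarrow> real"
  assumes "has_grad f f1 f2 x"
    "has_grad f g1 g2 x"
  shows "f1 = g1" "f2 = g2"
proof -
  have e: "(\<lambda>h::pt. fst h * f1 + snd h * f2) = (\<lambda>h. fst h * g1 + snd h * g2)"
    by (rule has_derivative_unique[OF assms])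
  show "f1 = g1" using fun_cong[OF e, of "(1,0)"] by simp
  show "f2 = g2" using fun_cong[OF e, of "(0,1)"] by simp
qed

lemma Ck_on_mult: "Ck_on S k f \<Longrightarrow> Ck_on S k g \<Longrightarrow> Ck_on S k (\<lambda>x. f x * g x)"
proof (induction k arbitrary: f g)
  case 0
  then show ?case by (simp add: continuous_on_mult)
next
  case (Suc k)
  obtain f1 f2 where f: "Ck_on S k f1" "Ck_on S k f2"
    "\<And>x. x \<in> S \<Longrightarrow> has_grad f (f1 x) (f2 x) x" using Suc.prems(1) by auto
  obtain g1 g2 where g: "Ck_on S k g1" "Ck_on S k g2"
    "\<And>x. x \<in> S \<Longrightarrow> has_grad g (g1 x) (g2 x) x" using Suc.prems(2) by auto
  have fg: "Ck_on S k f" "Ck_on S k g" using Suc.prems Ck_on_Suc_imp by blast+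
  show ?case unfolding Ck_on.simps
  proof (intro exI conjI ballI)
    show "has_grad (\<lambda>x. f x * g x) (f1 x * g x + f x * g1 x) (f2 x * g x + f x * g2 x) x" if "x \<in> S" for x
      by (rule has_derivative_pt_mult[OF f(3)[OF that] g(3)[OF that]])
  qed (intro Ck_on_add Suc.IH f g fg)+
qed

lemma smooth_on_const: "smooth_on S (\<lambda>_. c)" by (simp add: smooth_on_def Ck_on_const)
lemma smooth_on_add: "smooth_on S f \<Longrightarrow> smooth_on S g \<Longrightarrow> smooth_on S (\<lambda>x. f x + g x)"
  by (simp add: smooth_on_def Ck_on_add)
lemma smooth_on_mult: "smooth_on S f \<Longrightarrow> smooth_on S g \<Longrightarrow> smooth_on S (\<lambda>x. f x * g x)"
  by (simp add: smooth_on_def Ck_on_mult)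

text \<open>Avoids formulas for higher derivatives: a family stable under both partial derivatives
  can be differentiated without end. It serves for complex powers and affine functions.\<close>

lemma smooth_on_family:
  assumes "\<And>f. f \<in> F \<Longrightarrow> \<exists>g1\<in>F. \<exists>g2\<in>F. \<forall>x\<in>S. has_grad f (g1 x) (g2 x) x"
    and "f \<in> F"
  shows "smooth_on S f"
proof -
  have "\<forall>f\<in>F. Ck_on S k f" for k
  proof (induction k)
    case 0
    show ?case
    proof
      fix f assume "f \<in> F"
      with assms(1) have "Ck_on S (Suc 0) f \<or> continuous_on S f"
        by (meson continuous_at_imp_continuous_on has_derivative_continuous)
      then show "Ck_on S 0 f" by (metis Ck_on.simps(1) Ck_on_continuous)
    qed
  next
    case (Suc k)
    show ?case
    proof
      fix f assume "f \<in> F"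
      then obtain g1 g2 where g: "g1 \<in> F" "g2 \<in> F"
        "\<And>x. x \<in> S \<Longrightarrow> has_grad f (g1 x) (g2 x) x" using assms(1) by meson
      show "Ck_on S (Suc k) f" by (rule Ck_on_SucI[OF _ _ g(3)]) (use g Suc in auto)
    qed
  qed
  then show ?thesis using assms(2) by (simp add: smooth_on_def)
qed

text \<open>The one-variable counterpart of such a family, for outer functions in compositions:
  \<open>flat\<close>, its reflections and \<open>exp\<close>.\<close>

definition deriv_closed :: "(real \<Rightarrow> real) set \<Rightarrow> bool" where
  "deriv_closed F \<longleftrightarrow> (\<forall>J\<in>F. \<exists>J'\<in>F. \<forall>x. (J has_real_derivative J' x) (at x))"

lemma smooth_on_compose:
  assumes F: "deriv_closed F" and "J \<in> F" and f: "smooth_on S f"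
  shows "smooth_on S (\<lambda>x. J (f x))"
proof -
  have "\<forall>J\<in>F. Ck_on S k (\<lambda>x. J (f x))" for k
  proof (induction k)
    case 0
    show ?case
    proof
      fix J assume "J \<in> F"
      then have "continuous_on UNIV J"
        using F unfolding deriv_closed_def by (metis DERIV_continuous continuous_at_imp_continuous_on)
      moreover have "continuous_on S f" using f Ck_on_continuous unfolding smooth_on_def by blast
      ultimately show "Ck_on S 0 (\<lambda>x. J (f x))" using continuous_on_compose2[of UNIV J S f] by simp
    qed
  next
    case (Suc k)
    show ?case
    proof
      fix J assume "J \<in> F"
      then obtain J' where J': "J' \<in> F" "\<And>x. (J has_real_derivative J' x) (at x)"
        using F unfolding deriv_closed_def by blast
      have "Ck_on S (Suc k) f" using f unfolding smooth_on_def by blast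
      then obtain f1 f2 where g: "Ck_on S k f1" "Ck_on S k f2"
        "\<And>x. x \<in> S \<Longrightarrow> has_grad f (f1 x) (f2 x) x" by auto
      show "Ck_on S (Suc k) (\<lambda>x. J (f x))" unfolding Ck_on.simps
      proof (intro exI conjI ballI)
        show "has_grad (\<lambda>x. J (f x)) (J' (f x) * f1 x) (J' (f x) * f2 x) x"
          if "x \<in> S" for x by (rule has_derivative_pt_comp[OF g(3)[OF that] J'(2)])
        show "Ck_on S k (\<lambda>x. J' (f x) * f1 x)" "Ck_on S k (\<lambda>x. J' (f x) * f2 x)"
          using Suc J'(1) g by (auto intro: Ck_on_mult)
      qed
    qed
  qed
  then show ?thesis using assms(2) by (simp add: smooth_on_def)
qed

text \<open>Uniqueness of the gradient identifies \<open>g1\<close> and \<open>g2\<close> with the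
  partial derivatives that \<open>Ck_on\<close> provides separately at each order.\<close>

lemma smooth_on_partial:
  assumes "open S" "smooth_on S f"
    and d: "\<And>x. x \<in> S \<Longrightarrow> has_grad f (g1 x) (g2 x) x"
  shows "smooth_on S g1" "smooth_on S g2"
proof -
  have "Ck_on S k g1 \<and> Ck_on S k g2" for k
  proof -
    have "Ck_on S (Suc k) f" using assms(2) unfolding smooth_on_def by blast
    then obtain f1 f2 where f: "Ck_on S k f1" "Ck_on S k f2"
      "\<And>x. x \<in> S \<Longrightarrow> has_grad f (f1 x) (f2 x) x" by auto
    have "f1 x = g1 x" "f2 x = g2 x" if "x \<in> S" for x
      using has_derivative_pt_unique[OF f(3)[OF that] d[OF that]] by auto
    then show ?thesis using Ck_on_cong[OF assms(1)] f by blast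
  qed
  then show "smooth_on S g1" "smooth_on S g2" by (auto simp: smooth_on_def)
qed

text \<open>Off \<open>K\<close> the function vanishes on an open set, so its gradient vanishes
  there as well. The gradient extended by 0 thus satisfies the same hypotheses, and induction on the
  order applies.\<close>

lemma Ck_on_zero_extend:
  assumes "open S" "closed K" "K \<subseteq> S" "Ck_on S k f" "\<And>x. x \<notin> K \<Longrightarrow> f x = 0"
  shows "Ck_on UNIV k f"
  using assms(4,5)
proof (induction k arbitrary: f)
  case 0
  have "continuous_on (S \<union> - K) f"
  proof (rule continuous_on_open_Un)
    show "continuous_on (- K) f" using 0 by (subst continuous_on_cong[where g = "\<lambda>_. 0"]) auto
  qed (use 0 assms in auto)
  moreover have "S \<union> - K = UNIV" using assms by auto
  ultimately show ?case by simp
next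
  case (Suc k)
  obtain g1 g2 where g: "Ck_on S k g1" "Ck_on S k g2"
    "\<And>x. x \<in> S \<Longrightarrow> has_grad f (g1 x) (g2 x) x" using Suc.prems(1) by auto
  have zero: "has_grad f 0 0 x" if "x \<notin> K" for x
  proof -
    have "has_grad (\<lambda>x::pt. 0::real) 0 0 x" by simp
    then show ?thesis
      by (rule has_derivative_transform_within_open[of _ _ _ _ "- K"]) (use that assms(2) Suc.prems in auto)
  qed
  define e1 where "e1 x = (if x \<in> S then g1 x else 0)" for x
  define e2 where "e2 x = (if x \<in> S then g2 x else 0)" for x
  have e0: "e1 x = 0" "e2 x = 0" if "x \<notin> K" for x
    using has_derivative_pt_unique[OF g(3)[of x] zero[OF that]] by (auto simp: e1_def e2_def)
  have "Ck_on S k e1" "Ck_on S k e2" using Ck_on_cong[OF assms(1) _ g(1), of e1] Ck_on_cong[OF assms(1) _ g(2), of e2]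
    by (auto simp: e1_def e2_def)
  then have "Ck_on UNIV k e1" "Ck_on UNIV k e2" using Suc.IH e0 by blast+
  moreover have "has_grad f (e1 x) (e2 x) x" for x
  proof (cases "x \<in> S")
    case True
    then show ?thesis using g(3) by (simp add: e1_def e2_def)
  next
    case False
    then have "x \<notin> K" using assms(3) by auto
    then show ?thesis using zero e0 by metis
  qed
  ultimately show ?case by (intro Ck_on_SucI[of UNIV k e1 e2]) blast+
qed

lemma smooth_on_zero_extend:
  assumes "open S" "closed K" "K \<subseteq> S" "smooth_on S f" "\<And>x. x \<notin> K \<Longrightarrow> f x = 0"
  shows "smooth_on UNIV f"
  using Ck_on_zero_extend[OF assms(1-3) _ assms(5)] assms(4) by (auto simp: smooth_on_def)

section \<open>Smooth functions flat at the origin\<close>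

definition flat :: "real poly \<Rightarrow> real \<Rightarrow> real" where
  "flat p x = (if 0 < x then x\<^sup>2 * poly p (1 / x) * exp (- (1 / x)) else 0)"

text \<open>With \<open>y = 1 / x\<close> the derivative of \<open>x^2 p(y) exp (- y)\<close> is
  \<open>x^2 (2 y p - y^2 p' + y^2 p) exp (- y)\<close>, so the range of \<open>flat\<close> is
  stable under differentiation. The prefactor \<open>x^2\<close> permits the linear and quadratic
  growth of the functions built from it below.\<close>

definition flat_deriv :: "real poly \<Rightarrow> real poly" where
  "flat_deriv p = [:0, 2:] * p - [:0, 0, 1:] * pderiv p + [:0, 0, 1:] * p"

lemma poly_times_exp_tendsto_0: "((\<lambda>y::real. poly p y * exp (- y)) \<longlongrightarrow> 0) at_top"
proof -
  have "((\<lambda>y::real. \<Sum>i\<le>degree p. coeff p i * (y ^ i / exp y)) \<longlongrightarrow> (\<Sum>i\<le>degree p. coeff p i * 0)) at_top"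
    by (intro tendsto_sum tendsto_mult tendsto_const tendsto_power_div_exp_0)
  then show ?thesis by (simp add: poly_altdef exp_minus sum_distrib_right divide_inverse mult.assoc)
qed

lemma flat_has_real_derivative: "(flat p has_real_derivative flat (flat_deriv p) x) (at x)"
proof -
  consider "x > 0" | "x < 0" | "x = 0" by linarith
  then show ?thesis
  proof cases
    case 1
    have "((\<lambda>x. x\<^sup>2 * poly p (1 / x) * exp (- (1 / x))) has_real_derivative flat (flat_deriv p) x) (at x)"
      using 1
      by (auto intro!: derivative_eq_intros DERIV_chain2[OF poly_DERIV] simp: flat_def flat_deriv_def field_simps power2_eq_square)
    then show ?thesis
      by (rule has_field_derivative_transform_within_open[of _ _ _ "{0<..}"]) (use 1 in \<open>auto simp: flat_def\<close>)
  next
    case 2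
    have "((\<lambda>x. 0) has_real_derivative flat (flat_deriv p) x) (at x)" using 2 by (simp add: flat_def)
    then show ?thesis
      by (rule has_field_derivative_transform_within_open[of _ _ _ "{..<0}"]) (use 2 in \<open>auto simp: flat_def\<close>)
  next
    case 3
    \<comment> \<open>From the right the difference quotient is \<open>h p(1/h) exp (- 1/h)\<close>,
      where the exponential beats the polynomial; from the left it is 0.\<close>
    have lim: "((\<lambda>h. flat p h / h) \<longlongrightarrow> 0) (at_right 0)"
    proof -
      have "((\<lambda>h. h * (poly p (inverse h) * exp (- inverse h))) \<longlongrightarrow> 0 * 0) (at_right (0::real))"
        by (intro tendsto_mult tendsto_ident_at filterlim_compose[OF poly_times_exp_tendsto_0 filterlim_inverse_at_top_right])
      moreover have "\<forall>\<^sub>F h in at_right 0. h * (poly p (inverse h) * exp (- inverse h)) = flat p h / h"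
        by (auto simp: eventually_at_filter flat_def inverse_eq_divide power2_eq_square)
      ultimately show ?thesis by (simp add: tendsto_cong)
    qed
    have "((\<lambda>h. flat p h / h) \<longlongrightarrow> 0) (at_left 0)"
      by (rule tendsto_eventually) (auto simp: eventually_at_filter flat_def)
    with lim have "((\<lambda>h. flat p h / h) \<longlongrightarrow> 0) (at 0)" by (simp add: filterlim_at_split)
    then show ?thesis using 3 by (simp add: DERIV_def flat_def)
  qed
qed

lemma deriv_closed_flat: "deriv_closed (range flat)"
  unfolding deriv_closed_def using flat_has_real_derivative by blast

section \<open>Calculus of test functions\<close>

lemma test_fnI:
  assumes "smooth_on UNIV f" "\<And>x. has_grad f (g1 x) (g2 x) x"
    and "compact K" "K \<subseteq> \<Omega>" "\<And>x. x \<notin> K \<Longrightarrow> f x = 0"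
  shows "test_fn \<Omega> f g1 g2"
proof -
  have "closure {x. f x \<noteq> 0} \<subseteq> K"
    by (rule closure_minimal) (use assms(3,5) compact_imp_closed in auto)
  moreover from this have "compact (closure {x. f x \<noteq> 0})"
    using assms(3) compact_Int_closed[of K "closure {x. f x \<noteq> 0}"] by (simp add: Int_absorb1)
  ultimately show ?thesis unfolding test_fn_def smooth2_iff using assms by blast
qed

lemma test_fnD:
  assumes "test_fn \<Omega> f g1 g2"
  shows "smooth_on UNIV f" "has_grad f (g1 x) (g2 x) x"
    "compact (closure {x. f x \<noteq> 0})" "closure {x. f x \<noteq> 0} \<subseteq> \<Omega>"
    "x \<notin> closure {x. f x \<noteq> 0} \<Longrightarrow> f x = 0"
    "x \<notin> closure {x. f x \<noteq> 0} \<Longrightarrow> g1 x = 0"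
    "x \<notin> closure {x. f x \<noteq> 0} \<Longrightarrow> g2 x = 0"
proof -
  show d: "has_grad f (g1 x) (g2 x) x"
    using assms unfolding test_fn_def by blast
  show "smooth_on UNIV f" "compact (closure {x. f x \<noteq> 0})" "closure {x. f x \<noteq> 0} \<subseteq> \<Omega>"
    using assms unfolding test_fn_def smooth2_iff by blast+
  have off: "f y = 0" if "y \<notin> closure {x. f x \<noteq> 0}" for y
    using closure_subset[of "{x. f x \<noteq> 0}"] that by auto
  assume x: "x \<notin> closure {x. f x \<noteq> 0}"
  show "f x = 0" by (rule off[OF x])
  have "has_grad (\<lambda>x::pt. 0::real) 0 0 x" by simp
  then have "has_grad f 0 0 x"
  proof (rule has_derivative_transform_within_open[of _ _ _ _ "- closure {x. f x \<noteq> 0}"])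
    show "open (- closure {x. f x \<noteq> 0})" by (rule open_Compl[OF closed_closure])
    show "x \<in> - closure {x. f x \<noteq> 0}" unfolding Compl_iff by (rule x)
    show "0 = f y" if "y \<in> - closure {x. f x \<noteq> 0}" for y by (rule off[OF ComplD[OF that], symmetric])
  qed
  from has_derivative_pt_unique[OF d this] show "g1 x = 0" "g2 x = 0" by auto
qed

lemma test_fn_partial_smooth:
  assumes "test_fn \<Omega> f g1 g2"
  shows "smooth_on UNIV g1" "smooth_on UNIV g2"
  by (rule smooth_on_partial[OF open_UNIV test_fnD(1)[OF assms] test_fnD(2)[OF assms]])+

lemma smooth_on_UNIV_gradient:
  assumes "smooth_on UNIV f"
  shows "\<exists>g1 g2. \<forall>x. has_grad f (g1 x) (g2 x) x"
proof -
  have "Ck_on UNIV (Suc 0) f" using assms unfolding smooth_on_def by blast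
  then show ?thesis unfolding Ck_on.simps by blast
qed

lemma test_fn_partial:
  assumes "test_fn \<Omega> f g1 g2"
  shows "\<exists>a b. test_fn \<Omega> g1 a b" "\<exists>a b. test_fn \<Omega> g2 a b"
proof -
  obtain a b where ab: "\<forall>x. has_grad g1 (a x) (b x) x"
    using smooth_on_UNIV_gradient[OF test_fn_partial_smooth(1)[OF assms]] by blast
  have "test_fn \<Omega> g1 a b"
    by (rule test_fnI[OF test_fn_partial_smooth(1)[OF assms] spec[OF ab] test_fnD(3,4,6)[OF assms]])
  then show "\<exists>a b. test_fn \<Omega> g1 a b" by blast
  obtain c d where cd: "\<forall>x. has_grad g2 (c x) (d x) x"
    using smooth_on_UNIV_gradient[OF test_fn_partial_smooth(2)[OF assms]] by blast
  have "test_fn \<Omega> g2 c d"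
    by (rule test_fnI[OF test_fn_partial_smooth(2)[OF assms] spec[OF cd] test_fnD(3,4,7)[OF assms]])
  then show "\<exists>a b. test_fn \<Omega> g2 a b" by blast
qed

lemma test_fn_lincomb:
  assumes f: "test_fn \<Omega> f f1 f2" and g: "test_fn \<Omega> g g1 g2"
  shows "test_fn \<Omega> (\<lambda>x. r * f x + s * g x) (\<lambda>x. r * f1 x + s * g1 x) (\<lambda>x. r * f2 x + s * g2 x)"
proof (rule test_fnI[where K = "closure {x. f x \<noteq> 0} \<union> closure {x. g x \<noteq> 0}"])
  show "smooth_on UNIV (\<lambda>x. r * f x + s * g x)"
    by (intro smooth_on_add smooth_on_mult smooth_on_const test_fnD(1)[OF f] test_fnD(1)[OF g])
  show "has_grad (\<lambda>x. r * f x + s * g x) (r * f1 x + s * g1 x) (r * f2 x + s * g2 x) x" for x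
    by (rule has_derivative_eq_rhs[OF has_derivative_add[OF has_derivative_mult_right[OF test_fnD(2)[OF f]] has_derivative_mult_right[OF test_fnD(2)[OF g]]]])
       (simp add: algebra_simps)
  show "compact (closure {x. f x \<noteq> 0} \<union> closure {x. g x \<noteq> 0})"
    by (rule compact_Un[OF test_fnD(3)[OF f] test_fnD(3)[OF g]])
  show "closure {x. f x \<noteq> 0} \<union> closure {x. g x \<noteq> 0} \<subseteq> \<Omega>"
    using test_fnD(4)[OF f] test_fnD(4)[OF g] by (rule Un_least)
  show "r * f x + s * g x = 0" if "x \<notin> closure {x. f x \<noteq> 0} \<union> closure {x. g x \<noteq> 0}" for x
    using that test_fnD(5)[OF f, of x] test_fnD(5)[OF g, of x] by simp
qed

lemma test_fn_zero: "test_fn \<Omega> (\<lambda>_. 0) (\<lambda>_. 0) (\<lambda>_. 0)"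
  by (rule test_fnI[of _ _ _ "{}"]) (auto simp: smooth_on_const)

lemma test_fn_mult:
  assumes f: "test_fn \<Omega> f f1 f2" and g: "test_fn \<Omega> g g1 g2"
  shows "test_fn \<Omega> (\<lambda>x. f x * g x) (\<lambda>x. f1 x * g x + f x * g1 x) (\<lambda>x. f2 x * g x + f x * g2 x)"
proof (rule test_fnI[where K = "closure {x. f x \<noteq> 0}"])
  show "smooth_on UNIV (\<lambda>x. f x * g x)" by (intro smooth_on_mult test_fnD(1)[OF f] test_fnD(1)[OF g])
  show "has_grad (\<lambda>x. f x * g x) (f1 x * g x + f x * g1 x) (f2 x * g x + f x * g2 x) x" for x
    by (rule has_derivative_pt_mult[OF test_fnD(2)[OF f] test_fnD(2)[OF g]])
  show "f x * g x = 0" if "x \<notin> closure {x. f x \<noteq> 0}" for x using test_fnD(5)[OF f that] by simp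
qed (rule test_fnD(3,4)[OF f])+

lemma test_fn_compose:
  assumes f: "test_fn \<Omega> f f1 f2" and F: "deriv_closed F" "J \<in> F" "J 0 = 0"
    and J: "\<And>s. (J has_real_derivative J' s) (at s)"
  shows "test_fn \<Omega> (\<lambda>x. J (f x)) (\<lambda>x. J' (f x) * f1 x) (\<lambda>x. J' (f x) * f2 x)"
proof (rule test_fnI[where K = "closure {x. f x \<noteq> 0}"])
  show "smooth_on UNIV (\<lambda>x. J (f x))" by (rule smooth_on_compose[OF F(1,2) test_fnD(1)[OF f]])
  show "has_grad (\<lambda>x. J (f x)) (J' (f x) * f1 x) (J' (f x) * f2 x) x" for x
    by (rule has_derivative_pt_comp[OF test_fnD(2)[OF f] J])
  show "J (f x) = 0" if "x \<notin> closure {x. f x \<noteq> 0}" for x using test_fnD(5)[OF f that] F(3) by simp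
qed (rule test_fnD(3,4)[OF f])+

lemma compact_support_integrable:
  fixes f :: "pt \<Rightarrow> real"
  assumes "continuous_on UNIV f" "compact K" "\<And>x. x \<notin> K \<Longrightarrow> f x = 0"
  shows "integrable lborel f"
proof -
  have "integrable lborel (\<lambda>x. indicator K x *\<^sub>R f x)"
    by (rule borel_integrable_compact[OF assms(2)]) (rule continuous_on_subset[OF assms(1)], simp)
  moreover have "(\<lambda>x. indicator K x *\<^sub>R f x) = f" using assms(3) by (auto simp: indicator_def fun_eq_iff)
  ultimately show ?thesis by simp
qed

lemma compact_support_sqint:
  assumes "continuous_on UNIV f" "compact K" "\<And>x. x \<notin> K \<Longrightarrow> f x = 0"
  shows "sqint f"
  unfolding sqint_def
proof
  show "f \<in> borel_measurable lborel" using borel_measurable_continuous_onI[OF assms(1)] by simp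
  show "integrable lborel (\<lambda>x. (f x)\<^sup>2)"
    by (rule compact_support_integrable[OF continuous_on_power[OF assms(1)] assms(2)]) (simp add: assms(3))
qed

lemma smooth_on_UNIV_continuous: "smooth_on UNIV f \<Longrightarrow> continuous_on UNIV f"
  unfolding smooth_on_def using Ck_on_continuous by blast

lemma test_fn_sqint:
  assumes "test_fn \<Omega> f g1 g2"
  shows "sqint f" "sqint g1" "sqint g2"
proof -
  note K = test_fnD(3)[OF assms]
  show "sqint f"
    by (rule compact_support_sqint[OF smooth_on_UNIV_continuous[OF test_fnD(1)[OF assms]] K]) (rule test_fnD(5)[OF assms])
  show "sqint g1"
    by (rule compact_support_sqint[OF smooth_on_UNIV_continuous[OF test_fn_partial_smooth(1)[OF assms]] K]) (rule test_fnD(6)[OF assms])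
  show "sqint g2"
    by (rule compact_support_sqint[OF smooth_on_UNIV_continuous[OF test_fn_partial_smooth(2)[OF assms]] K]) (rule test_fnD(7)[OF assms])
qed

lemma test_fn_integrable:
  assumes "test_fn \<Omega> f g1 g2"
  shows "integrable lborel f" "integrable lborel g1" "integrable lborel g2"
proof -
  note K = test_fnD(3)[OF assms]
  show "integrable lborel f"
    by (rule compact_support_integrable[OF smooth_on_UNIV_continuous[OF test_fnD(1)[OF assms]] K]) (rule test_fnD(5)[OF assms])
  show "integrable lborel g1"
    by (rule compact_support_integrable[OF smooth_on_UNIV_continuous[OF test_fn_partial_smooth(1)[OF assms]] K]) (rule test_fnD(6)[OF assms])
  show "integrable lborel g2"
    by (rule compact_support_integrable[OF smooth_on_UNIV_continuous[OF test_fn_partial_smooth(2)[OF assms]] K]) (rule test_fnD(7)[OF assms])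
qed

section \<open>Integration by parts\<close>

lemma integral_derivative_compact_support:
  fixes F :: "real \<Rightarrow> real"
  assumes "\<And>x. (F has_real_derivative f x) (at x)" "continuous_on UNIV f"
    and "\<And>x. R \<le> \<bar>x\<bar> \<Longrightarrow> F x = 0" "\<And>x. R \<le> \<bar>x\<bar> \<Longrightarrow> f x = 0" "0 < R"
  shows "(\<integral>x. f x \<partial>lborel) = 0"
proof -
  have "(\<integral>x. f x * indicator {- R .. R} x \<partial>lborel) = F R - F (- R)"
    by (rule integral_FTC_Icc_real) (use assms in \<open>auto simp: continuous_on_eq_continuous_at\<close>)
  moreover have "(\<lambda>x. f x * indicator {- R .. R} x) = f"
  proof
    fix x show "f x * indicator {- R .. R} x = f x"
      using assms(4)[of x] by (cases "R \<le> \<bar>x\<bar>") (auto simp: indicator_def)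
  qed
  ultimately show ?thesis using assms(3,5) by simp
qed

text \<open>Fubini reduces the claim to coordinate lines, where the fundamental theorem of calculus
  evaluates a compactly supported function at two points off its support.\<close>

lemma integral_partial_eq_0:
  assumes "test_fn \<Omega> f g1 g2"
  shows "(\<integral>x. g1 x \<partial>lborel) = 0" "(\<integral>x. g2 x \<partial>lborel) = 0"
proof -
  define K where "K = closure {x. f x \<noteq> 0}"
  have K: "compact K" and off: "\<And>x. x \<notin> K \<Longrightarrow> f x = 0" "\<And>x. x \<notin> K \<Longrightarrow> g1 x = 0" "\<And>x. x \<notin> K \<Longrightarrow> g2 x = 0"
    unfolding K_def by (fact test_fnD(3)[OF assms] test_fnD(5)[OF assms] test_fnD(6)[OF assms] test_fnD(7)[OF assms])+
  obtain R0 where R0: "\<And>x. x \<in> K \<Longrightarrow> norm x \<le> R0"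
    using compact_imp_bounded[OF K] unfolding bounded_iff by blast
  \<comment> \<open>The extra 1 puts all points with a coordinate of absolute value \<open>R\<close>
    or more strictly outside the support.\<close>
  define R where "R = max R0 0 + 1"
  have R: "0 < R" "R0 < R" by (auto simp: R_def)
  have notK: "(x, y) \<notin> K" if "R \<le> \<bar>x\<bar> \<or> R \<le> \<bar>y\<bar>" for x y
    using R0[of "(x, y)"] that R norm_fst_le[of x y] norm_snd_le[of y x] by auto
  have c: "continuous_on UNIV g1" "continuous_on UNIV g2"
    by (rule smooth_on_UNIV_continuous[OF test_fn_partial_smooth(1)[OF assms]]
        smooth_on_UNIV_continuous[OF test_fn_partial_smooth(2)[OF assms]])+
  have i: "integrable (lborel \<Otimes>\<^sub>M lborel) (\<lambda>(x, y). g1 (x, y))" "integrable (lborel \<Otimes>\<^sub>M lborel) (\<lambda>(x, y). g2 (x, y))"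
    using test_fn_integrable[OF assms] by (auto simp: lborel_prod)
  have "(\<integral>x. g1 (x, y) \<partial>lborel) = 0" for y
  proof (rule integral_derivative_compact_support[where F = "\<lambda>x. f (x, y)" and R = R])
    show "((\<lambda>x. f (x, y)) has_real_derivative g1 (x, y)) (at x)" for x
      unfolding has_field_derivative_def
      by (rule has_derivative_eq_rhs[OF has_derivative_compose[OF has_derivative_Pair[OF has_derivative_ident has_derivative_const]
             test_fnD(2)[OF assms]]]) (simp add: fun_eq_iff)
    show "continuous_on UNIV (\<lambda>x. g1 (x, y))"
      by (rule continuous_on_compose2[OF c(1)]) (auto intro!: continuous_intros)
  qed (use R notK off in auto)
  then show "(\<integral>x. g1 x \<partial>lborel) = 0"
    using lborel_pair.integral_snd[OF i(1)] by (simp add: lborel_prod)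
  have "(\<integral>y. g2 (x, y) \<partial>lborel) = 0" for x
  proof (rule integral_derivative_compact_support[where F = "\<lambda>y. f (x, y)" and R = R])
    show "((\<lambda>y. f (x, y)) has_real_derivative g2 (x, y)) (at y)" for y
      unfolding has_field_derivative_def
      by (rule has_derivative_eq_rhs[OF has_derivative_compose[OF has_derivative_Pair[OF has_derivative_const has_derivative_ident]
             test_fnD(2)[OF assms]]]) (simp add: fun_eq_iff)
    show "continuous_on UNIV (\<lambda>y. g2 (x, y))"
      by (rule continuous_on_compose2[OF c(2)]) (auto intro!: continuous_intros)
  qed (use R notK off in auto)
  then show "(\<integral>x. g2 x \<partial>lborel) = 0"
    using lborel_pair.integral_fst[OF i(2)] by (simp add: lborel_prod)
qed

text \<open>Divergence theorem for \<open>f\<close> times the gradient of \<open>g\<close>: the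
  derivative of \<open>f g1\<close> in the first variable and that of \<open>f g2\<close> in the
  second both integrate to 0.\<close>

lemma green_identity:
  assumes f: "test_fn \<Omega> f f1 f2" and g: "test_fn \<Omega> g g1 g2"
    and g1: "test_fn \<Omega> g1 g11 g12" and g2: "test_fn \<Omega> g2 g21 g22"
  shows "inner (cls f1) (cls g1) + inner (cls f2) (cls g2) = - inner (cls f) (cls (\<lambda>x. g11 x + g22 x))"
proof -
  note sq = test_fn_sqint[OF f] test_fn_sqint[OF g] test_fn_sqint[OF g1] test_fn_sqint[OF g2]
  have i: "(\<integral>x. f1 x * g1 x + f x * g11 x \<partial>lborel) = 0" "(\<integral>x. f2 x * g2 x + f x * g22 x \<partial>lborel) = 0"
    using integral_partial_eq_0[OF test_fn_mult[OF f g1]] integral_partial_eq_0[OF test_fn_mult[OF f g2]] by auto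
  have s: "sqint (\<lambda>x. g11 x + g22 x)" using sq by (intro sqint_add)
  show ?thesis
    using i sq s by (simp add: inner_cls sqint_mult distrib_left)
qed

subsection \<open>The Dirichlet form\<close>

definition test_space :: "pt set \<Rightarrow> (l2 \<times> l2 \<times> l2) set" where
  "test_space \<Omega> = {(cls f, cls g1, cls g2) | f g1 g2. test_fn \<Omega> f g1 g2}"

text \<open>\<open>H_0^1\<close> encoded as the graph of the weak gradient. Closedness is built in,
  and the inner product of the triple product is the form inner product, as the abstract resolvent
  expects.\<close>

definition energy_space :: "pt set \<Rightarrow> (l2 \<times> l2 \<times> l2) set" where
  "energy_space \<Omega> = closure (test_space \<Omega>)"

lemma subspace_closure:
  fixes S :: "'a::real_normed_vector set"
  assumes "subspace S"
  shows "subspace (closure S)"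
proof (rule subspaceI)
  show "0 \<in> closure S" using subspace_0[OF assms] closure_subset by blast
next
  fix x y assume "x \<in> closure S" "y \<in> closure S"
  then obtain f g where "\<forall>n. f n \<in> S" "f \<longlonglongrightarrow> x" "\<forall>n. g n \<in> S" "g \<longlonglongrightarrow> y"
    unfolding closure_sequential by blast
  then have "(\<forall>n. f n + g n \<in> S) \<and> (\<lambda>n. f n + g n) \<longlonglongrightarrow> x + y"
    using subspace_add[OF assms] tendsto_add by blast
  then show "x + y \<in> closure S" unfolding closure_sequential by (intro exI)
next
  fix c x assume "x \<in> closure S"
  then obtain f where "\<forall>n. f n \<in> S" "f \<longlonglongrightarrow> x" unfolding closure_sequential by blast
  then have "(\<forall>n. c *\<^sub>R f n \<in> S) \<and> (\<lambda>n. c *\<^sub>R f n) \<longlonglongrightarrow> c *\<^sub>R x"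
    using subspace_scale[OF assms] tendsto_scaleR[OF tendsto_const] by blast
  then show "c *\<^sub>R x \<in> closure S" unfolding closure_sequential by (intro exI)
qed

lemma cls_lincomb: "sqint f \<Longrightarrow> sqint g \<Longrightarrow> r *\<^sub>R cls f + s *\<^sub>R cls g = cls (\<lambda>x. r * f x + s * g x)"
  by (simp add: cls_scale cls_add sqint_scale)

lemma test_space_lincomb:
  assumes "p \<in> test_space \<Omega>" "q \<in> test_space \<Omega>"
  shows "r *\<^sub>R p + s *\<^sub>R q \<in> test_space \<Omega>"
proof -
  obtain f f1 f2 where f: "test_fn \<Omega> f f1 f2" "p = (cls f, cls f1, cls f2)" using assms(1) unfolding test_space_def by blast
  obtain g g1 g2 where g: "test_fn \<Omega> g g1 g2" "q = (cls g, cls g1, cls g2)" using assms(2) unfolding test_space_def by blast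
  have "r *\<^sub>R p + s *\<^sub>R q = (cls (\<lambda>x. r * f x + s * g x), cls (\<lambda>x. r * f1 x + s * g1 x), cls (\<lambda>x. r * f2 x + s * g2 x))"
    unfolding f(2) g(2) using test_fn_sqint[OF f(1)] test_fn_sqint[OF g(1)] by (simp add: cls_lincomb)
  then show ?thesis unfolding test_space_def using test_fn_lincomb[OF f(1) g(1), of r s] by blast
qed

lemma subspace_energy_space: "subspace (energy_space \<Omega>)"
  unfolding energy_space_def
proof (rule subspace_closure, rule subspaceI)
  show "0 \<in> test_space \<Omega>"
    unfolding test_space_def using test_fn_zero[of \<Omega>] by (auto simp: zero_prod_def cls_zero)
  show "p + q \<in> test_space \<Omega>" if "p \<in> test_space \<Omega>" "q \<in> test_space \<Omega>" for p q
    using test_space_lincomb[OF that, of 1 1] by simp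
  show "c *\<^sub>R p \<in> test_space \<Omega>" if "p \<in> test_space \<Omega>" for p c
    using test_space_lincomb[OF that that, of c 0] by simp
qed

lemma closed_energy_space: "closed (energy_space \<Omega>)" by (simp add: energy_space_def)

lemma test_fn_in_energy_space: "test_fn \<Omega> f g1 g2 \<Longrightarrow> (cls f, cls g1, cls g2) \<in> energy_space \<Omega>"
  unfolding energy_space_def by (rule subsetD[OF closure_subset]) (auto simp: test_space_def)

lemma energy_space_induct:
  assumes "(v, h) \<in> energy_space \<Omega>" "closed {p. P (fst p) (snd p)}"
    and "\<And>f g1 g2. test_fn \<Omega> f g1 g2 \<Longrightarrow> P (cls f) (cls g1, cls g2)"
  shows "P v h"
proof -
  have "energy_space \<Omega> \<subseteq> {p. P (fst p) (snd p)}"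
    unfolding energy_space_def by (rule closure_minimal[OF _ assms(2)]) (use assms(3) in \<open>auto simp: test_space_def\<close>)
  then show ?thesis using assms(1) by auto
qed

lemma energy_space_approx:
  assumes "(u, G1, G2) \<in> energy_space \<Omega>"
  shows "\<exists>\<phi> d1 d2. (\<forall>n::nat. test_fn \<Omega> (\<phi> n) (d1 n) (d2 n)) \<and>
    (\<lambda>n. cls (\<phi> n)) \<longlonglongrightarrow> u \<and> (\<lambda>n. cls (d1 n)) \<longlonglongrightarrow> G1 \<and> (\<lambda>n. cls (d2 n)) \<longlonglongrightarrow> G2"
proof -
  obtain X where X: "\<And>n. X n \<in> test_space \<Omega>" "X \<longlonglongrightarrow> (u, G1, G2)"
    using assms unfolding energy_space_def closure_sequential by blast
  have "\<forall>n. \<exists>q. X n = (cls (fst q), cls (fst (snd q)), cls (snd (snd q))) \<and> test_fn \<Omega> (fst q) (fst (snd q)) (snd (snd q))"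
    using X(1) unfolding test_space_def by fastforce
  then obtain q where q: "\<And>n. X n = (cls (fst (q n)), cls (fst (snd (q n))), cls (snd (snd (q n))))"
    "\<And>n. test_fn \<Omega> (fst (q n)) (fst (snd (q n))) (snd (snd (q n)))" by metis
  have "(\<lambda>n. fst (X n)) \<longlonglongrightarrow> u" "(\<lambda>n. fst (snd (X n))) \<longlonglongrightarrow> G1" "(\<lambda>n. snd (snd (X n))) \<longlonglongrightarrow> G2"
    using tendsto_fst[OF X(2)] tendsto_fst[OF tendsto_snd[OF X(2)]] tendsto_snd[OF tendsto_snd[OF X(2)]] by simp_all
  then show ?thesis
    by (intro exI[of _ "\<lambda>n. fst (q n)"] exI[of _ "\<lambda>n. fst (snd (q n))"] exI[of _ "\<lambda>n. snd (snd (q n))"])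
       (simp add: q(1) q(2))
qed

section \<open>From functions on the domain to classes on the plane and back\<close>

definition restr :: "pt set \<Rightarrow> (pt \<Rightarrow> real) \<Rightarrow> pt \<Rightarrow> real" where
  "restr \<Omega> f x = indicator \<Omega> x * f x"

lemma norm2_eq_restr: "norm2 \<Omega> f = (\<integral>\<^sup>+x. ennreal ((restr \<Omega> f x)\<^sup>2) \<partial>lborel)"
  unfolding wnorm2_def by (rule nn_integral_cong) (auto simp: restr_def indicator_def)

lemma restr_test_fn: "test_fn \<Omega> f g1 g2 \<Longrightarrow> restr \<Omega> f = f"
proof
  fix x assume t: "test_fn \<Omega> f g1 g2"
  show "restr \<Omega> f x = f x"
  proof (cases "x \<in> \<Omega>")
    case False
    then have "f x = 0" using test_fnD(4)[OF t] by (intro test_fnD(5)[OF t]) blast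
    then show ?thesis by (simp add: restr_def)
  qed (simp add: restr_def)
qed

lemma sqint_restr:
  assumes "\<Omega> \<in> sets borel" "in_L2 \<Omega> f"
  shows "sqint (restr \<Omega> f)"
  unfolding sqint_iff
proof
  show "restr \<Omega> f \<in> borel_measurable lborel"
    using assms unfolding restr_def[abs_def] in_L2_def by auto
  show "(\<integral>\<^sup>+ x. ennreal ((restr \<Omega> f x)\<^sup>2) \<partial>lborel) < \<infinity>"
    using assms(2) by (simp add: in_L2_def norm2_eq_restr)
qed

lemma norm2_le_norm_cls:
  assumes "sqint f"
  shows "norm2 \<Omega> f \<le> ennreal ((norm (cls f))\<^sup>2)"
proof -
  have "norm2 \<Omega> f \<le> (\<integral>\<^sup>+x. ennreal ((f x)\<^sup>2) \<partial>lborel)"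
    unfolding norm2_eq_restr by (rule nn_integral_mono) (auto simp: restr_def indicator_def)
  then show ?thesis by (simp add: nn_norm_cls[OF assms])
qed

lemma sqint_in_L2: assumes "sqint f" shows "in_L2 \<Omega> f"
  unfolding in_L2_def
proof
  show "norm2 \<Omega> f < \<infinity>" using le_less_trans[OF norm2_le_norm_cls[OF assms] ennreal_less_top] by simp
qed (use assms in \<open>simp add: sqint_def\<close>)

text \<open>For functions vanishing off \<open>\<Omega>\<close> the integral over
  \<open>\<Omega>\<close> is the full squared norm, so only the limit has to be restricted.\<close>

lemma norm2_tendsto_0_iff:
  assumes \<Omega>: "\<Omega> \<in> sets borel" and f: "\<And>n. sqint (f n)" "\<And>n. restr \<Omega> (f n) = f n" and v: "in_L2 \<Omega> v"
    and lim: "((\<lambda>n. norm2 \<Omega> (\<lambda>x. f n x - v x)) \<longlongrightarrow> 0) sequentially"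
  shows "(\<lambda>n. cls (f n)) \<longlonglongrightarrow> cls (restr \<Omega> v)"
proof -
  have "restr \<Omega> (\<lambda>x. f n x - v x) = (\<lambda>x. f n x - restr \<Omega> v x)" for n
    using fun_cong[OF f(2)[of n]] by (auto simp: restr_def fun_eq_iff right_diff_distrib)
  then have "norm2 \<Omega> (\<lambda>x. f n x - v x) = ennreal ((norm (cls (f n) - cls (restr \<Omega> v)))\<^sup>2)" for n
    unfolding norm2_eq_restr using nn_norm_cls[OF sqint_diff[OF f(1) sqint_restr[OF \<Omega> v]]]
    by (simp add: cls_diff[OF f(1) sqint_restr[OF \<Omega> v]])
  with lim have "(\<lambda>n. (norm (cls (f n) - cls (restr \<Omega> v)))\<^sup>2) \<longlonglongrightarrow> 0" by (simp add: ennreal_tendsto_0_iff)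
  from tendsto_real_sqrt[OF this] have "(\<lambda>n. cls (f n) - cls (restr \<Omega> v)) \<longlonglongrightarrow> 0"
    by (simp add: tendsto_norm_zero_iff)
  then show ?thesis by (simp add: LIM_zero_iff)
qed

text \<open>Members of \<open>H01\<close> are arbitrary off \<open>\<Omega>\<close>, while a class
  sees the whole plane; restriction removes the ambiguity. The approximating test functions and
  their gradients already vanish off \<open>\<Omega>\<close>.\<close>

lemma H01_in_energy_space:
  assumes \<Omega>: "\<Omega> \<in> sets borel" and H: "H01 \<Omega> v h1 h2"
  shows "(cls (restr \<Omega> v), cls (restr \<Omega> h1), cls (restr \<Omega> h2)) \<in> energy_space \<Omega>"
proof -
  have L: "in_L2 \<Omega> v" "in_L2 \<Omega> h1" "in_L2 \<Omega> h2" using H unfolding H01_def by blast+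
  obtain \<phi> d1 d2 where t: "\<And>n. test_fn \<Omega> (\<phi> n) (d1 n) (d2 n)"
    and l: "((\<lambda>n. norm2 \<Omega> (\<lambda>x. \<phi> n x - v x)) \<longlongrightarrow> 0) sequentially"
      "((\<lambda>n. norm2 \<Omega> (\<lambda>x. d1 n x - h1 x)) \<longlongrightarrow> 0) sequentially"
      "((\<lambda>n. norm2 \<Omega> (\<lambda>x. d2 n x - h2 x)) \<longlongrightarrow> 0) sequentially"
    using H unfolding H01_def by blast
  have r: "restr \<Omega> (\<phi> n) = \<phi> n" "restr \<Omega> (d1 n) = d1 n" "restr \<Omega> (d2 n) = d2 n" for n
    using restr_test_fn[OF t[of n]] test_fn_partial[OF t[of n]] restr_test_fn by blast+
  have "(\<lambda>n. (cls (\<phi> n), cls (d1 n), cls (d2 n))) \<longlonglongrightarrow> (cls (restr \<Omega> v), cls (restr \<Omega> h1), cls (restr \<Omega> h2))"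
    by (intro tendsto_Pair norm2_tendsto_0_iff[OF \<Omega>] L l r test_fn_sqint[OF t])
  moreover have "(cls (\<phi> n), cls (d1 n), cls (d2 n)) \<in> test_space \<Omega>" for n
    unfolding test_space_def using t[of n] by blast
  ultimately show ?thesis unfolding energy_space_def closure_sequential
    by (intro exI[of _ "\<lambda>n. (cls (\<phi> n), cls (d1 n), cls (d2 n))"] conjI allI)
qed

lemma norm2_cls_tendsto_0:
  assumes "\<And>n. sqint (f n)" "((\<lambda>n. cls (f n)) \<longlongrightarrow> 0) F"
  shows "((\<lambda>n. norm2 \<Omega> (f n)) \<longlongrightarrow> 0) F"
proof (rule tendsto_sandwich[of "\<lambda>_. 0" _ _ "\<lambda>n. ennreal ((norm (cls (f n)))\<^sup>2)"])
  show "((\<lambda>n. ennreal ((norm (cls (f n)))\<^sup>2)) \<longlongrightarrow> 0) F"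
    using tendsto_ennrealI[OF tendsto_power[OF tendsto_norm[OF assms(2)], of 2]] by simp
  show "\<forall>\<^sub>F n in F. norm2 \<Omega> (f n) \<le> ennreal ((norm (cls (f n)))\<^sup>2)"
    by (rule always_eventually, rule allI, rule norm2_le_norm_cls[OF assms(1)])
qed simp_all

lemma energy_space_H01:
  assumes "(u, G1, G2) \<in> energy_space \<Omega>"
  shows "H01 \<Omega> (rep u) (rep G1) (rep G2)"
proof -
  obtain \<phi> d1 d2 where t: "\<And>n::nat. test_fn \<Omega> (\<phi> n) (d1 n) (d2 n)"
    and l: "(\<lambda>n. cls (\<phi> n)) \<longlonglongrightarrow> u" "(\<lambda>n. cls (d1 n)) \<longlonglongrightarrow> G1" "(\<lambda>n. cls (d2 n)) \<longlonglongrightarrow> G2"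
    using energy_space_approx[OF assms] by auto
  have *: "((\<lambda>n. norm2 \<Omega> (\<lambda>x. f n x - rep w x)) \<longlongrightarrow> 0) sequentially"
    if "\<And>n. sqint (f n)" "(\<lambda>n. cls (f n)) \<longlonglongrightarrow> w" for f :: "nat \<Rightarrow> _" and w
  proof (rule norm2_cls_tendsto_0)
    show "sqint (\<lambda>x. f n x - rep w x)" for n by (rule sqint_diff[OF that(1) sqint_rep])
    have "cls (\<lambda>x. f n x - rep w x) = cls (f n) - w" for n
      using cls_diff[OF that(1) sqint_rep, of n w] by simp
    then show "(\<lambda>n. cls (\<lambda>x. f n x - rep w x)) \<longlonglongrightarrow> 0" using that(2) by (simp add: LIM_zero_iff)
  qed
  show ?thesis unfolding H01_def
    by (intro conjI sqint_in_L2 sqint_rep exI[of _ \<phi>] exI[of _ d1] exI[of _ d2] allI t * test_fn_sqint[OF t] l)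
qed

text \<open>Bridge from the Hilbert space equation to the definition of the Laplacian: a competitor
  enters through its restricted classes, and the factor \<open>indicator \<Omega>\<close> in the
  integrals matches that restriction.\<close>

lemma dirichlet_lap_rep:
  assumes \<Omega>: "\<Omega> \<in> sets borel" and u: "(u, G) \<in> energy_space \<Omega>"
    and w: "\<And>v h. (v, h) \<in> energy_space \<Omega> \<Longrightarrow> inner G h = inner F v"
  shows "dirichlet_lap \<Omega> (rep u) (rep F)"
proof -
  obtain G1 G2 where G: "G = (G1, G2)" by (cases G)
  have "(\<integral>x. indicator \<Omega> x * (rep G1 x * h1 x + rep G2 x * h2 x) \<partial>lborel)
          = (\<integral>x. indicator \<Omega> x * (rep F x * v x) \<partial>lborel)" if H: "H01 \<Omega> v h1 h2" for v h1 h2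
  proof -
    have "in_L2 \<Omega> v" "in_L2 \<Omega> h1" "in_L2 \<Omega> h2" using H unfolding H01_def by blast+
    note s = this[THEN sqint_restr[OF \<Omega>]]
    have i: "inner K (cls (restr \<Omega> f)) = (\<integral>x. indicator \<Omega> x * (rep K x * f x) \<partial>lborel)"
      "integrable lborel (\<lambda>x. indicator \<Omega> x * (rep K x * f x))" if "sqint (restr \<Omega> f)" for K f
    proof -
      have e: "(\<lambda>x. rep K x * restr \<Omega> f x) = (\<lambda>x. indicator \<Omega> x * (rep K x * f x))" by (auto simp: restr_def)
      show "inner K (cls (restr \<Omega> f)) = (\<integral>x. indicator \<Omega> x * (rep K x * f x) \<partial>lborel)"
        using inner_cls[OF sqint_rep[of K] that] unfolding e by simp
      show "integrable lborel (\<lambda>x. indicator \<Omega> x * (rep K x * f x))"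
        using sqint_mult[OF sqint_rep[of K] that] unfolding e .
    qed
    have "inner G1 (cls (restr \<Omega> h1)) + inner G2 (cls (restr \<Omega> h2)) = inner F (cls (restr \<Omega> v))"
      using w[OF H01_in_energy_space[OF \<Omega> H]] by (simp add: G inner_prod_def)
    then show ?thesis unfolding i(1)[OF s(1)] i(1)[OF s(2)] i(1)[OF s(3)]
      by (simp add: distrib_left Bochner_Integration.integral_add[OF i(2)[OF s(2)] i(2)[OF s(3)]])
  qed
  then show ?thesis
    unfolding dirichlet_lap_def using energy_space_H01[OF u[unfolded G]] sqint_in_L2[OF sqint_rep] by blast
qed

text \<open>Green's identity on test functions; both sides are continuous in \<open>(v, h)\<close>,
  so it passes to the closure.\<close>

lemma weak_laplacian:
  assumes f: "test_fn \<Omega> f f1 f2" and f1: "test_fn \<Omega> f1 f11 f12" and f2: "test_fn \<Omega> f2 f21 f22"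
    and v: "(v, h) \<in> energy_space \<Omega>"
  shows "inner (cls f1, cls f2) h = - inner (cls (\<lambda>x. f11 x + f22 x)) v"
  using v
proof (rule energy_space_induct)
  show "closed {p. inner (cls f1, cls f2) (snd p) = - inner (cls (\<lambda>x. f11 x + f22 x)) (fst p)}"
    by (intro closed_Collect_eq continuous_intros)
  show "inner (cls f1, cls f2) (cls g1, cls g2) = - inner (cls (\<lambda>x. f11 x + f22 x)) (cls g)"
    if "test_fn \<Omega> g g1 g2" for g g1 g2
    using green_identity[OF that f f1 f2] by (simp add: inner_prod_def inner_commute)
qed

text \<open>\<open>w = f - \<Delta> f\<close> is again a test function. Iteration therefore puts a
  test function in the range of every power of the resolvent, which is the regularity that the
  evolution asks of its datum.\<close>

lemma test_fn_resolvent: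
  assumes f: "test_fn \<Omega> f f1 f2"
  obtains w w1 w2 where "test_fn \<Omega> w w1 w2"
    "\<And>v h. (v, h) \<in> energy_space \<Omega> \<Longrightarrow> inner (cls f) v + inner (cls f1, cls f2) h = inner (cls w) v"
proof -
  obtain f11 f12 where f1: "test_fn \<Omega> f1 f11 f12" using test_fn_partial(1)[OF f] by blast
  obtain f21 f22 where f2: "test_fn \<Omega> f2 f21 f22" using test_fn_partial(2)[OF f] by blast
  obtain a1 a2 where a: "test_fn \<Omega> f11 a1 a2" using test_fn_partial(1)[OF f1] by blast
  obtain d1 d2 where d: "test_fn \<Omega> f22 d1 d2" using test_fn_partial(2)[OF f2] by blast
  note L = test_fn_lincomb[OF a d, of 1 1]
  have s: "sqint (\<lambda>x. f11 x + f22 x)" by (intro sqint_add test_fn_sqint[OF a] test_fn_sqint[OF d])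
  have "inner (cls f) v + inner (cls f1, cls f2) h = inner (cls (\<lambda>x. 1 * f x + -1 * (1 * f11 x + 1 * f22 x))) v"
    if "(v, h) \<in> energy_space \<Omega>" for v h
  proof -
    have "cls f - cls (\<lambda>x. f11 x + f22 x) = cls (\<lambda>x. 1 * f x + -1 * (1 * f11 x + 1 * f22 x))"
      using cls_diff[OF test_fn_sqint(1)[OF f] s] by (simp add: algebra_simps)
    then show ?thesis using weak_laplacian[OF f f1 f2 that] by (metis inner_diff_left diff_conv_add_uminus)
  qed
  then show ?thesis using that[OF test_fn_lincomb[OF f L, of 1 "-1"]] by blast
qed

subsection \<open>Existence and positivity of heat flows\<close>

lemma flat_eq: "0 < x \<Longrightarrow> flat p x = x\<^sup>2 * poly p (1 / x) * exp (- (1 / x))"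
  and flat_nonpos: "x \<le> 0 \<Longrightarrow> flat p x = 0"
  by (auto simp: flat_def)

lemma exp_minus_mult_quadratic_le: "0 \<le> y \<Longrightarrow> (2 + 2 * y + y\<^sup>2) * exp (- y) \<le> (2::real)"
  using exp_lower_Taylor_quadratic[of y] by (simp add: exp_minus field_simps)

lemma flat_uminus_has_real_derivative:
  "((\<lambda>s. flat p (- s)) has_real_derivative - flat (flat_deriv p) (- s)) (at s)"
  using DERIV_chain2[OF flat_has_real_derivative DERIV_minus[OF DERIV_ident], of p s UNIV] by simp

text \<open>As \<open>pen\<close> is convex and vanishes exactly on the nonnegative half line, the integral of \<open>pen (u(t))\<close> is
  nonincreasing along the flow, which yields its positivity.\<close>

definition pen :: "real \<Rightarrow> real" where "pen s = flat 1 (- s)"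
definition pen' :: "real \<Rightarrow> real" where "pen' s = - flat (flat_deriv 1) (- s)"
definition pen'' :: "real \<Rightarrow> real" where "pen'' s = flat (flat_deriv (flat_deriv 1)) (- s)"

lemma pen_deriv: "(pen has_real_derivative pen' s) (at s)" "(pen' has_real_derivative pen'' s) (at s)"
  unfolding pen_def[abs_def] pen'_def[abs_def] pen''_def
  using DERIV_minus[OF flat_uminus_has_real_derivative[of "flat_deriv 1" s]]
  by (simp_all add: flat_uminus_has_real_derivative)

text \<open>With \<open>y = - 1 / s\<close> and \<open>s < 0\<close> the second derivative is
  \<open>(2 + 2 y + y^2) exp (- y)\<close>, and \<open>exp y \<ge> 1 + y + y^2 / 2\<close>. The
  bound 2 becomes the Lipschitz constant of \<open>pen'\<close> in all later estimates.\<close>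

lemma pen''_bounds: "0 \<le> pen'' s" "pen'' s \<le> 2"
proof -
  have "0 \<le> pen'' s \<and> pen'' s \<le> 2"
  proof (cases "s < 0")
    case True
    define y where "y = 1 / - s"
    have y: "0 \<le> y" "y * - s = 1" using True by (simp_all add: y_def)
    have pp: "poly (flat_deriv (flat_deriv 1)) y = y\<^sup>2 * (2 + 2 * y + y\<^sup>2)"
      by (simp add: flat_deriv_def pderiv_pCons power2_eq_square algebra_simps)
    have "0 < - s" using True by simp
    then have "pen'' s = (- s)\<^sup>2 * (y\<^sup>2 * (2 + 2 * y + y\<^sup>2)) * exp (- y)"
      unfolding pen''_def by (simp only: flat_eq y_def[symmetric] pp)
    also have "\<dots> = (y * - s)\<^sup>2 * ((2 + 2 * y + y\<^sup>2) * exp (- y))" by (simp only: power_mult_distrib mult_ac)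
    also have "\<dots> = (2 + 2 * y + y\<^sup>2) * exp (- y)" unfolding y(2) by simp
    finally show ?thesis using exp_minus_mult_quadratic_le[OF y(1)] y(1) by simp
  qed (simp add: pen''_def flat_nonpos)
  then show "0 \<le> pen'' s" "pen'' s \<le> 2" by auto
qed

lemma pen_pos: "s < 0 \<Longrightarrow> 0 < pen s" and pen_zero: "0 \<le> s \<Longrightarrow> pen s = 0" and pen'_zero: "0 \<le> s \<Longrightarrow> pen' s = 0"
  by (auto simp: pen_def pen'_def flat_eq flat_nonpos)

lemma pen_nonneg: "0 \<le> pen s"
  using pen_pos[of s] pen_zero[of s] by (cases "s < 0") auto

lemma pen'_lipschitz: "\<bar>pen' a - pen' b\<bar> \<le> 2 * \<bar>a - b\<bar>"
  using field_differentiable_bound[of UNIV pen' pen'' 2 a b] pen_deriv(2) pen''_bounds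
  by (auto simp: has_field_derivative_at_within)

lemma pen_taylor: "\<bar>pen b - pen a - pen' a * (b - a)\<bar> \<le> 2 * (b - a)\<^sup>2"
proof -
  define g where "g x = pen x - pen' a * x" for x
  have "\<bar>g b - g a\<bar> \<le> (2 * \<bar>b - a\<bar>) * \<bar>b - a\<bar>"
  proof -
    have "norm (g b - g a) \<le> (2 * \<bar>b - a\<bar>) * norm (b - a)"
    proof (rule field_differentiable_bound[of "closed_segment a b" g "\<lambda>x. pen' x - pen' a"])
      show "(g has_field_derivative pen' z - pen' a) (at z within closed_segment a b)" for z
        unfolding g_def by (auto intro!: derivative_eq_intros has_field_derivative_at_within[OF pen_deriv(1)])
      show "norm (pen' z - pen' a) \<le> 2 * \<bar>b - a\<bar>" if "z \<in> closed_segment a b" for z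
      proof -
        have "\<bar>z - a\<bar> \<le> \<bar>b - a\<bar>" using that by (auto simp: closed_segment_eq_real_ivl split: if_splits)
        then show ?thesis using pen'_lipschitz[of z a] by simp
      qed
    qed auto
    then show ?thesis by simp
  qed
  then show ?thesis by (simp add: g_def power2_eq_square algebra_simps abs_mult_self_eq flip: abs_mult)
qed

text \<open>Each derivative of a reflected function produces a sign; the scalar \<open>c\<close>
  absorbs it.\<close>

lemma deriv_closed_pen: "deriv_closed {\<lambda>s. c * flat p (- s) | c p. True}"
  unfolding deriv_closed_def
proof
  fix J assume "J \<in> {\<lambda>s. c * flat p (- s) | c p. True}"
  then obtain c p where J: "J = (\<lambda>s. c * flat p (- s))" by blast
  have "\<forall>x. (J has_real_derivative (- c) * flat (flat_deriv p) (- x)) (at x)"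
  proof
    fix x show "(J has_real_derivative (- c) * flat (flat_deriv p) (- x)) (at x)"
      unfolding J using DERIV_cmult[OF flat_uminus_has_real_derivative[of p x], of c] by simp
  qed
  then show "\<exists>J'\<in>{\<lambda>s. c * flat p (- s) | c p. True}. \<forall>x. (J has_real_derivative J' x) (at x)"
    by (rule bexI[of _ "\<lambda>s. (- c) * flat (flat_deriv p) (- s)"])
       (rule CollectI, intro exI[of _ "- c"] exI[of _ "flat_deriv p"] conjI refl TrueI)
qed

lemma continuous_on_pen: "continuous_on A pen" "continuous_on A pen'"
  by (rule DERIV_continuous_on[OF has_field_derivative_at_within[OF pen_deriv(1)]]
      DERIV_continuous_on[OF has_field_derivative_at_within[OF pen_deriv(2)]])+

lemma sqint_pen': assumes "sqint f" shows "sqint (\<lambda>x. pen' (f x))"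
proof -
  have m: "(\<lambda>x. pen' (f x)) \<in> borel_measurable lborel"
    using assms borel_measurable_continuous_onI[OF continuous_on_pen(2)[of UNIV]] by (auto simp: sqint_def)
  have "(pen' (f x))\<^sup>2 \<le> (2 * f x)\<^sup>2" for x
    using pen'_lipschitz[of "f x" 0] pen'_zero[of 0]
    by (intro abs_le_square_iff[THEN iffD1]) (simp add: abs_mult)
  then have ae: "AE x in lborel. norm ((pen' (f x))\<^sup>2) \<le> norm ((2 * f x)\<^sup>2)" by (intro AE_I2) simp
  have i: "integrable lborel (\<lambda>x. (2 * f x)\<^sup>2)" using assms by (simp add: sqint_def power_mult_distrib)
  have m2: "(\<lambda>x. (pen' (f x))\<^sup>2) \<in> borel_measurable lborel" using m by measurable
  show ?thesis unfolding sqint_def by (intro conjI m Bochner_Integration.integrable_bound[OF i m2 ae])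
qed

lemma norm_cls_mono:
  assumes "sqint f" "sqint g" "\<And>x. \<bar>f x\<bar> \<le> c * \<bar>g x\<bar>" "0 \<le> c"
  shows "norm (cls f) \<le> c * norm (cls g)"
proof -
  have "(norm (cls f))\<^sup>2 \<le> (\<integral>x. (c * g x)\<^sup>2 \<partial>lborel)"
    unfolding norm_cls[OF assms(1)]
  proof (rule integral_mono)
    show "(f x)\<^sup>2 \<le> (c * g x)\<^sup>2" for x
      using assms(3)[of x] assms(4) by (intro abs_le_square_iff[THEN iffD1]) (simp add: abs_mult)
    show "integrable lborel (\<lambda>x. (f x)\<^sup>2)" using assms(1) by (simp add: sqint_def)
    show "integrable lborel (\<lambda>x. (c * g x)\<^sup>2)" using assms(2) by (simp add: sqint_def power_mult_distrib)
  qed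
  also have "\<dots> = (c * norm (cls g))\<^sup>2"
    by (simp add: power_mult_distrib norm_cls[OF assms(2)])
  finally show ?thesis using assms(4) by (simp add: power2_le_iff_abs_le)
qed

text \<open>Formally, testing the equation with \<open>pen' u\<close> gives the integral of
  \<open>pen'' u\<close> times the squared gradient. As \<open>u\<close> is only in the energy
  space, the test functions \<open>pen' (\<phi> n)\<close> are inserted instead and the inequality
  is obtained in the limit.\<close>

lemma pen'_dissipative:
  assumes uG: "(u, G) \<in> energy_space \<Omega>"
    and w: "\<And>v h. (v, h) \<in> energy_space \<Omega> \<Longrightarrow> inner G h = inner F v"
  shows "0 \<le> inner (cls (\<lambda>x. pen' (rep u x))) F"
proof -
  obtain G1 G2 where G: "G = (G1, G2)" by (cases G)
  obtain \<phi> d1 d2 where t: "\<And>n::nat. test_fn \<Omega> (\<phi> n) (d1 n) (d2 n)"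
    and l: "(\<lambda>n. cls (\<phi> n)) \<longlonglongrightarrow> u" "(\<lambda>n. cls (d1 n)) \<longlonglongrightarrow> G1" "(\<lambda>n. cls (d2 n)) \<longlonglongrightarrow> G2"
    using energy_space_approx[OF uG[unfolded G]] by auto
  note st = test_fn_sqint[OF t]
  have tp: "test_fn \<Omega> (\<lambda>x. pen' (\<phi> n x)) (\<lambda>x. pen'' (\<phi> n x) * d1 n x) (\<lambda>x. pen'' (\<phi> n x) * d2 n x)" for n
  proof (rule test_fn_compose[OF t deriv_closed_pen])
    show "pen' \<in> {\<lambda>s. c * flat p (- s) | c p. True}"
      unfolding pen'_def[abs_def] by (intro CollectI exI[of _ "-1"] exI[of _ "flat_deriv 1"]) auto
    show "pen' 0 = 0" by (rule pen'_zero) simp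
    show "(pen' has_real_derivative pen'' s) (at s)" for s by (rule pen_deriv(2))
  qed
  note sp = test_fn_sqint[OF tp]
  have b: "\<bar>pen'' s * a\<bar> \<le> 2 * \<bar>a\<bar>" for s a
    using pen''_bounds[of s] by (simp add: abs_mult mult_right_mono)
  define D where "D n = (cls (d1 n), cls (d2 n))" for n
  define E where "E n = (cls (\<lambda>x. pen'' (\<phi> n x) * d1 n x), cls (\<lambda>x. pen'' (\<phi> n x) * d2 n x))" for n
  have Dl: "D \<longlonglongrightarrow> G" unfolding D_def G by (intro tendsto_Pair l)
  have E1: "norm (E n) \<le> 2 * norm (D n)" for n
  proof -
    have "norm (fst (E n)) \<le> 2 * norm (fst (D n))" "norm (snd (E n)) \<le> 2 * norm (snd (D n))"
      unfolding E_def D_def fst_conv snd_conv by (rule norm_cls_mono; use sp st b in simp)+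
    then have "(norm (fst (E n)))\<^sup>2 + (norm (snd (E n)))\<^sup>2 \<le> (2 * norm (fst (D n)))\<^sup>2 + (2 * norm (snd (D n)))\<^sup>2"
      by (intro add_mono power_mono) auto
    then have "(norm (E n))\<^sup>2 \<le> (2 * norm (D n))\<^sup>2"
      by (simp add: norm_prod_def power_mult_distrib)
    then show ?thesis by (rule power2_le_imp_le) simp
  qed
  have DE: "0 \<le> inner (D n) (E n)" for n
  proof -
    have "0 \<le> inner (cls (d n)) (cls (\<lambda>x. pen'' (\<phi> n x) * d n x))" if "sqint (d n)" "sqint (\<lambda>x. pen'' (\<phi> n x) * d n x)" for d :: "nat \<Rightarrow> _"
      unfolding inner_cls[OF that]
    proof (rule integral_nonneg_AE, rule AE_I2)
      fix x
      have "0 \<le> pen'' (\<phi> n x) * (d n x * d n x)" using pen''_bounds by simp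
      then show "0 \<le> d n x * (pen'' (\<phi> n x) * d n x)" by (simp add: mult_ac)
    qed
    from this[of d1] this[of d2] show ?thesis using st sp by (simp add: D_def E_def inner_prod_def)
  qed
  \<comment> \<open>For \<open>E n\<close> only the bound \<open>2 * norm (D n)\<close> is at hand,
    not a limit. Hence \<open>G\<close> is split as \<open>(G - D n) + D n\<close>: the first part
    tends to 0, the second pairs nonnegatively with \<open>E n\<close>.\<close>
  have ge: "- (norm (G - D n) * (2 * norm (D n))) \<le> inner F (cls (\<lambda>x. pen' (\<phi> n x)))" for n
  proof -
    have "inner F (cls (\<lambda>x. pen' (\<phi> n x))) = inner G (E n)"
      using w[OF test_fn_in_energy_space[OF tp[of n]]] by (simp add: E_def)
    also have "\<dots> = inner (G - D n) (E n) + inner (D n) (E n)" by (simp add: inner_diff_left)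
    finally have eq: "inner F (cls (\<lambda>x. pen' (\<phi> n x))) = inner (G - D n) (E n) + inner (D n) (E n)" .
    have "\<bar>inner (G - D n) (E n)\<bar> \<le> norm (G - D n) * norm (E n)" by (rule Cauchy_Schwarz_ineq2)
    also have "\<dots> \<le> norm (G - D n) * (2 * norm (D n))" by (intro mult_left_mono E1) simp
    finally show ?thesis using DE[of n] eq by linarith
  qed
  have "(\<lambda>n. cls (\<lambda>x. pen' (\<phi> n x)) - cls (\<lambda>x. pen' (rep u x))) \<longlonglongrightarrow> 0"
  proof (rule Lim_null_comparison[OF always_eventually])
    show "\<forall>n. norm (cls (\<lambda>x. pen' (\<phi> n x)) - cls (\<lambda>x. pen' (rep u x))) \<le> 2 * norm (cls (\<phi> n) - u)"
    proof
      fix n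
      have s: "sqint (\<lambda>x. pen' (rep u x))" by (rule sqint_pen'[OF sqint_rep])
      have "norm (cls (\<lambda>x. pen' (\<phi> n x) - pen' (rep u x))) \<le> 2 * norm (cls (\<lambda>x. \<phi> n x - rep u x))"
        by (rule norm_cls_mono[OF sqint_diff[OF sp(1) s] sqint_diff[OF st(1) sqint_rep]]) (simp_all add: pen'_lipschitz)
      then show "norm (cls (\<lambda>x. pen' (\<phi> n x)) - cls (\<lambda>x. pen' (rep u x))) \<le> 2 * norm (cls (\<phi> n) - u)"
        using cls_diff[OF sp(1)[of n] s] cls_diff[OF st(1)[of n] sqint_rep[of u]] by simp
    qed
    have "(\<lambda>n. cls (\<phi> n) - u) \<longlonglongrightarrow> 0" using l(1) by (simp add: LIM_zero_iff)
    from tendsto_mult_left[OF tendsto_norm[OF this], of 2]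
    show "(\<lambda>n. 2 * norm (cls (\<phi> n) - u)) \<longlonglongrightarrow> 0" by simp
  qed
  then have "(\<lambda>n. cls (\<lambda>x. pen' (\<phi> n x))) \<longlonglongrightarrow> cls (\<lambda>x. pen' (rep u x))" by (simp add: LIM_zero_iff)
  then have l1: "(\<lambda>n. inner F (cls (\<lambda>x. pen' (\<phi> n x)))) \<longlonglongrightarrow> inner F (cls (\<lambda>x. pen' (rep u x)))"
    by (intro tendsto_inner tendsto_const)
  have l2: "(\<lambda>n. - (norm (G - D n) * (2 * norm (D n)))) \<longlonglongrightarrow> - (norm (G - G) * (2 * norm G))"
    by (intro tendsto_intros Dl)
  have "- (norm (G - G) * (2 * norm G)) \<le> inner F (cls (\<lambda>x. pen' (rep u x)))"
    by (rule LIMSEQ_le[OF l2 l1]) (intro exI allI impI ge)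
  then show ?thesis by (simp add: inner_commute)
qed

lemma integrable_pen: assumes "sqint f" shows "integrable lborel (\<lambda>x. pen (f x))"
proof (rule Bochner_Integration.integrable_bound)
  show "integrable lborel (\<lambda>x. 2 * (f x)\<^sup>2)" using assms by (simp add: sqint_def)
  show "(\<lambda>x. pen (f x)) \<in> borel_measurable lborel"
    using assms borel_measurable_continuous_onI[OF continuous_on_pen(1)[of UNIV]] by (auto simp: sqint_def)
  have "\<bar>pen s\<bar> \<le> 2 * s\<^sup>2" for s using pen_taylor[of s 0] pen_zero[of 0] pen'_zero[of 0] by simp
  then show "AE x in lborel. norm (pen (f x)) \<le> norm (2 * (f x)\<^sup>2)" by (intro AE_I2) simp
qed

definition penalty :: "l2 \<Rightarrow> real" where "penalty u = (\<integral>x. pen (rep u x) \<partial>lborel)"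

lemma penalty_nonneg: "0 \<le> penalty u"
  unfolding penalty_def by (rule integral_nonneg_AE) (simp add: pen_nonneg)

lemma penalty_eq_0_iff: "penalty u = 0 \<longleftrightarrow> (AE x in lborel. 0 \<le> rep u x)"
proof -
  have "penalty u = 0 \<longleftrightarrow> (AE x in lborel. pen (rep u x) = 0)"
    unfolding penalty_def
    by (rule integral_nonneg_eq_0_iff_AE[OF integrable_pen[OF sqint_rep]]) (simp add: pen_nonneg)
  moreover have "pen s = 0 \<longleftrightarrow> 0 \<le> s" for s using pen_pos[of s] pen_zero[of s] by fastforce
  ultimately show ?thesis by simp
qed

text \<open>The pointwise Taylor estimate integrated: the functional is Frechet differentiable with
  quadratic remainder, which the chain rule along an orbit requires.\<close>

lemma penalty_taylor:
  "\<bar>penalty v - penalty u - inner (cls (\<lambda>x. pen' (rep u x))) (v - u)\<bar> \<le> 2 * (norm (v - u))\<^sup>2"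
proof -
  note s = sqint_pen'[OF sqint_rep[of u]]
  note d = sqint_diff[OF sqint_rep[of v] sqint_rep[of u]]
  have vu: "v - u = cls (\<lambda>x. rep v x - rep u x)" using cls_diff[OF sqint_rep sqint_rep, of v u] by simp
  have i: "integrable lborel (\<lambda>x. pen (rep v x) - pen (rep u x) - pen' (rep u x) * (rep v x - rep u x))"
    by (intro Bochner_Integration.integrable_diff integrable_pen sqint_rep sqint_mult s d)
  have "penalty v - penalty u - inner (cls (\<lambda>x. pen' (rep u x))) (v - u)
     = (\<integral>x. pen (rep v x) - pen (rep u x) - pen' (rep u x) * (rep v x - rep u x) \<partial>lborel)"
    unfolding vu inner_cls[OF s d] penalty_def
    by (simp add: Bochner_Integration.integral_diff integrable_pen sqint_rep sqint_mult s d)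
  also have "\<bar>\<dots>\<bar> \<le> (\<integral>x. \<bar>pen (rep v x) - pen (rep u x) - pen' (rep u x) * (rep v x - rep u x)\<bar> \<partial>lborel)"
    using integral_norm_bound[of lborel "\<lambda>x. pen (rep v x) - pen (rep u x) - pen' (rep u x) * (rep v x - rep u x)"] by simp
  also have "\<dots> \<le> (\<integral>x. 2 * (rep v x - rep u x)\<^sup>2 \<partial>lborel)"
  proof (rule integral_mono)
    show "integrable lborel (\<lambda>x. 2 * (rep v x - rep u x)\<^sup>2)" using d by (simp add: sqint_def)
  qed (rule integrable_abs[OF i] pen_taylor)+
  also have "\<dots> = 2 * (norm (v - u))\<^sup>2" unfolding vu norm_cls[OF d] by simp
  finally show ?thesis .
qed

lemma has_vector_derivative_imp_quotient:
  assumes "(U has_vector_derivative D) (at t within S)"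
  shows "((\<lambda>s. (1 / (s - t)) *\<^sub>R (U s - U t)) \<longlongrightarrow> D) (at t within S)"
proof -
  have l: "((\<lambda>s. (1 / norm (s - t)) *\<^sub>R (U s - (U t + (s - t) *\<^sub>R D))) \<longlongrightarrow> 0) (at t within S)"
    using assms unfolding has_vector_derivative_def has_derivative_within by blast
  have "((\<lambda>s. (1 / (s - t)) *\<^sub>R (U s - U t) - D) \<longlongrightarrow> 0) (at t within S)"
  proof (rule Lim_null_comparison)
    show "\<forall>\<^sub>F s in at t within S. norm ((1 / (s - t)) *\<^sub>R (U s - U t) - D)
        \<le> norm ((1 / norm (s - t)) *\<^sub>R (U s - (U t + (s - t) *\<^sub>R D)))"
      unfolding eventually_at_filter
    proof (intro always_eventually allI impI)
      fix s assume s: "s \<noteq> t"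
      have e: "(1 / (s - t)) *\<^sub>R (U s - (U t + (s - t) *\<^sub>R D)) = (1 / (s - t)) *\<^sub>R (U s - U t) - D"
        using s by (simp add: diff_diff_eq[symmetric] scaleR_diff_right)
      show "norm ((1 / (s - t)) *\<^sub>R (U s - U t) - D) \<le> norm ((1 / norm (s - t)) *\<^sub>R (U s - (U t + (s - t) *\<^sub>R D)))"
        unfolding e[symmetric] norm_scaleR by simp
    qed
    show "((\<lambda>s. norm ((1 / norm (s - t)) *\<^sub>R (U s - (U t + (s - t) *\<^sub>R D)))) \<longlongrightarrow> 0) (at t within S)"
      using tendsto_norm[OF l] by simp
  qed
  then show ?thesis by (simp add: LIM_zero_iff)
qed

lemma penalty_has_derivative:
  assumes U: "(U has_vector_derivative D) (at t within S)"
  shows "((\<lambda>s. penalty (U s)) has_real_derivative inner (cls (\<lambda>x. pen' (rep (U t) x))) D) (at t within S)"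
proof -
  define P where "P = cls (\<lambda>x. pen' (rep (U t) x))"
  have q: "((\<lambda>s. (1 / (s - t)) *\<^sub>R (U s - U t)) \<longlongrightarrow> D) (at t within S)"
    by (rule has_vector_derivative_imp_quotient[OF U])
  have c: "((\<lambda>s. U s - U t) \<longlongrightarrow> 0) (at t within S)"
    using has_vector_derivative_continuous[OF U] by (simp add: continuous_within LIM_zero_iff)
  have l: "((\<lambda>s. (penalty (U s) - penalty (U t)) / (s - t) - inner P ((1 / (s - t)) *\<^sub>R (U s - U t))) \<longlongrightarrow> 0) (at t within S)"
  proof (rule Lim_null_comparison)
    show "\<forall>\<^sub>F s in at t within S. norm ((penalty (U s) - penalty (U t)) / (s - t) - inner P ((1 / (s - t)) *\<^sub>R (U s - U t)))
       \<le> 2 * (norm ((1 / (s - t)) *\<^sub>R (U s - U t)) * norm (U s - U t))"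
      unfolding eventually_at_filter
    proof (intro always_eventually allI impI)
      fix s assume s: "s \<noteq> t"
      have "(penalty (U s) - penalty (U t)) / (s - t) - inner P ((1 / (s - t)) *\<^sub>R (U s - U t))
         = (penalty (U s) - penalty (U t) - inner P (U s - U t)) / (s - t)" by (simp add: diff_divide_distrib)
      then have "norm ((penalty (U s) - penalty (U t)) / (s - t) - inner P ((1 / (s - t)) *\<^sub>R (U s - U t)))
         = \<bar>penalty (U s) - penalty (U t) - inner P (U s - U t)\<bar> / \<bar>s - t\<bar>" by (simp add: abs_divide)
      also have "\<dots> \<le> 2 * (norm (U s - U t))\<^sup>2 / \<bar>s - t\<bar>"
        unfolding P_def by (intro divide_right_mono penalty_taylor) simp
      also have "\<dots> = 2 * (norm ((1 / (s - t)) *\<^sub>R (U s - U t)) * norm (U s - U t))"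
        by (simp add: power2_eq_square)
      finally show "norm ((penalty (U s) - penalty (U t)) / (s - t) - inner P ((1 / (s - t)) *\<^sub>R (U s - U t)))
       \<le> 2 * (norm ((1 / (s - t)) *\<^sub>R (U s - U t)) * norm (U s - U t))" .
    qed
    have "((\<lambda>s. 2 * (norm ((1 / (s - t)) *\<^sub>R (U s - U t)) * norm (U s - U t))) \<longlongrightarrow> 2 * (norm D * norm (0::l2))) (at t within S)"
      by (intro tendsto_intros q c)
    then show "((\<lambda>s. 2 * (norm ((1 / (s - t)) *\<^sub>R (U s - U t)) * norm (U s - U t))) \<longlongrightarrow> 0) (at t within S)" by simp
  qed
  have "((\<lambda>s. inner P ((1 / (s - t)) *\<^sub>R (U s - U t))) \<longlongrightarrow> inner P D) (at t within S)"
    by (intro tendsto_inner tendsto_const q)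
  from tendsto_add[OF l this] show ?thesis by (simp add: has_field_derivative_iff P_def)
qed

text \<open>Three uses of \<open>test_fn_resolvent\<close> provide the chain of preimages that the
  abstract evolution starts from. The last conclusion has the Laplacian moved onto the test
  function, the form in which a subsolution is paired with the flow.\<close>

theorem heat_flow_exists:
  assumes \<Omega>: "\<Omega> \<in> sets borel" and f: "test_fn \<Omega> f f1 f2" and pos: "\<And>x. 0 \<le> f x"
  obtains U :: "real \<Rightarrow> l2" where "U 0 = cls f"
    "heat_orbit \<Omega> f (\<lambda>t. if t = 0 then f else rep (U t))"
    "\<And>t. 0 \<le> t \<Longrightarrow> norm (U t) \<le> norm (cls f)"
    "\<And>t. 0 \<le> t \<Longrightarrow> AE x in lborel. 0 \<le> rep (U t) x"
    "\<And>p p1 p2 p11 p12 p21 p22 t. test_fn \<Omega> p p1 p2 \<Longrightarrow> test_fn \<Omega> p1 p11 p12 \<Longrightarrow> test_fn \<Omega> p2 p21 p22 \<Longrightarrow> 0 \<le> t \<Longrightarrow>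
      ((\<lambda>t. inner (U t) (cls p)) has_real_derivative inner (U t) (cls (\<lambda>x. p11 x + p22 x))) (at t within {0..})"
proof -
  obtain w w1 w2 where w: "test_fn \<Omega> w w1 w2"
    and fw: "\<And>v h. (v, h) \<in> energy_space \<Omega> \<Longrightarrow> inner (cls f) v + inner (cls f1, cls f2) h = inner (cls w) v"
    using test_fn_resolvent[OF f] by metis
  obtain y y1 y2 where y: "test_fn \<Omega> y y1 y2"
    and wy: "\<And>v h. (v, h) \<in> energy_space \<Omega> \<Longrightarrow> inner (cls w) v + inner (cls w1, cls w2) h = inner (cls y) v"
    using test_fn_resolvent[OF w] by metis
  obtain z z1 z2 where z: "test_fn \<Omega> z z1 z2"
    and yz: "\<And>v h. (v, h) \<in> energy_space \<Omega> \<Longrightarrow> inner (cls y) v + inner (cls y1, cls y2) h = inner (cls z) v"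
    using test_fn_resolvent[OF y] by metis
  obtain U F :: "real \<Rightarrow> l2" and G :: "real \<Rightarrow> l2 \<times> l2" where U0: "U 0 = cls f"
    and dU: "\<And>t. 0 \<le> t \<Longrightarrow> (U has_vector_derivative - F t) (at t within {0..})"
    and UV: "\<And>t. 0 \<le> t \<Longrightarrow> (U t, G t) \<in> energy_space \<Omega>"
    and UG: "\<And>t v h. 0 \<le> t \<Longrightarrow> (v, h) \<in> energy_space \<Omega> \<Longrightarrow> inner (G t) h = inner (F t) v"
    and Ule: "\<And>t. 0 \<le> t \<Longrightarrow> norm (U t) \<le> norm (cls f)"
    by (rule weak_evolution_exists[OF subspace_energy_space closed_energy_space
          test_fn_in_energy_space[OF f] fw test_fn_in_energy_space[OF w] wy test_fn_in_energy_space[OF y] yz]) blast+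
  \<comment> \<open>\<open>heat_orbit\<close> asks for \<open>u 0 = f\<close> as functions, whereas
    \<open>rep (U 0)\<close> agrees with \<open>f\<close> only almost everywhere.\<close>
  define u where "u t = (if t = 0 then f else rep (U t))" for t
  have su: "sqint (u t)" for t using test_fn_sqint(1)[OF f] sqint_rep by (simp add: u_def)
  have cu: "cls (u t) = U t" for t by (simp add: u_def U0)
  have orbit: "heat_orbit \<Omega> f u"
    unfolding heat_orbit_def
  proof (intro conjI allI impI)
    show "in_L2 \<Omega> f" by (rule sqint_in_L2[OF test_fn_sqint(1)[OF f]])
    show "u 0 = f" by (simp add: u_def)
    show "in_L2 \<Omega> (u t)" for t by (rule sqint_in_L2[OF su])
    show "((\<lambda>t. norm2 \<Omega> (\<lambda>x. u t x - f x)) \<longlongrightarrow> 0) (at_right 0)"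
    proof (rule norm2_cls_tendsto_0)
      show "sqint (\<lambda>x. u t x - f x)" for t by (rule sqint_diff[OF su test_fn_sqint(1)[OF f]])
      have "(U \<longlongrightarrow> U 0) (at 0 within {0..})"
        using has_vector_derivative_continuous[OF dU[of 0]] by (simp add: continuous_within)
      then have "(U \<longlongrightarrow> U 0) (at_right 0)" by (rule tendsto_within_subset) auto
      then show "((\<lambda>t. cls (\<lambda>x. u t x - f x)) \<longlongrightarrow> 0) (at_right 0)"
        by (simp add: cls_diff[OF su test_fn_sqint(1)[OF f], symmetric] cu U0 LIM_zero_iff)
    qed
    fix t :: real assume t: "0 < t"
    have ut: "u t = rep (U t)" using t by (simp add: u_def)
    show "\<exists>g. dirichlet_lap \<Omega> (u t) g \<and> ((\<lambda>s. norm2 \<Omega> (\<lambda>x. (u s x - u t x) / (s - t) + g x)) \<longlongrightarrow> 0) (at t)"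
    proof (intro exI conjI)
      show "dirichlet_lap \<Omega> (u t) (rep (F t))"
        unfolding ut by (rule dirichlet_lap_rep[OF \<Omega> UV UG]) (use t in auto)
      show "((\<lambda>s. norm2 \<Omega> (\<lambda>x. (u s x - u t x) / (s - t) + rep (F t) x)) \<longlongrightarrow> 0) (at t)"
      proof (rule norm2_cls_tendsto_0)
        have s1: "sqint (\<lambda>x. (1 / (s - t)) * (u s x - u t x))" for s by (intro sqint_scale sqint_diff su)
        have e: "(\<lambda>x. (u s x - u t x) / (s - t) + rep (F t) x) = (\<lambda>x. (1 / (s - t)) * (u s x - u t x) + rep (F t) x)" for s
          by simp
        show "sqint (\<lambda>x. (u s x - u t x) / (s - t) + rep (F t) x)" for s
          unfolding e by (rule sqint_add[OF s1 sqint_rep])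
        have c: "cls (\<lambda>x. (u s x - u t x) / (s - t) + rep (F t) x) = (1 / (s - t)) *\<^sub>R (U s - U t) + F t" for s
        proof -
          have "(1 / (s - t)) *\<^sub>R (U s - U t) = cls (\<lambda>x. (1 / (s - t)) * (u s x - u t x))"
            by (simp only: cls_diff[OF su su] cls_scale[OF sqint_diff[OF su su]] cu[symmetric])
          moreover have "F t = cls (rep (F t))" by simp
          ultimately show ?thesis unfolding e using cls_add[OF s1 sqint_rep] by metis
        qed
        have "at t within {0..} = at t" by (rule at_within_interior) (use t in simp)
        then have "((\<lambda>s. (1 / (s - t)) *\<^sub>R (U s - U t)) \<longlongrightarrow> - F t) (at t)"
          using has_vector_derivative_imp_quotient[OF dU[of t]] t by simp
        from tendsto_add[OF this tendsto_const[of "F t"]]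
        show "((\<lambda>s. cls (\<lambda>x. (u s x - u t x) / (s - t) + rep (F t) x)) \<longlongrightarrow> 0) (at t)" unfolding c by simp
      qed
    qed
  qed
  have "AE x in lborel. 0 \<le> rep (U t) x" if t: "0 \<le> t" for t
  proof -
    have "penalty (U 0) = 0" unfolding penalty_eq_0_iff U0
      using rep_cls[OF test_fn_sqint(1)[OF f]] pos by (auto elim: AE_mp)
    moreover have "penalty (U t) \<le> penalty (U 0)"
    proof (rule DERIV_nonpos_imp_decreasing_open[OF t])
      fix x assume x: "0 < x" "x < t"
      have "at x within {0..} = at x" by (rule at_within_interior) (use x in simp)
      then have "((\<lambda>s. penalty (U s)) has_real_derivative inner (cls (\<lambda>q. pen' (rep (U x) q))) (- F x)) (at x)"
        using penalty_has_derivative[OF dU[of x]] x by simp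
      moreover have "inner (cls (\<lambda>q. pen' (rep (U x) q))) (- F x) \<le> 0"
        using pen'_dissipative[OF UV UG] x by simp
      ultimately show "\<exists>y. ((\<lambda>s. penalty (U s)) has_real_derivative y) (at x) \<and> y \<le> 0" by blast
    next
      show "continuous_on {0..t} (\<lambda>s. penalty (U s))"
      proof (rule continuous_on_subset[of "{0..}"])
        show "continuous_on {0..} (\<lambda>s. penalty (U s))"
          by (rule DERIV_continuous_on[OF penalty_has_derivative[OF dU]]) simp
      qed auto
    qed
    ultimately have "penalty (U t) = 0" using penalty_nonneg[of "U t"] by linarith
    then show ?thesis by (simp add: penalty_eq_0_iff)
  qed
  moreover have "((\<lambda>t. inner (U t) (cls p)) has_real_derivative inner (U t) (cls (\<lambda>x. p11 x + p22 x))) (at t within {0..})"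
    if p: "test_fn \<Omega> p p1 p2" "test_fn \<Omega> p1 p11 p12" "test_fn \<Omega> p2 p21 p22" "0 \<le> t" for p p1 p2 p11 p12 p21 p22 t
  proof -
    \<comment> \<open>The weak form is used in both directions: with the test function as competitor
      for \<open>U t\<close>, and with \<open>U t\<close> as competitor for the test
      function.\<close>
    have "inner (F t) (cls p) = inner (G t) (cls p1, cls p2)"
      using UG[OF p(4) test_fn_in_energy_space[OF p(1)]] by simp
    also have "\<dots> = - inner (cls (\<lambda>x. p11 x + p22 x)) (U t)"
      using weak_laplacian[OF p(1,2,3) UV[OF p(4)]] by (simp add: inner_commute)
    finally have "inner (- F t) (cls p) = inner (U t) (cls (\<lambda>x. p11 x + p22 x))" by (simp add: inner_commute)
    moreover have "((\<lambda>t. inner (U t) (cls p)) has_vector_derivative inner (- F t) (cls p)) (at t within {0..})"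
      by (rule bounded_linear.has_vector_derivative[OF bounded_linear_inner_left dU[OF p(4)]])
    ultimately show ?thesis by (simp add: has_real_derivative_iff_has_vector_derivative)
  qed
  ultimately show ?thesis using that[of U] U0 orbit Ule unfolding u_def by blast
qed

subsection \<open>Subsolutions in planar sectors\<close>

lemma test_fn_zero_extend:
  assumes S: "open S" and f: "smooth_on S f"
    and d: "\<And>x. x \<in> S \<Longrightarrow> has_grad f (g1 x) (g2 x) x"
    and K: "compact K" "K \<subseteq> S" "S \<subseteq> \<Omega>" and off: "\<And>x. x \<in> S \<Longrightarrow> x \<notin> K \<Longrightarrow> f x = 0"
  shows "test_fn \<Omega> (\<lambda>x. if x \<in> S then f x else 0) (\<lambda>x. if x \<in> S then g1 x else 0) (\<lambda>x. if x \<in> S then g2 x else 0)"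
proof -
  define e where "e x = (if x \<in> S then f x else 0)" for x
  have eK: "e x = 0" if "x \<notin> K" for x using off[of x] that by (simp add: e_def)
  have cl: "closed K" by (rule compact_imp_closed[OF K(1)])
  have "smooth_on S e"
    unfolding smooth_on_def
  proof
    fix k
    have "Ck_on S k f" using f unfolding smooth_on_def by (rule spec)
    then show "Ck_on S k e" by (rule Ck_on_cong[OF S, rotated]) (simp add: e_def)
  qed
  then have sm: "smooth_on UNIV e" by (rule smooth_on_zero_extend[OF S cl K(2)]) (rule eK)
  have de: "has_grad e (if x \<in> S then g1 x else 0) (if x \<in> S then g2 x else 0) x" for x
  proof (cases "x \<in> S")
    case True
    have "has_grad e (g1 x) (g2 x) x"
      by (rule has_derivative_transform_within_open[OF d[OF True] S True]) (simp add: e_def)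
    then show ?thesis using True by simp
  next
    case False
    have "has_grad (\<lambda>x::pt. 0::real) 0 0 x" by simp
    then have "has_grad e 0 0 x"
    proof (rule has_derivative_transform_within_open[of _ _ _ _ "- K"])
      show "open (- K)" by (rule open_Compl[OF cl])
      show "x \<in> - K" using False K(2) by auto
      show "0 = e y" if "y \<in> - K" for y by (rule eK[OF ComplD[OF that], symmetric])
    qed
    then show ?thesis using False by simp
  qed
  have "test_fn \<Omega> e (\<lambda>x. if x \<in> S then g1 x else 0) (\<lambda>x. if x \<in> S then g2 x else 0)"
    by (rule test_fnI[OF sm de K(1) order_trans[OF K(2,3)] eK])
  then show ?thesis by (simp add: e_def[abs_def])
qed

text \<open>A smooth stand-in for the positive part, equal to \<open>s exp (- 1 / s)\<close> for
  \<open>s > 0\<close>. It is convex, has slopes in \<open>[0, 1]\<close> and stays within 1 of the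
  positive part, which fixes the constants of the subsolution.\<close>

definition kap :: "real \<Rightarrow> real" where "kap = flat [:0, 1:]"
definition kap' :: "real \<Rightarrow> real" where "kap' = flat (flat_deriv [:0, 1:])"
definition kap'' :: "real \<Rightarrow> real" where "kap'' = flat (flat_deriv (flat_deriv [:0, 1:]))"

lemma kap_deriv: "(kap has_real_derivative kap' s) (at s)" "(kap' has_real_derivative kap'' s) (at s)"
  unfolding kap_def kap'_def kap''_def by (rule flat_has_real_derivative)+

lemma kap_nonpos: "s \<le> 0 \<Longrightarrow> kap s = 0" "s \<le> 0 \<Longrightarrow> kap' s = 0" "s \<le> 0 \<Longrightarrow> kap'' s = 0"
  unfolding kap_def kap'_def kap''_def by (rule flat_nonpos, assumption)+

lemma kap_pos:
  assumes "0 < s"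
  shows "kap s = s * exp (- (1 / s))" "kap' s = (1 + 1 / s) * exp (- (1 / s))" "kap'' s = exp (- (1 / s)) / s ^ 3"
proof -
  define y where "y = 1 / s"
  have y: "s * y = 1" "y \<noteq> 0" "s = 1 / y" using assms by (auto simp: y_def)
  show "kap s = s * exp (- (1 / s))" using assms by (simp add: kap_def flat_eq power2_eq_square)
  have p1: "poly (flat_deriv [:0, 1:]) y = y\<^sup>2 * (1 + y)"
    by (simp add: flat_deriv_def pderiv_pCons power2_eq_square algebra_simps)
  have p2: "poly (flat_deriv (flat_deriv [:0, 1:])) y = y ^ 5"
    by (simp add: flat_deriv_def pderiv_pCons algebra_simps power_numeral_reduce)
  have "kap' s = s\<^sup>2 * (y\<^sup>2 * (1 + y)) * exp (- y)"
    using flat_eq[OF assms, of "flat_deriv [:0, 1:]"] by (simp only: kap'_def y_def[symmetric] p1)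
  also have "\<dots> = (s * y)\<^sup>2 * ((1 + y) * exp (- y))" by (simp only: power_mult_distrib mult_ac)
  finally show "kap' s = (1 + 1 / s) * exp (- (1 / s))" unfolding y(1) y_def[symmetric] by simp
  have "kap'' s = s\<^sup>2 * y ^ 5 * exp (- y)"
    using flat_eq[OF assms, of "flat_deriv (flat_deriv [:0, 1:])"] by (simp only: kap''_def y_def[symmetric] p2)
  also have "\<dots> = exp (- y) / s ^ 3" using y(2) by (simp add: y(3) power_numeral_reduce)
  finally show "kap'' s = exp (- (1 / s)) / s ^ 3" by (simp add: y_def)
qed

lemma kap_nonneg: "0 \<le> kap s"
  by (cases "0 < s") (auto simp: kap_pos kap_nonpos)

lemma kap''_nonneg: "0 \<le> kap'' s"
  by (cases "0 < s") (auto simp: kap_pos kap_nonpos)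

lemma kap'_bounds: "0 \<le> kap' s" "kap' s \<le> 1"
proof -
  have "0 \<le> kap' s \<and> kap' s \<le> 1"
  proof (cases "0 < s")
    case True
    have "(1 + 1 / s) * exp (- (1 / s)) \<le> exp (1 / s) * exp (- (1 / s))"
      by (intro mult_right_mono exp_ge_add_one_self) simp
    then show ?thesis using True by (simp add: kap_pos exp_minus)
  qed (simp add: kap_nonpos)
  then show "0 \<le> kap' s" "kap' s \<le> 1" by auto
qed

lemma kap_le: "0 \<le> s \<Longrightarrow> kap s \<le> s"
  by (cases "0 < s") (auto simp: kap_pos kap_nonpos mult_left_le)

lemma kap_ge: "s - 1 \<le> kap s"
proof (cases "0 < s")
  case True
  have "s * (1 + - (1 / s)) \<le> s * exp (- (1 / s))" using True by (intro mult_left_mono exp_ge_add_one_self) auto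
  then show ?thesis using True by (simp add: kap_pos algebra_simps)
qed (simp add: kap_nonpos)

text \<open>\<open>\<omega>\<close> is a rotation and \<open>p\<close> the apex; \<open>zc\<close>
  moves the apex to 0 and the axis to the positive reals. The bound on \<open>\<nu>\<close> keeps
  the half opening \<open>pi / (2 * \<nu>)\<close> below \<open>pi\<close>, so the branch cut of
  \<open>Ln\<close> stays outside.\<close>

locale planar_sector =
  fixes \<omega> p :: complex and \<nu> :: real
  assumes norm_\<omega>: "cmod \<omega> = 1" and \<nu>: "1/2 < \<nu>"
begin

definition zc :: "pt \<Rightarrow> complex" where "zc x = \<omega> * (Complex (fst x) (snd x) - p)"

definition sector :: "pt set" where
  "sector = {x. zc x \<notin> \<real>\<^sub>\<le>\<^sub>0 \<and> \<bar>Im (Ln (zc x))\<bar> < pi / (2 * \<nu>)}"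

text \<open>A general complex coefficient \<open>c\<close> makes the family contain its own partial
  derivatives. \<open>pw 1 \<nu>\<close> is the harmonic function
  \<open>r^\<nu> cos (\<nu> \<phi>)\<close>, positive in the sector and vanishing on its
  edges.\<close>

definition pw :: "complex \<Rightarrow> real \<Rightarrow> pt \<Rightarrow> real" where
  "pw c \<mu> x = Re (c * zc x powr of_real \<mu>)"

lemma zc_has_derivative: "(zc has_derivative (\<lambda>h. \<omega> * (of_real (fst h) + \<i> * of_real (snd h)))) (at x)"
  unfolding zc_def[abs_def] Complex_eq
  by (auto intro!: derivative_eq_intros simp: algebra_simps)

lemma continuous_on_zc: "continuous_on A zc"
  using has_derivative_continuous[OF zc_has_derivative] by (auto intro: continuous_at_imp_continuous_on)

lemma open_sector: "open sector"
proof -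
  have "open (- \<real>\<^sub>\<le>\<^sub>0 \<inter> (\<lambda>z. \<bar>Im (Ln z)\<bar>) -` {..< pi / (2 * \<nu>)})"
    by (rule continuous_open_preimage) (auto intro!: continuous_intros)
  then have "open (zc -` (- \<real>\<^sub>\<le>\<^sub>0 \<inter> (\<lambda>z. \<bar>Im (Ln z)\<bar>) -` {..< pi / (2 * \<nu>)}))"
    by (rule open_vimage[OF _ continuous_on_zc])
  moreover have "zc -` (- \<real>\<^sub>\<le>\<^sub>0 \<inter> (\<lambda>z. \<bar>Im (Ln z)\<bar>) -` {..< pi / (2 * \<nu>)}) = sector"
    unfolding sector_def by blast
  ultimately show ?thesis by simp
qed

lemma pw_has_derivative:
  assumes "x \<in> sector"
  shows "has_grad (pw c \<mu>) (pw (c * of_real \<mu> * \<omega>) (\<mu> - 1) x) (pw (\<i> * c * of_real \<mu> * \<omega>) (\<mu> - 1) x) x"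
proof -
  have z: "zc x \<notin> \<real>\<^sub>\<le>\<^sub>0" using assms by (simp add: sector_def)
  have "((\<lambda>x. zc x powr of_real \<mu>) has_derivative
    (\<lambda>h. of_real \<mu> * zc x powr (of_real \<mu> - 1) * (\<omega> * (of_real (fst h) + \<i> * of_real (snd h))))) (at x)"
    by (rule has_derivative_compose[OF zc_has_derivative
          has_field_derivative_powr[OF z, unfolded has_field_derivative_def]])
  then have "(pw c \<mu> has_derivative
    (\<lambda>h. Re (c * (of_real \<mu> * zc x powr (of_real \<mu> - 1) * (\<omega> * (of_real (fst h) + \<i> * of_real (snd h))))))) (at x)"
    unfolding pw_def[abs_def]
    by (intro bounded_linear.has_derivative[OF bounded_linear_Re] has_derivative_mult_right)
  moreover have "Re (c * (of_real \<mu> * zc x powr (of_real \<mu> - 1) * (\<omega> * (of_real a + \<i> * of_real b))))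
     = a * pw (c * of_real \<mu> * \<omega>) (\<mu> - 1) x + b * pw (\<i> * c * of_real \<mu> * \<omega>) (\<mu> - 1) x" for a b
  proof -
    have "c * (of_real \<mu> * zc x powr (of_real \<mu> - 1) * (\<omega> * (of_real a + \<i> * of_real b)))
      = of_real a * (c * of_real \<mu> * \<omega> * zc x powr (of_real \<mu> - 1))
      + of_real b * (\<i> * c * of_real \<mu> * \<omega> * zc x powr (of_real \<mu> - 1))" by (simp add: algebra_simps)
    moreover have "Re (of_real a * w1 + of_real b * w2) = a * Re w1 + b * Re w2" for w1 w2 by simp
    ultimately show ?thesis unfolding pw_def by (simp only: of_real_diff of_real_1)
  qed
  ultimately show ?thesis by simp
qed

lemma smooth_on_pw: "smooth_on sector (pw c \<mu>)"
proof (rule smooth_on_family[where F = "{pw c \<mu> | c \<mu>. True}"])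
  fix f assume "f \<in> {pw c \<mu> | c \<mu>. True}"
  then obtain c \<mu> where f: "f = pw c \<mu>" by blast
  show "\<exists>g1\<in>{pw c \<mu> | c \<mu>. True}. \<exists>g2\<in>{pw c \<mu> | c \<mu>. True}.
      \<forall>x\<in>sector. has_grad f (g1 x) (g2 x) x"
    unfolding f
    by (intro bexI[of _ "pw (c * of_real \<mu> * \<omega>) (\<mu> - 1)"] bexI[of _ "pw (\<i> * c * of_real \<mu> * \<omega>) (\<mu> - 1)"] ballI
        pw_has_derivative) blast+
qed blast

lemma pw_one: "x \<in> sector \<Longrightarrow> pw 1 \<mu> x = cmod (zc x) powr \<mu> * cos (\<mu> * Im (Ln (zc x)))"
proof -
  assume "x \<in> sector"
  then have z: "zc x \<noteq> 0" by (auto simp: sector_def)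
  then have "pw 1 \<mu> x = exp (Re (of_real \<mu> * Ln (zc x))) * cos (Im (of_real \<mu> * Ln (zc x)))"
    by (simp add: pw_def powr_def Re_exp)
  then show ?thesis using z by (simp add: powr_def)
qed

lemma zc_inverse: "zc (Re (cnj \<omega> * z + p), Im (cnj \<omega> * z + p)) = z"
proof -
  have "\<omega> * cnj \<omega> = 1" using norm_\<omega> by (simp add: complex_norm_square[symmetric])
  then show ?thesis
    by (simp only: zc_def fst_conv snd_conv complex_surj add_diff_cancel_right' mult.assoc[symmetric] mult_1_left)
qed

lemma zc_eq_iff: "zc x = zc y \<longleftrightarrow> x = y"
  using norm_\<omega> by (auto simp: zc_def prod_eq_iff)

lemma cmod_zc: "(cmod (zc x))\<^sup>2 = (fst x - Re p)\<^sup>2 + (snd x - Im p)\<^sup>2"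
  by (simp add: zc_def norm_mult norm_\<omega> cmod_power2)

section \<open>The Gaussian factor and the profile\<close>

definition gau :: "real \<Rightarrow> pt \<Rightarrow> real" where
  "gau T x = exp (- ((fst x - Re p)\<^sup>2 + (snd x - Im p)\<^sup>2) / (4 * T))"

definition g1 :: "real \<Rightarrow> pt \<Rightarrow> real" where "g1 T x = - (fst x - Re p) / (2 * T) * gau T x"
definition g2 :: "real \<Rightarrow> pt \<Rightarrow> real" where "g2 T x = - (snd x - Im p) / (2 * T) * gau T x"

lemma gau_has_derivative:
  assumes "0 < T"
  shows "has_grad (gau T) (g1 T x) (g2 T x) x"
  unfolding gau_def[abs_def] g1_def g2_def using assms
  by (auto intro!: derivative_eq_intros simp: field_simps fun_eq_iff)

lemma g1_has_derivative:
  assumes "0 < T"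
  shows "has_grad (g1 T) ((- 1 / (2 * T) + (fst x - Re p)\<^sup>2 / (4 * T\<^sup>2)) * gau T x) ((fst x - Re p) * (snd x - Im p) / (4 * T\<^sup>2) * gau T x) x"
proof -
  have "has_grad (\<lambda>x. - (fst x - Re p) / (2 * T)) (- 1 / (2 * T)) 0 x"
    using assms by (auto intro!: derivative_eq_intros)
  from has_derivative_pt_mult[OF this gau_has_derivative[OF assms]]
  show ?thesis unfolding g1_def[abs_def]
    by (rule has_derivative_eq_rhs)
       (use assms in \<open>simp add: fun_eq_iff g1_def g2_def field_simps power2_eq_square\<close>)
qed

lemma g2_has_derivative:
  assumes "0 < T"
  shows "has_grad (g2 T) ((fst x - Re p) * (snd x - Im p) / (4 * T\<^sup>2) * gau T x) ((- 1 / (2 * T) + (snd x - Im p)\<^sup>2 / (4 * T\<^sup>2)) * gau T x) x"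
proof -
  have "has_grad (\<lambda>x. - (snd x - Im p) / (2 * T)) 0 (- 1 / (2 * T)) x"
    using assms by (auto intro!: derivative_eq_intros)
  from has_derivative_pt_mult[OF this gau_has_derivative[OF assms]]
  show ?thesis unfolding g2_def[abs_def]
    by (rule has_derivative_eq_rhs)
       (use assms in \<open>simp add: fun_eq_iff g1_def g2_def field_simps power2_eq_square\<close>)
qed

lemma smooth_on_affine: "smooth_on S (\<lambda>x. a + b * fst x + c * snd x)"
proof (rule smooth_on_family[where F = "{\<lambda>x. a + b * fst x + c * snd x | a b c. True}"])
  fix f :: "pt \<Rightarrow> real" assume "f \<in> {\<lambda>x. a + b * fst x + c * snd x | a b c. True}"
  then obtain a b c where f: "f = (\<lambda>x. a + b * fst x + c * snd x)" by blast
  \<comment> \<open>The zero slopes are written out so that the constant partial derivatives are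
    syntactically members of the family.\<close>
  have "has_grad f (b + 0 * fst x + 0 * snd x) (c + 0 * fst x + 0 * snd x) x" for x
    unfolding f by (auto intro!: derivative_eq_intros)
  then show "\<exists>g1\<in>{\<lambda>x. a + b * fst x + c * snd x | a b c. True}. \<exists>g2\<in>{\<lambda>x. a + b * fst x + c * snd x | a b c. True}.
      \<forall>x\<in>S. has_grad f (g1 x) (g2 x) x"
    by (intro bexI[of _ "\<lambda>x. b + 0 * fst x + 0 * snd x"] bexI[of _ "\<lambda>x. c + 0 * fst x + 0 * snd x"] ballI) blast+
qed blast

lemma smooth_on_gau: "smooth_on S (gau T)"
proof -
  have q: "smooth_on S (\<lambda>x. (- Re p + 1 * fst x + 0 * snd x) * (- Re p + 1 * fst x + 0 * snd x)
      + (- Im p + 0 * fst x + 1 * snd x) * (- Im p + 0 * fst x + 1 * snd x))"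
    by (intro smooth_on_add smooth_on_mult smooth_on_affine)
  have e: "gau T = (\<lambda>x. exp (- 1 / (4 * T) * ((- Re p + 1 * fst x + 0 * snd x) * (- Re p + 1 * fst x + 0 * snd x)
      + (- Im p + 0 * fst x + 1 * snd x) * (- Im p + 0 * fst x + 1 * snd x))))"
  proof
    fix x :: pt
    have l: "- Re p + 1 * fst x + 0 * snd x = fst x - Re p" "- Im p + 0 * fst x + 1 * snd x = snd x - Im p" by simp_all
    show "gau T x = exp (- 1 / (4 * T) * ((- Re p + 1 * fst x + 0 * snd x) * (- Re p + 1 * fst x + 0 * snd x)
      + (- Im p + 0 * fst x + 1 * snd x) * (- Im p + 0 * fst x + 1 * snd x)))"
      unfolding l gau_def
      by (simp only: power2_eq_square minus_divide_left[symmetric] mult_minus_left times_divide_eq_left mult_1_left)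
  qed
  have c: "deriv_closed {exp}" unfolding deriv_closed_def using DERIV_exp by blast
  show ?thesis unfolding e
    by (rule smooth_on_compose[OF c]) (simp, rule smooth_on_mult[OF smooth_on_const q])
qed

definition prof :: "real \<Rightarrow> real \<Rightarrow> pt \<Rightarrow> real" where
  "prof \<Lambda> T x = \<Lambda> * (pw 1 \<nu> x * gau T x)"

lemma prof_eq:
  assumes "x \<in> sector"
  shows "prof \<Lambda> T x = \<Lambda> * cmod (zc x) powr \<nu> * cos (\<nu> * Im (Ln (zc x))) * exp (- (cmod (zc x))\<^sup>2 / (4 * T))"
  unfolding prof_def pw_one[OF assms] gau_def cmod_zc by (simp add: mult_ac)

lemma cos_pos_sector:
  assumes "x \<in> sector"
  shows "0 < cos (\<nu> * Im (Ln (zc x)))"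
proof (rule cos_gt_zero_pi)
  have "\<nu> * \<bar>Im (Ln (zc x))\<bar> < \<nu> * (pi / (2 * \<nu>))"
    using assms \<nu> by (intro mult_strict_left_mono) (auto simp: sector_def)
  then have "\<bar>\<nu> * Im (Ln (zc x))\<bar> < pi / 2" using \<nu> by (simp add: abs_mult)
  then show "- (pi / 2) < \<nu> * Im (Ln (zc x))" "\<nu> * Im (Ln (zc x)) < pi / 2" by auto
qed

lemma prof_pos: "x \<in> sector \<Longrightarrow> 0 < \<Lambda> \<Longrightarrow> 0 < prof \<Lambda> T x"
  using cos_pos_sector[of x] by (auto simp: prof_eq sector_def intro!: mult_pos_pos)

lemma prof_le:
  assumes "x \<in> sector" "0 < \<Lambda>"
  shows "prof \<Lambda> T x \<le> \<Lambda> * cmod (zc x) powr \<nu> * exp (- (cmod (zc x))\<^sup>2 / (4 * T))"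
proof -
  have "\<Lambda> * cmod (zc x) powr \<nu> * cos (\<nu> * Im (Ln (zc x))) \<le> \<Lambda> * cmod (zc x) powr \<nu> * 1"
    by (intro mult_left_mono) (use assms in auto)
  then show ?thesis unfolding prof_eq[OF assms(1)] by (intro mult_right_mono) auto
qed

text \<open>A superlevel set is the image of a compact set of polar coordinates, which keeps the branch cut of
  the logarithm out of the argument.\<close>

lemma compact_superlevel:
  assumes L: "0 < \<Lambda>" and T: "0 < T" and tail: "\<And>r. \<rho> < r \<Longrightarrow> \<Lambda> * r powr \<nu> * exp (- r\<^sup>2 / (4 * T)) < 1"
  shows "\<exists>K. compact K \<and> K \<subseteq> sector \<and> (\<forall>x\<in>sector. x \<notin> K \<longrightarrow> prof \<Lambda> T x < 1)"
proof -
  define c where "c = pi / (2 * \<nu>)"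
  have c: "0 < c" "c < pi" "\<nu> * c = pi / 2" using \<nu> by (auto simp: c_def field_simps)
  define m where "m q = \<Lambda> * fst q powr \<nu> * cos (\<nu> * snd q) * exp (- (fst q)\<^sup>2 / (4 * T))" for q :: pt
  \<comment> \<open>The rectangle includes the edges and radius 0, so \<open>A\<close> is compact;
    \<open>m\<close> vanishes at those points, so the condition \<open>1 \<le> m q\<close> keeps
    \<open>A\<close> away from them.\<close>
  define A where "A = {q \<in> {0..\<rho>} \<times> {- c..c}. 1 \<le> m q}"
  define X where "X q = (let z = of_real (fst q) * exp (\<i> * of_real (snd q)) in (Re (cnj \<omega> * z + p), Im (cnj \<omega> * z + p)))" for q :: pt
  have zX: "zc (X q) = of_real (fst q) * exp (\<i> * of_real (snd q))" for q
    unfolding X_def Let_def by (rule zc_inverse)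
  have "continuous_on ({0..\<rho>} \<times> {- c..c}) m"
    unfolding m_def using \<nu> T by (auto intro!: continuous_intros continuous_on_powr')
  then have "closed A"
    unfolding A_def by (intro continuous_on_closed_Collect_le continuous_on_const) (auto intro: closed_Times)
  moreover have "A = A \<inter> ({0..\<rho>} \<times> {- c..c})" by (auto simp: A_def)
  ultimately have "compact A" by (metis closed_Int_compact compact_Icc compact_Times)
  moreover have "continuous_on A X" unfolding X_def Let_def by (auto intro!: continuous_intros)
  ultimately have K: "compact (X ` A)" by (rule compact_continuous_image[rotated])
  have sub: "X q \<in> sector" if q: "q \<in> A" for q
  proof -
    obtain r \<eta> where [simp]: "q = (r, \<eta>)" by (cases q)
    have q': "0 \<le> r" "\<bar>\<eta>\<bar> \<le> c" "1 \<le> \<Lambda> * r powr \<nu> * cos (\<nu> * \<eta>) * exp (- r\<^sup>2 / (4 * T))"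
      using q by (auto simp: A_def m_def)
    have r: "0 < r" using q'(1,3) by (cases "r = 0") auto
    have "cos (\<nu> * \<eta>) \<noteq> 0" using q'(3) by auto
    moreover have "cos (\<nu> * \<eta>) = cos (\<nu> * \<bar>\<eta>\<bar>)" by (cases "\<eta> \<ge> 0") auto
    ultimately have "\<bar>\<eta>\<bar> \<noteq> c" using c(3) cos_pi_half by metis
    then have \<eta>: "\<bar>\<eta>\<bar> < c" using q'(2) by simp
    \<comment> \<open>The logarithm written explicitly: its imaginary part lies strictly between
      \<open>- pi\<close> and \<open>pi\<close>, so \<open>Ln\<close> inverts \<open>exp\<close> at
      \<open>w\<close>.\<close>
    define w where "w = Complex (ln r) \<eta>"
    have z: "zc (X q) = exp w" unfolding zX using r
      by (simp add: w_def Complex_eq exp_add exp_of_real)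
    have ln: "Ln (zc (X q)) = w" unfolding z by (rule Ln_exp) (use \<eta> c in \<open>auto simp: w_def\<close>)
    have nz: "zc (X q) \<noteq> 0" unfolding z by simp
    have "zc (X q) \<notin> \<real>\<^sub>\<le>\<^sub>0"
    proof
      assume "zc (X q) \<in> \<real>\<^sub>\<le>\<^sub>0"
      then have "Re (zc (X q)) < 0 \<and> Im (zc (X q)) = 0"
        using nz by (auto simp: complex_nonpos_Reals_iff complex_eq_iff)
      then have "Im (Ln (zc (X q))) = pi" using Im_Ln_eq_pi[OF nz] by blast
      then show False using \<eta> c unfolding ln w_def complex.sel by linarith
    qed
    then show ?thesis using \<eta> unfolding sector_def c_def mem_Collect_eq ln w_def complex.sel by blast
  qed
  have "x \<in> X ` A" if x: "x \<in> sector" "1 \<le> prof \<Lambda> T x" for x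
  proof
    define q where "q = (cmod (zc x), Im (Ln (zc x)))"
    have nz: "zc x \<noteq> 0" using x(1) by (auto simp: sector_def)
    have "of_real (fst q) * exp (\<i> * of_real (snd q)) = exp (Complex (ln (cmod (zc x))) (Im (Ln (zc x))))"
      using nz by (simp add: q_def Complex_eq exp_add exp_of_real)
    also have "Complex (ln (cmod (zc x))) (Im (Ln (zc x))) = Ln (zc x)" using nz by (simp add: complex_eq_iff)
    finally have "zc (X q) = zc x" using nz by (simp add: zX)
    then show "x = X q" by (simp add: zc_eq_iff)
    have "1 \<le> \<Lambda> * cmod (zc x) powr \<nu> * exp (- (cmod (zc x))\<^sup>2 / (4 * T))" using prof_le[OF x(1) L, of T] x(2) by simp
    then have "cmod (zc x) \<le> \<rho>" using tail[of "cmod (zc x)"] by force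
    then show "q \<in> A" using x by (auto simp: A_def q_def m_def prof_eq sector_def c_def abs_less_iff)
  qed
  then have "\<forall>x\<in>sector. x \<notin> X ` A \<longrightarrow> prof \<Lambda> T x < 1" by (meson not_le)
  then show ?thesis using K sub by (intro exI[of _ "X ` A"]) auto
qed

definition bump :: "real \<Rightarrow> real \<Rightarrow> pt \<Rightarrow> real" where
  "bump \<Lambda> T x = (if x \<in> sector then kap (prof \<Lambda> T x - 1) else 0)"

lemma bump_nonneg: "0 \<le> bump \<Lambda> T x"
  by (simp add: bump_def kap_nonneg)

lemma prof_tail:
  assumes "0 < \<Lambda>" "\<And>r. \<rho> < r \<Longrightarrow> \<Lambda> * r powr \<nu> * exp (- r\<^sup>2 / (4 * T)) < 1"
    and "x \<in> sector" "1 < prof \<Lambda> T x"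
  shows "cmod (zc x) \<le> \<rho>"
  using prof_le[OF assms(3,1), of T] assms(2)[of "cmod (zc x)"] assms(4) by force

lemma bump_le:
  assumes "0 < \<Lambda>" "0 < T" "\<And>r. \<rho> < r \<Longrightarrow> \<Lambda> * r powr \<nu> * exp (- r\<^sup>2 / (4 * T)) < 1"
  shows "bump \<Lambda> T x \<le> \<Lambda> * \<rho> powr \<nu> * indicator {x. cmod (zc x) \<le> \<rho>} x"
proof (cases "x \<in> sector \<and> 1 < prof \<Lambda> T x")
  case True
  then have r: "cmod (zc x) \<le> \<rho>" using prof_tail[OF assms(1,3)] by blast
  have "bump \<Lambda> T x \<le> prof \<Lambda> T x - 1" using True by (simp add: bump_def kap_le)
  also have "\<dots> \<le> \<Lambda> * cmod (zc x) powr \<nu> * exp (- (cmod (zc x))\<^sup>2 / (4 * T))"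
    using prof_le[of x \<Lambda> T] True assms(1) by simp
  also have "\<dots> \<le> \<Lambda> * \<rho> powr \<nu> * 1"
    using r assms \<nu> by (intro mult_mono mult_left_mono powr_mono2) auto
  finally show ?thesis using r by simp
next
  case False
  then have "bump \<Lambda> T x = 0" by (auto simp: bump_def kap_nonpos)
  then show ?thesis using assms(1) by simp
qed

text \<open>With \<open>V = prof - 1\<close>, the Laplacian of \<open>kap V\<close> is
  \<open>kap'' V\<close> times the squared gradient plus \<open>kap' V\<close> times
  \<open>\<Delta> V\<close>; convexity discards the former. Where \<open>V > 0\<close>, the
  inequality \<open>tail\<close> confines the point to the disc, and
  \<open>kap' * prof \<le> prof = V + 1 \<le> kap V + 2\<close> accounts for the error
  \<open>2 * indicator\<close>.\<close>

theorem bump_subsolution: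
  assumes L: "0 < \<Lambda>" and T: "0 < T" and tail: "\<And>r. \<rho> < r \<Longrightarrow> \<Lambda> * r powr \<nu> * exp (- r\<^sup>2 / (4 * T)) < 1"
    and sub: "sector \<subseteq> \<Omega>"
  shows "\<exists>b1 b2 b11 b12 b21 b22. test_fn \<Omega> (bump \<Lambda> T) b1 b2 \<and> test_fn \<Omega> b1 b11 b12 \<and> test_fn \<Omega> b2 b21 b22 \<and>
    (\<forall>x. - ((1 + \<nu>) / T) * (bump \<Lambda> T x + 2 * indicator {x. cmod (zc x) \<le> \<rho>} x) \<le> b11 x + b22 x)"
proof -
  define V where "V x = prof \<Lambda> T x - 1" for x
  define H1 where "H1 = pw (1 * of_real \<nu> * \<omega>) (\<nu> - 1)"
  define H2 where "H2 = pw (\<i> * 1 * of_real \<nu> * \<omega>) (\<nu> - 1)"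
  define H11 where "H11 = pw (1 * of_real \<nu> * \<omega> * of_real (\<nu> - 1) * \<omega>) (\<nu> - 1 - 1)"
  define H12 where "H12 = pw (\<i> * (1 * of_real \<nu> * \<omega>) * of_real (\<nu> - 1) * \<omega>) (\<nu> - 1 - 1)"
  define H21 where "H21 = pw ((\<i> * 1 * of_real \<nu> * \<omega>) * of_real (\<nu> - 1) * \<omega>) (\<nu> - 1 - 1)"
  define H22 where "H22 = pw (\<i> * (\<i> * 1 * of_real \<nu> * \<omega>) * of_real (\<nu> - 1) * \<omega>) (\<nu> - 1 - 1)"
  have dH: "has_grad (pw 1 \<nu>) (H1 x) (H2 x) x"
    and dH1: "has_grad H1 (H11 x) (H12 x) x"
    and dH2: "has_grad H2 (H21 x) (H22 x) x" if "x \<in> sector" for x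
    unfolding H1_def H2_def H11_def H12_def H21_def H22_def by (rule pw_has_derivative[OF that])+
  define X where "X x = fst x - Re p" for x :: pt
  define Y where "Y x = snd x - Im p" for x :: pt
  define G11 where "G11 x = (- 1 / (2 * T) + (X x)\<^sup>2 / (4 * T\<^sup>2)) * gau T x" for x
  define G12 where "G12 x = X x * Y x / (4 * T\<^sup>2) * gau T x" for x
  define G22 where "G22 x = (- 1 / (2 * T) + (Y x)\<^sup>2 / (4 * T\<^sup>2)) * gau T x" for x
  note dG = gau_has_derivative[OF T]
  have dG1: "has_grad (g1 T) (G11 x) (G12 x) x"
    and dG2: "has_grad (g2 T) (G12 x) (G22 x) x" for x
    unfolding G11_def G12_def G22_def X_def Y_def by (rule g1_has_derivative[OF T] g2_has_derivative[OF T])+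
  define V1 where "V1 x = \<Lambda> * (H1 x * gau T x + pw 1 \<nu> x * g1 T x)" for x
  define V2 where "V2 x = \<Lambda> * (H2 x * gau T x + pw 1 \<nu> x * g2 T x)" for x
  define V11 where "V11 x = \<Lambda> * ((H11 x * gau T x + H1 x * g1 T x) + (H1 x * g1 T x + pw 1 \<nu> x * G11 x))" for x
  define V12 where "V12 x = \<Lambda> * ((H12 x * gau T x + H1 x * g2 T x) + (H2 x * g1 T x + pw 1 \<nu> x * G12 x))" for x
  define V21 where "V21 x = \<Lambda> * ((H21 x * gau T x + H2 x * g1 T x) + (H1 x * g2 T x + pw 1 \<nu> x * G12 x))" for x
  define V22 where "V22 x = \<Lambda> * ((H22 x * gau T x + H2 x * g2 T x) + (H2 x * g2 T x + pw 1 \<nu> x * G22 x))" for x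
  have cmul: "has_grad (\<lambda>x. c * f x) (c * a) (c * b) x"
    if "has_grad f a b x" for f :: "pt \<Rightarrow> real" and a b c x
    by (rule has_derivative_eq_rhs[OF has_derivative_mult_right[OF that]]) (simp add: algebra_simps)
  have add: "has_grad (\<lambda>x. f x + f' x) (a + a') (b + b') x"
    if "has_grad f a b x" "has_grad f' a' b' x"
    for f f' :: "pt \<Rightarrow> real" and a b a' b' x
    by (rule has_derivative_eq_rhs[OF has_derivative_add[OF that]]) (simp add: algebra_simps)
  have dV: "has_grad V (V1 x) (V2 x) x"
    and dV1: "has_grad V1 (V11 x) (V12 x) x"
    and dV2: "has_grad V2 (V21 x) (V22 x) x" if x: "x \<in> sector" for x
  proof -
    have "has_grad (\<lambda>x. prof \<Lambda> T x + - 1) (V1 x + 0) (V2 x + 0) x"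
      unfolding prof_def V1_def V2_def
      by (rule add[OF cmul[OF has_derivative_pt_mult[OF dH[OF x] dG]]]) simp
    then show "has_grad V (V1 x) (V2 x) x" by (simp add: V_def[abs_def])
    show "has_grad V1 (V11 x) (V12 x) x"
      unfolding V1_def[abs_def] V11_def V12_def
      by (rule cmul[OF add[OF has_derivative_pt_mult[OF dH1[OF x] dG] has_derivative_pt_mult[OF dH[OF x] dG1]]])
    show "has_grad V2 (V21 x) (V22 x) x"
      unfolding V2_def[abs_def] V21_def V22_def
      by (rule cmul[OF add[OF has_derivative_pt_mult[OF dH2[OF x] dG] has_derivative_pt_mult[OF dH[OF x] dG2]]])
  qed
  \<comment> \<open>Product rule for the harmonic \<open>h = pw 1 \<nu>\<close> and the Gaussian
    \<open>g\<close>: \<open>h \<Delta> g\<close> is \<open>(r^2 / (4 T^2) - 1 / T) h g\<close>, and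
    Euler's relation turns the cross term into \<open>- (\<nu> / T) h g\<close>.\<close>
  have lapV: "V11 x + V22 x = prof \<Lambda> T x * ((cmod (zc x))\<^sup>2 / (4 * T\<^sup>2) - (1 + \<nu>) / T)" if x: "x \<in> sector" for x
  proof -
    \<comment> \<open>Harmonicity: differentiating twice in the second variable brings out
      \<open>\<i>^2 = -1\<close>.\<close>
    have h0: "H11 x + H22 x = 0"
    proof -
      have "\<i> * (\<i> * 1 * of_real \<nu> * \<omega>) * of_real (\<nu> - 1) * \<omega> = - (1 * of_real \<nu> * \<omega> * of_real (\<nu> - 1) * \<omega>)"
        by (simp add: algebra_simps)
      then show ?thesis unfolding H11_def H22_def pw_def by simp
    qed
    have nz: "zc x \<noteq> 0" using x by (auto simp: sector_def)
    \<comment> \<open>Euler's relation for a function homogeneous of degree \<open>\<nu>\<close>,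
      read off from \<open>z * z^(\<nu> - 1) = z^\<nu>\<close>.\<close>
    have euler: "X x * H1 x + Y x * H2 x = \<nu> * pw 1 \<nu> x"
    proof -
      have "zc x * zc x powr of_real (\<nu> - 1) = zc x powr of_real \<nu>"
        using nz powr_add[of "zc x" 1 "of_real (\<nu> - 1)"] by simp
      moreover have "of_real (X x) * (1 * of_real \<nu> * \<omega> * W) + of_real (Y x) * (\<i> * 1 * of_real \<nu> * \<omega> * W)
          = of_real \<nu> * (zc x * W)" for W
        unfolding X_def Y_def zc_def by (simp add: complex_eq_iff algebra_simps)
      ultimately have "of_real (X x) * (1 * of_real \<nu> * \<omega> * zc x powr of_real (\<nu> - 1))
          + of_real (Y x) * (\<i> * 1 * of_real \<nu> * \<omega> * zc x powr of_real (\<nu> - 1)) = of_real \<nu> * (1 * zc x powr of_real \<nu>)"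
        by simp
      from arg_cong[OF this, of Re] show ?thesis unfolding H1_def H2_def pw_def by simp
    qed
    have r: "(cmod (zc x))\<^sup>2 = (X x)\<^sup>2 + (Y x)\<^sup>2" by (simp add: cmod_zc X_def Y_def)
    have g: "g1 T x = - X x / (2 * T) * gau T x" "g2 T x = - Y x / (2 * T) * gau T x"
      by (simp_all add: g1_def g2_def X_def Y_def)
    have "V11 x + V22 x = \<Lambda> * ((H11 x + H22 x) * gau T x + 2 * (H1 x * g1 T x + H2 x * g2 T x) + pw 1 \<nu> x * (G11 x + G22 x))"
      by (simp add: V11_def V22_def algebra_simps)
    also have "H1 x * g1 T x + H2 x * g2 T x = - (X x * H1 x + Y x * H2 x) / (2 * T) * gau T x"
    proof -
      have "h1 * (- a / (2 * T) * e) + h2 * (- b / (2 * T) * e) = - (a * h1 + b * h2) / (2 * T) * e" for a b h1 h2 e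
        using T by (simp add: field_simps)
      then show ?thesis unfolding g by blast
    qed
    also have "G11 x + G22 x = (- 1 / T + ((X x)\<^sup>2 + (Y x)\<^sup>2) / (4 * T\<^sup>2)) * gau T x"
    proof -
      have "(- 1 / (2 * T) + a / (4 * T\<^sup>2)) * e + (- 1 / (2 * T) + b / (4 * T\<^sup>2)) * e = (- 1 / T + (a + b) / (4 * T\<^sup>2)) * e" for a b e
        using T by (simp add: field_simps power2_eq_square)
      then show ?thesis unfolding G11_def G22_def by blast
    qed
    finally have "V11 x + V22 x = \<Lambda> * (2 * (- (\<nu> * pw 1 \<nu> x) / (2 * T) * gau T x)
      + pw 1 \<nu> x * ((- 1 / T + (cmod (zc x))\<^sup>2 / (4 * T\<^sup>2)) * gau T x))"
      unfolding h0 euler r by simp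
    also have "\<dots> = \<Lambda> * (pw 1 \<nu> x * gau T x) * ((cmod (zc x))\<^sup>2 / (4 * T\<^sup>2) - (1 + \<nu>) / T)"
    proof -
      have "\<Lambda> * (2 * (- (\<nu> * P) / (2 * T) * e) + P * ((- 1 / T + r / (4 * T\<^sup>2)) * e))
         = \<Lambda> * (P * e) * (r / (4 * T\<^sup>2) - (1 + \<nu>) / T)" for P e r
        using T by (simp add: field_simps power2_eq_square)
      then show ?thesis by blast
    qed
    finally show ?thesis by (simp add: prof_def)
  qed
  obtain K where K: "compact K" "K \<subseteq> sector" "\<And>x. x \<in> sector \<Longrightarrow> x \<notin> K \<Longrightarrow> prof \<Lambda> T x < 1"
    using compact_superlevel[OF L T tail] by metis
  have sV: "smooth_on sector V"
    unfolding V_def[abs_def] prof_def diff_conv_add_uminus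
    by (intro smooth_on_add smooth_on_mult smooth_on_const smooth_on_pw smooth_on_gau)
  have off: "V x \<le> 0" if "x \<in> sector" "x \<notin> K" for x using K(3)[OF that] by (simp add: V_def)
  have sk: "smooth_on sector (\<lambda>x. kap (V x))"
    by (rule smooth_on_compose[OF deriv_closed_flat _ sV]) (simp add: kap_def)
  have dk: "has_grad (\<lambda>x. kap (V x)) (kap' (V x) * V1 x) (kap' (V x) * V2 x) x"
    if "x \<in> sector" for x by (rule has_derivative_pt_comp[OF dV[OF that] kap_deriv(1)])
  note sk12 = smooth_on_partial[OF open_sector sk dk]
  have dk': "has_grad (\<lambda>x. kap' (V x)) (kap'' (V x) * V1 x) (kap'' (V x) * V2 x) x"
    if "x \<in> sector" for x by (rule has_derivative_pt_comp[OF dV[OF that] kap_deriv(2)])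
  note dk1 = has_derivative_pt_mult[OF dk' dV1]
  note dk2 = has_derivative_pt_mult[OF dk' dV2]
  have "test_fn \<Omega> (\<lambda>x. if x \<in> sector then kap (V x) else 0) (\<lambda>x. if x \<in> sector then kap' (V x) * V1 x else 0)
      (\<lambda>x. if x \<in> sector then kap' (V x) * V2 x else 0)"
    by (rule test_fn_zero_extend[OF open_sector sk dk K(1,2) sub]) (use off kap_nonpos in auto)
  moreover have "(\<lambda>x. if x \<in> sector then kap (V x) else 0) = bump \<Lambda> T" by (auto simp: bump_def V_def)
  ultimately have t0: "test_fn \<Omega> (bump \<Lambda> T) (\<lambda>x. if x \<in> sector then kap' (V x) * V1 x else 0)
      (\<lambda>x. if x \<in> sector then kap' (V x) * V2 x else 0)" by simp
  have t1: "test_fn \<Omega> (\<lambda>x. if x \<in> sector then kap' (V x) * V1 x else 0)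
     (\<lambda>x. if x \<in> sector then kap'' (V x) * V1 x * V1 x + kap' (V x) * V11 x else 0)
     (\<lambda>x. if x \<in> sector then kap'' (V x) * V2 x * V1 x + kap' (V x) * V12 x else 0)"
    by (rule test_fn_zero_extend[OF open_sector sk12(1) dk1 K(1,2) sub]) (use off kap_nonpos in auto)
  have t2: "test_fn \<Omega> (\<lambda>x. if x \<in> sector then kap' (V x) * V2 x else 0)
     (\<lambda>x. if x \<in> sector then kap'' (V x) * V1 x * V2 x + kap' (V x) * V21 x else 0)
     (\<lambda>x. if x \<in> sector then kap'' (V x) * V2 x * V2 x + kap' (V x) * V22 x else 0)"
    by (rule test_fn_zero_extend[OF open_sector sk12(2) dk2 K(1,2) sub]) (use off kap_nonpos in auto)
  have lap: "- ((1 + \<nu>) / T) * (bump \<Lambda> T x + 2 * indicator {x. cmod (zc x) \<le> \<rho>} x)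
     \<le> (if x \<in> sector then kap'' (V x) * V1 x * V1 x + kap' (V x) * V11 x else 0)
      + (if x \<in> sector then kap'' (V x) * V2 x * V2 x + kap' (V x) * V22 x else 0)" for x
  proof -
    define N where "N = (1 + \<nu>) / T"
    have N: "0 \<le> N" using T \<nu> by (simp add: N_def)
    have b: "0 \<le> bump \<Lambda> T x + 2 * indicator {x. cmod (zc x) \<le> \<rho>} x" by (simp add: bump_nonneg)
    show ?thesis
    proof (cases "x \<in> sector")
      case True
      have P: "0 < prof \<Lambda> T x" by (rule prof_pos[OF True L])
      have "kap' (V x) * prof \<Lambda> T x \<le> bump \<Lambda> T x + 2 * indicator {x. cmod (zc x) \<le> \<rho>} x"
      proof (cases "V x \<le> 0")
        case True
        then show ?thesis using b by (simp add: kap_nonpos)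
      next
        case False
        then have "cmod (zc x) \<le> \<rho>" using prof_tail[OF L tail True] by (simp add: V_def)
        moreover have "kap' (V x) * prof \<Lambda> T x \<le> 1 * prof \<Lambda> T x"
          using kap'_bounds P by (intro mult_right_mono) auto
        moreover have "prof \<Lambda> T x \<le> kap (V x) + 2" using kap_ge[of "V x"] by (simp add: V_def)
        ultimately show ?thesis using True by (simp add: bump_def V_def)
      qed
      then have "- N * (bump \<Lambda> T x + 2 * indicator {x. cmod (zc x) \<le> \<rho>} x) \<le> - N * (kap' (V x) * prof \<Lambda> T x)"
        using N by (simp add: mult_left_mono)
      \<comment> \<open>The amount gained is \<open>kap' * prof * r^2 / (4 T^2)\<close>, which is
        nonnegative.\<close>
      also have "\<dots> \<le> kap' (V x) * (prof \<Lambda> T x * ((cmod (zc x))\<^sup>2 / (4 * T\<^sup>2) - N))"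
        using kap'_bounds(1)[of "V x"] P by (simp add: algebra_simps)
      also have "\<dots> = kap' (V x) * (V11 x + V22 x)" unfolding lapV[OF True] N_def ..
      also have "\<dots> \<le> kap'' (V x) * (V1 x * V1 x + V2 x * V2 x) + kap' (V x) * (V11 x + V22 x)"
        using kap''_nonneg[of "V x"] by simp
      finally show ?thesis using True by (simp add: N_def algebra_simps)
    next
      case False
      then show ?thesis using mult_nonneg_nonneg[OF N b]
        by (simp only: N_def[symmetric] if_False mult_minus_left add_0_left neg_le_0_iff_le)
    qed
  qed
  show ?thesis by (intro exI conjI allI) (rule t0 t1 t2 lap)+
qed

end

subsection \<open>Sectors inside curved wedges\<close>

text \<open>Invariance of domain for the twisted polar map; \<open>a \<le> 1\<close> keeps the
  angles within one turn, which gives injectivity. Openness supplies the Borel measurability that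
  restriction to the wedge needs.\<close>

lemma open_curved_wedge:
  assumes "0 < a" "a \<le> 1" and c: "continuous_on {0<..} \<theta>"
  shows "open (curved_wedge \<theta> a)"
proof -
  define f where "f q = (fst q * cos (snd q + \<theta> (fst q)), fst q * sin (snd q + \<theta> (fst q)))" for q :: pt
  define D :: "pt set" where "D = {0<..} \<times> {0<..<2 * pi * a}"
  have "f ` D = curved_wedge \<theta> a"
    unfolding f_def D_def curved_wedge_def by (force simp: image_iff)
  moreover have "open D" unfolding D_def by (intro open_Times) auto
  moreover have "continuous_on D f"
  proof -
    have "continuous_on D (\<lambda>q. \<theta> (fst q))"
      by (rule continuous_on_compose2[OF c]) (auto simp: D_def intro!: continuous_intros)
    then show ?thesis unfolding f_def by (intro continuous_intros)
  qed
  moreover have "inj_on f D"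
  proof (rule inj_onI)
    fix q q' assume q: "q \<in> D" "q' \<in> D" and e: "f q = f q'"
    obtain r s r' s' where [simp]: "q = (r, s)" "q' = (r', s')" by (cases q, cases q')
    have b: "0 < r" "0 < r'" "0 < s" "s < 2 * pi * a" "0 < s'" "s' < 2 * pi * a" using q by (auto simp: D_def)
    have "r\<^sup>2 = (fst (f q))\<^sup>2 + (snd (f q))\<^sup>2" "r'\<^sup>2 = (fst (f q'))\<^sup>2 + (snd (f q'))\<^sup>2"
      by (simp_all add: f_def power_mult_distrib flip: distrib_left)
    then have "r\<^sup>2 = r'\<^sup>2" using e by simp
    then have r: "r = r'" using b by (simp add: power2_eq_iff)
    then have "cos (s + \<theta> r) = cos (s' + \<theta> r) \<and> sin (s + \<theta> r) = sin (s' + \<theta> r)"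
      using e b by (simp add: f_def)
    then obtain n where "s + \<theta> r = s' + \<theta> r + 2 * pi * of_int n" using sin_cos_eq_iff by metis
    then have n: "s - s' = 2 * pi * of_int n" by simp
    have "2 * pi * a \<le> 2 * pi * 1" using assms by (intro mult_left_mono) auto
    then have "\<bar>s - s'\<bar> < 2 * pi" using b by linarith
    then have "\<bar>of_int n\<bar> < (1::real)" unfolding n by (simp add: abs_mult)
    then have "n = 0" by linarith
    then show "q = q'" using n r by simp
  qed
  ultimately show ?thesis using invariance_of_domain by metis
qed

text \<open>Rotating by \<open>- \<eta>\<close> gives
  \<open>|w| sin (\<phi> - \<eta>) = - s sin \<eta>\<close> for the new argument
  \<open>\<phi>\<close>, so \<open>\<phi>\<close> has moved from \<open>\<eta>\<close> towards 0;
  the imaginary part is unchanged, so it has not crossed 0.\<close>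

lemma shifted_argument:
  fixes z :: complex
  assumes "0 < s" "\<bar>\<eta>\<bar> < pi" and z: "z = of_real r * cis \<eta>" "0 < r"
  shows "\<bar>Arg (z + of_real s)\<bar> \<le> \<bar>\<eta>\<bar>"
proof -
  define w where "w = z + of_real s"
  have im: "Im w = r * sin \<eta>" by (simp add: w_def z)
  show ?thesis
  proof (cases "\<eta> = 0")
    case True
    then have "w = of_real (r + s)" by (simp add: w_def z)
    moreover have "0 < r + s" using assms by simp
    ultimately have "Arg w = 0" by (simp only: Arg_of_real) simp
    then show ?thesis unfolding w_def by simp
  next
    case False
    have "sin \<eta> \<noteq> 0" using assms(2) False
      using sin_gt_zero[of \<eta>] sin_gt_zero[of "- \<eta>"] by (cases "0 < \<eta>") auto
    then have w0: "w \<noteq> 0" using im z(2) by auto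
    define \<phi> where "\<phi> = Arg w"
    have w: "w = of_real (cmod w) * cis \<phi>" using rcis_cmod_Arg[of w] by (simp add: rcis_def \<phi>_def)
    have "Im (w * cis (- \<eta>)) = - s * sin \<eta>"
      by (simp add: w_def z algebra_simps)
    moreover have "w * cis (- \<eta>) = of_real (cmod w) * cis (\<phi> - \<eta>)"
      by (subst w) (simp add: cis_mult)
    ultimately have sn: "cmod w * sin (\<phi> - \<eta>) = - s * sin \<eta>" by simp
    have cw: "0 < cmod w" using w0 by simp
    show ?thesis
    proof (cases "0 < \<eta>")
      case True
      then have sp: "0 < sin \<eta>" using assms(2) by (intro sin_gt_zero) auto
      then have "0 < \<phi>" "\<phi> < pi" using Arg_lt_pi[of w] im z(2) by (auto simp: \<phi>_def)
      moreover have "\<phi> < \<eta>"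
      proof (rule ccontr)
        assume "\<not> \<phi> < \<eta>"
        then have "0 \<le> sin (\<phi> - \<eta>)" using \<open>\<phi> < pi\<close> True by (intro sin_ge_zero) auto
        then have "0 \<le> cmod w * sin (\<phi> - \<eta>)" using cw by simp
        moreover have "- s * sin \<eta> < 0" using sp assms(1) by simp
        ultimately show False using sn by linarith
      qed
      ultimately show ?thesis by (simp add: \<phi>_def w_def)
    next
      case False
      then have neg: "\<eta> < 0" using \<open>\<eta> \<noteq> 0\<close> by simp
      then have sp: "sin \<eta> < 0" using assms(2) sin_gt_zero[of "- \<eta>"] by simp
      then have "Im w < 0" using im z(2) by (simp add: mult_pos_neg)
      then have "\<phi> < 0" using Arg_less_0[of w] by (simp add: \<phi>_def)
      moreover have "- pi < \<phi>" using Arg_bounded[of w] by (simp add: \<phi>_def)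
      moreover have "\<eta> < \<phi>"
      proof (rule ccontr)
        assume "\<not> \<eta> < \<phi>"
        then have "0 \<le> sin (\<eta> - \<phi>)" using \<open>- pi < \<phi>\<close> neg by (intro sin_ge_zero) auto
        moreover have "sin (\<phi> - \<eta>) = - sin (\<eta> - \<phi>)" by (metis minus_diff_eq sin_minus)
        ultimately have "cmod w * sin (\<phi> - \<eta>) \<le> 0" using cw by (simp add: mult_le_0_iff)
        moreover have "0 < - s * sin \<eta>" using sp assms(1) by (simp add: mult_pos_neg)
        ultimately show False using sn by linarith
      qed
      ultimately show ?thesis by (simp add: \<phi>_def w_def)
    qed
  qed
qed

text \<open>Law of cosines with \<open>cos \<eta> \<ge> - q\<close>, where
  \<open>q = max 0 (- cos b)\<close>, and \<open>2 r s \<le> r^2 + s^2\<close>: what remains is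
  \<open>(1 - q) (r^2 + s^2)\<close>.\<close>

lemma shifted_modulus:
  fixes z :: complex
  assumes "0 < s" "\<bar>\<eta>\<bar> \<le> b" "b < pi" and z: "z = of_real r * cis \<eta>" "0 < r"
  shows "(1 - max 0 (- cos b)) * s\<^sup>2 \<le> (cmod (z + of_real s))\<^sup>2"
proof -
  define q where "q = max 0 (- cos b)"
  have "cos b \<le> cos \<bar>\<eta>\<bar>" using assms by (intro cos_monotone_0_pi_le) auto
  moreover have "cos \<bar>\<eta>\<bar> = cos \<eta>" by (cases "\<eta> \<ge> 0") auto
  ultimately have c: "- q \<le> cos \<eta>" by (simp add: q_def)
  have q: "0 \<le> q" "q \<le> 1" using cos_ge_minus_one[of b] by (auto simp: q_def)
  have "(cmod (z + of_real s))\<^sup>2 = (r * cos \<eta> + s)\<^sup>2 + (r * sin \<eta>)\<^sup>2" by (simp add: z cmod_power2)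
  also have "\<dots> = r\<^sup>2 * ((sin \<eta>)\<^sup>2 + (cos \<eta>)\<^sup>2) + 2 * (r * s) * cos \<eta> + s\<^sup>2"
    unfolding power2_eq_square by (simp only: ring_distribs mult_2 mult_ac add_ac)
  also have "\<dots> = r\<^sup>2 + 2 * (r * s) * cos \<eta> + s\<^sup>2" by simp
  finally have e: "(cmod (z + of_real s))\<^sup>2 = r\<^sup>2 + 2 * (r * s) * cos \<eta> + s\<^sup>2" .
  have "2 * (r * s) * (- q) \<le> 2 * (r * s) * cos \<eta>" using c assms by (intro mult_left_mono) auto
  moreover have "q * (2 * (r * s)) \<le> q * (r\<^sup>2 + s\<^sup>2)"
    using q sum_squares_bound[of r s] by (intro mult_left_mono) (auto simp: mult_ac)
  moreover have "q * r\<^sup>2 \<le> 1 * r\<^sup>2" using q by (intro mult_right_mono) auto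
  ultimately have "(1 - q) * s\<^sup>2 \<le> (cmod (z + of_real s))\<^sup>2" unfolding e by (simp add: algebra_simps)
  then show ?thesis by (simp add: q_def)
qed

text \<open>The apex is moved to distance \<open>s\<close> along the axis: this misses the disc of radius \<open>R\<close> because the half
  opening angle of the sector is strictly smaller than \<open>\<pi>\<close>.\<close>

lemma sector_in_curved_wedge:
  assumes a: "0 < a" "a \<le> 1" and \<nu>: "1 / (2 * a) < \<nu>"
    and R: "0 < R" and \<theta>: "\<And>r. R \<le> r \<Longrightarrow> \<theta> r = \<theta> R"
  shows "\<exists>\<omega> p. planar_sector \<omega> \<nu> \<and> planar_sector.sector \<omega> p \<nu> \<subseteq> curved_wedge \<theta> a"
proof -
  \<comment> \<open>Direction of the axis of the outer part of the wedge: the middle angle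
    \<open>pi * a\<close> turned by the final value of \<open>\<theta>\<close>.\<close>
  define \<alpha> where "\<alpha> = pi * a + \<theta> R"
  define b where "b = pi / (2 * \<nu>)"
  have \<nu>1: "1 / 2 < \<nu>"
  proof -
    have "1 / 2 \<le> 1 / (2 * a)" using a by (simp add: field_simps)
    then show ?thesis using \<nu> by linarith
  qed
  have b: "0 < b" "b < pi * a" using \<nu> \<nu>1 a by (auto simp: b_def field_simps)
  have bpi: "b < pi" using b(2) mult_left_mono[OF a(2), of pi] pi_gt_zero by linarith
  define q where "q = max 0 (- cos b)"
  have q: "q < 1" using cos_monotone_0_pi[of b pi] b bpi by (simp add: q_def)
  \<comment> \<open>Chosen so that \<open>(1 - q) * s^2 = (R + 1)^2\<close>, which keeps the sector
    outside the disc of radius \<open>R\<close>; \<open>q < 1\<close> because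
    \<open>b < pi\<close>.\<close>
  define s where "s = (R + 1) / sqrt (1 - q)"
  have s: "0 < s" "(1 - q) * s\<^sup>2 = (R + 1)\<^sup>2" using q R by (auto simp: s_def power_divide)
  define \<omega> where "\<omega> = cis (- \<alpha>)"
  define p where "p = of_real s * cis \<alpha>"
  interpret planar_sector \<omega> p \<nu> by standard (use \<nu>1 in \<open>simp_all add: \<omega>_def\<close>)
  have "x \<in> curved_wedge \<theta> a" if x: "x \<in> sector" for x
  proof -
    define X where "X = Complex (fst x) (snd x)"
    define z where "z = zc x"
    define \<eta> where "\<eta> = Im (Ln z)"
    define w where "w = z + of_real s"
    have z0: "z \<noteq> 0" and \<eta>: "\<bar>\<eta>\<bar> < b" using x by (auto simp: sector_def z_def \<eta>_def b_def)
    have z: "z = of_real (cmod z) * cis \<eta>"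
      using rcis_cmod_Arg[of z] Arg_eq_Im_Ln[OF z0] by (simp add: rcis_def \<eta>_def)
    have r: "0 < cmod z" using z0 by simp
    have "\<omega> * p = of_real s" by (simp add: \<omega>_def p_def cis_mult)
    \<comment> \<open>Seen from the origin with the axis rotated to the positive reals, a point of
      the sector is \<open>z + s\<close>, to which the bounds on argument and modulus apply.\<close>
    then have w: "w = \<omega> * X" by (simp add: w_def z_def zc_def X_def algebra_simps)
    have "\<bar>Arg w\<bar> \<le> \<bar>\<eta>\<bar>" unfolding w_def by (rule shifted_argument[OF s(1) _ z r]) (use \<eta> bpi in simp)
    then have A: "\<bar>Arg w\<bar> < pi * a" using \<eta> b by linarith
    have "(1 - q) * s\<^sup>2 \<le> (cmod w)\<^sup>2"
      unfolding w_def q_def by (rule shifted_modulus[OF s(1) _ bpi z r]) (use \<eta> in simp)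
    then have "(R + 1)\<^sup>2 \<le> (cmod w)\<^sup>2" by (simp add: s)
    then have "R + 1 \<le> cmod w" by (rule power2_le_imp_le) simp
    then have Rw: "R \<le> cmod w" "0 < cmod w" using R by auto
    have "X = w * cis \<alpha>" by (simp add: w \<omega>_def cis_mult mult_ac)
    also have "\<dots> = of_real (cmod w) * cis (Arg w + \<alpha>)"
      using rcis_cmod_Arg[of w] by (metis rcis_def cis_mult mult.assoc)
    finally have X: "X = of_real (cmod w) * cis (Arg w + \<alpha>)" .
    have ang: "Arg w + pi * a + \<theta> (cmod w) = Arg w + \<alpha>" using \<theta>[OF Rw(1)] by (simp add: \<alpha>_def)
    have "fst x = cmod w * cos (Arg w + pi * a + \<theta> (cmod w))" "snd x = cmod w * sin (Arg w + pi * a + \<theta> (cmod w))"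
      unfolding ang using arg_cong[OF X, of Re] arg_cong[OF X, of Im] by (simp_all add: X_def)
    then have "x = (cmod w * cos (Arg w + pi * a + \<theta> (cmod w)), cmod w * sin (Arg w + pi * a + \<theta> (cmod w)))"
      by (simp add: prod_eq_iff)
    moreover have "0 < Arg w + pi * a" "Arg w + pi * a < 2 * pi * a" using A by (auto simp: abs_less_iff)
    ultimately show ?thesis unfolding curved_wedge_def using Rw(2) by blast
  qed
  then show ?thesis using planar_sector_axioms by blast
qed

subsection \<open>Lower bounds for the decay\<close>

text \<open>For \<open>r > T^(1/\<kappa>)\<close> one has \<open>T \<le> r^\<kappa>\<close>, so the
  expression is at most \<open>r^(2 \<kappa> + \<nu>) exp (- r^(2 - \<kappa>) / 4)\<close>, which
  tends to 0 since \<open>\<kappa> < 2\<close>.\<close>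

lemma gaussian_tail:
  fixes \<nu> \<kappa> :: real
  assumes "0 < \<nu>" "0 < \<kappa>" "\<kappa> < 2"
  shows "\<exists>T1\<ge>1. \<forall>T\<ge>T1. \<forall>r>T powr (1 / \<kappa>). T\<^sup>2 * r powr \<nu> * exp (- r\<^sup>2 / (4 * T)) < 1"
proof -
  have "((\<lambda>r::real. r powr (2 * \<kappa> + \<nu>) * exp (- (r powr (2 - \<kappa>)) / 4)) \<longlongrightarrow> 0) at_top"
    using assms by real_asymp
  then have "\<forall>\<^sub>F r in at_top. r powr (2 * \<kappa> + \<nu>) * exp (- (r powr (2 - \<kappa>)) / 4) < (1::real)"
    by (rule order_tendstoD(2)) simp
  then obtain r0 where r0: "\<And>r. r0 \<le> r \<Longrightarrow> r powr (2 * \<kappa> + \<nu>) * exp (- (r powr (2 - \<kappa>)) / 4) < (1::real)"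
    unfolding eventually_at_top_linorder by blast
  \<comment> \<open>Makes \<open>T \<ge> T1\<close> force
    \<open>T^(1/\<kappa>) \<ge> max r0 1\<close>, so that every admissible \<open>r\<close> is
    beyond both \<open>r0\<close> and 1.\<close>
  define T1 where "T1 = (max r0 1) powr \<kappa>"
  have T1: "1 \<le> T1" using assms by (simp add: T1_def ge_one_powr_ge_zero)
  have "T\<^sup>2 * r powr \<nu> * exp (- r\<^sup>2 / (4 * T)) < 1" if T: "T1 \<le> T" and r: "T powr (1 / \<kappa>) < r" for T r
  proof -
    have T0: "0 < T" using T T1 by linarith
    have "max r0 1 = T1 powr (1 / \<kappa>)" using assms by (simp add: T1_def powr_powr)
    also have "\<dots> \<le> T powr (1 / \<kappa>)" using T T1 assms by (intro powr_mono2) auto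
    finally have rr: "r0 \<le> r" "1 \<le> r" using r by auto
    have "T = (T powr (1 / \<kappa>)) powr \<kappa>" using T0 assms by (simp add: powr_powr)
    also have "\<dots> \<le> r powr \<kappa>" using r assms by (intro powr_mono2) auto
    finally have Tr: "T \<le> r powr \<kappa>" .
    have "T\<^sup>2 \<le> (r powr \<kappa>)\<^sup>2" using Tr T0 by (intro power_mono) auto
    also have "\<dots> = r powr (2 * \<kappa>)" using rr by (simp add: power2_eq_square powr_add[symmetric])
    finally have T2: "T\<^sup>2 \<le> r powr (2 * \<kappa>)" .
    have "r powr (2 - \<kappa>) * T \<le> r powr (2 - \<kappa>) * r powr \<kappa>" using Tr by (intro mult_left_mono) auto
    also have "\<dots> = r\<^sup>2" using rr by (simp add: powr_add[symmetric])
    finally have "r powr (2 - \<kappa>) / 4 \<le> r\<^sup>2 / (4 * T)" using T0 by (simp add: field_simps)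
    then have e: "exp (- r\<^sup>2 / (4 * T)) \<le> exp (- (r powr (2 - \<kappa>)) / 4)" by simp
    have "T\<^sup>2 * r powr \<nu> * exp (- r\<^sup>2 / (4 * T)) \<le> r powr (2 * \<kappa>) * r powr \<nu> * exp (- (r powr (2 - \<kappa>)) / 4)"
      using T2 e by (intro mult_mono) auto
    also have "\<dots> < 1" using r0[OF rr(1)] by (simp add: powr_add)
    finally show ?thesis .
  qed
  then show ?thesis using T1 by blast
qed

section \<open>Pairing the flow with the subsolution\<close>

context planar_sector
begin

text \<open>Comparison with the circumscribed square of side \<open>2 * \<rho>\<close>; only the
  order in \<open>\<rho>\<close> affects the exponent.\<close>

lemma disc_indicator:
  assumes "0 < \<rho>"
  shows "sqint (indicator {x. cmod (zc x) \<le> \<rho>})" "norm (cls (indicator {x. cmod (zc x) \<le> \<rho>})) \<le> 2 * \<rho>"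
proof -
  define D where "D = {x. cmod (zc x) \<le> \<rho>}"
  define Q where "Q = cbox (Re p - \<rho>, Im p - \<rho>) (Re p + \<rho>, Im p + \<rho>)"
  have DQ: "D \<subseteq> Q"
  proof
    fix x assume "x \<in> D"
    then have "(cmod (zc x))\<^sup>2 \<le> \<rho>\<^sup>2" unfolding D_def by (intro power_mono) auto
    then have "(fst x - Re p)\<^sup>2 \<le> \<rho>\<^sup>2" "(snd x - Im p)\<^sup>2 \<le> \<rho>\<^sup>2"
      unfolding cmod_zc using zero_le_power2[of "fst x - Re p"] zero_le_power2[of "snd x - Im p"] by linarith+
    then have "\<bar>fst x - Re p\<bar> \<le> \<rho>" "\<bar>snd x - Im p\<bar> \<le> \<rho>"
      using assms by (simp_all add: power2_le_iff_abs_le)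
    then show "x \<in> Q" unfolding Q_def cbox_Pair_eq by (cases x) (auto simp: abs_le_iff)
  qed
  have Ds: "D \<in> sets borel"
  proof -
    have "closed D" unfolding D_def by (intro closed_Collect_le continuous_intros continuous_on_zc)
    then show ?thesis by simp
  qed
  have sq: "(\<lambda>x. (indicator A x)\<^sup>2 :: real) = indicator A" for A :: "pt set" by (auto simp: indicator_def)
  have sQ: "sqint (indicator Q)" unfolding sqint_def sq Q_def
    by (auto intro!: integrable_real_indicator simp: emeasure_lborel_cbox_eq)
  have "integrable lborel (indicator D :: pt \<Rightarrow> real)"
  proof (rule Bochner_Integration.integrable_bound)
    show "integrable lborel (indicator Q :: pt \<Rightarrow> real)" using sQ by (simp add: sqint_def sq)
    show "AE x in lborel. norm (indicator D x :: real) \<le> norm (indicator Q x :: real)"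
      using DQ by (intro AE_I2) (auto simp: indicator_def)
  qed (use Ds in measurable)
  then have sD: "sqint (indicator D)" unfolding sqint_def sq using Ds by auto
  have "norm (cls (indicator D)) \<le> 1 * norm (cls (indicator Q))"
    by (rule norm_cls_mono[OF sD sQ]) (use DQ in \<open>auto simp: indicator_def\<close>)
  moreover have "(norm (cls (indicator Q)))\<^sup>2 = (2 * \<rho>)\<^sup>2"
    unfolding norm_cls[OF sQ] sq using assms by (simp add: Q_def content_Pair power2_eq_square)
  then have "norm (cls (indicator Q)) = 2 * \<rho>" using assms by (intro power2_eq_imp_eq[of _ "2 * \<rho>"]) auto
  ultimately show "sqint (indicator {x. cmod (zc x) \<le> \<rho>})" "norm (cls (indicator {x. cmod (zc x) \<le> \<rho>})) \<le> 2 * \<rho>"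
    using sD by (simp_all add: D_def)
qed

text \<open>Here positivity of the flow enters: it lets the pointwise lower bound on the Laplacian
  of the bump be integrated against the flow.\<close>

lemma inner_cls_mono:
  assumes "AE x in lborel. 0 \<le> rep u x" "sqint f" "sqint g" "\<And>x. f x \<le> g x"
  shows "inner u (cls f) \<le> inner u (cls g)"
proof -
  have "inner u (cls h) = (\<integral>x. rep u x * h x \<partial>lborel)" if "sqint h" for h
    using inner_cls[OF sqint_rep that, of u] by simp
  moreover have "(\<integral>x. rep u x * f x \<partial>lborel) \<le> (\<integral>x. rep u x * g x \<partial>lborel)"
  proof (rule integral_mono_AE)
    show "AE x in lborel. rep u x * f x \<le> rep u x * g x"
      using assms(1) by eventually_elim (use assms(4) in \<open>auto intro: mult_left_mono\<close>)
  qed (intro sqint_mult sqint_rep assms)+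
  ultimately show ?thesis using assms by simp
qed

text \<open>Cauchy-Schwarz over \<open>\<Omega>\<close> alone, where the support of \<open>f\<close>
  lies; the resulting factor is the quantity that \<open>heat_opnorm\<close> dominates.\<close>

lemma inner_restr:
  assumes \<Omega>: "\<Omega> \<in> sets borel" and f: "test_fn \<Omega> f f1 f2"
  shows "inner u (cls f) \<le> sqrt (enn2real (norm2 \<Omega> (rep u))) * norm (cls f)"
proof -
  note s = sqint_restr[OF \<Omega> sqint_in_L2[OF sqint_rep[of u]]]
  note sf = test_fn_sqint(1)[OF f]
  have "(\<lambda>x. rep u x * f x) = (\<lambda>x. restr \<Omega> (rep u) x * f x)"
  proof
    fix x
    have "f x = restr \<Omega> f x" using restr_test_fn[OF f] by simp
    then show "rep u x * f x = restr \<Omega> (rep u) x * f x" by (auto simp: restr_def indicator_def)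
  qed
  then have "inner u (cls f) = inner (cls (restr \<Omega> (rep u))) (cls f)"
    using inner_cls[OF sqint_rep sf, of u] inner_cls[OF s sf] by simp
  also have "\<dots> \<le> norm (cls (restr \<Omega> (rep u))) * norm (cls f)" by (rule norm_cauchy_schwarz)
  also have "norm (cls (restr \<Omega> (rep u))) = sqrt (enn2real (norm2 \<Omega> (rep u)))"
    unfolding norm2_eq_restr nn_norm_cls[OF s] by simp
  finally show ?thesis .
qed

text \<open>Gronwall for \<open>g t = inner (U t) (cls B)\<close>: the subsolution property gives
  \<open>g' \<ge> - N (g + E)\<close> with \<open>N * T = 1 + \<nu>\<close>, so the loss factor does
  not depend on \<open>T\<close>. The right side is Cauchy-Schwarz with
  \<open>norm (cls B) \<le> \<Lambda> \<rho>^\<nu> * 2 \<rho>\<close>.\<close>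

theorem heat_lower_bound:
  assumes \<Omega>: "\<Omega> \<in> sets borel" "sector \<subseteq> \<Omega>" and f: "test_fn \<Omega> f f1 f2"
    and U0: "U 0 = cls f" and Ule: "\<And>t. 0 \<le> t \<Longrightarrow> norm (U t) \<le> norm (cls f)"
    and Upos: "\<And>t. 0 \<le> t \<Longrightarrow> AE x in lborel. 0 \<le> rep (U t) x"
    and dU: "\<And>q q1 q2 q11 q12 q21 q22 t. test_fn \<Omega> q q1 q2 \<Longrightarrow> test_fn \<Omega> q1 q11 q12 \<Longrightarrow> test_fn \<Omega> q2 q21 q22 \<Longrightarrow> 0 \<le> t \<Longrightarrow>
      ((\<lambda>t. inner (U t) (cls q)) has_real_derivative inner (U t) (cls (\<lambda>x. q11 x + q22 x))) (at t within {0..})"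
    and L: "0 < \<Lambda>" and T: "0 < T" and \<rho>: "0 < \<rho>" and tail: "\<And>r. \<rho> < r \<Longrightarrow> \<Lambda> * r powr \<nu> * exp (- r\<^sup>2 / (4 * T)) < 1"
  shows "exp (- (1 + \<nu>)) * (\<integral>x. f x * bump \<Lambda> T x \<partial>lborel) - 4 * \<rho> * norm (cls f)
    \<le> sqrt (enn2real (norm2 \<Omega> (rep (U T)))) * (2 * \<Lambda> * \<rho> powr (1 + \<nu>))"
proof -
  define D where "D = {x. cmod (zc x) \<le> \<rho>}"
  define N where "N = (1 + \<nu>) / T"
  \<comment> \<open>Twice the product of the bounds \<open>norm (cls f)\<close> for the flow and
    \<open>2 * \<rho>\<close> for the indicator of the disc.\<close>
  define E where "E = 4 * \<rho> * norm (cls f)"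
  define B where "B = bump \<Lambda> T"
  have ex: "\<exists>b1 b2 b11 b12 b21 b22. test_fn \<Omega> B b1 b2 \<and> test_fn \<Omega> b1 b11 b12 \<and> test_fn \<Omega> b2 b21 b22 \<and>
    (\<forall>x. - N * (B x + 2 * indicator D x) \<le> b11 x + b22 x)"
    unfolding B_def N_def D_def by (rule bump_subsolution[OF L T tail \<Omega>(2)])
  obtain b1 b2 b11 b12 b21 b22 where b: "test_fn \<Omega> B b1 b2" "test_fn \<Omega> b1 b11 b12" "test_fn \<Omega> b2 b21 b22"
    and lap: "\<And>x. - N * (B x + 2 * indicator D x) \<le> b11 x + b22 x"
    using ex by blast
  note sD = disc_indicator[OF \<rho>, folded D_def]
  note sB = test_fn_sqint(1)[OF b(1)]
  have N: "0 < N" using T \<nu> by (simp add: N_def)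
  define g where "g t = inner (U t) (cls B)" for t
  define g' where "g' t = inner (U t) (cls (\<lambda>x. b11 x + b22 x))" for t
  have dg: "(g has_real_derivative g' t) (at t within {0..})" if "0 \<le> t" for t
    unfolding g_def g'_def by (rule dU[OF b that])
  have lower: "- N * (g t + E) \<le> g' t" if t: "0 \<le> t" for t
  proof -
    have s1: "sqint (\<lambda>x. B x + 2 * indicator D x)" by (intro sqint_add sqint_scale sB sD)
    have s2: "sqint (\<lambda>x. b11 x + b22 x)" by (intro sqint_add test_fn_sqint(2)[OF b(2)] test_fn_sqint(3)[OF b(3)])
    have "inner (U t) (cls (\<lambda>x. - N * (B x + 2 * indicator D x))) \<le> g' t"
      unfolding g'_def by (rule inner_cls_mono[OF Upos[OF t] sqint_scale[OF s1] s2 lap])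
    moreover have "cls (\<lambda>x. - N * (B x + 2 * indicator D x)) = (- N) *\<^sub>R (cls B + 2 *\<^sub>R cls (indicator D))"
      by (simp only: cls_scale[OF sD(1)] cls_add[OF sB sqint_scale[OF sD(1)]] cls_scale[OF s1])
    ultimately have "- N * (g t + 2 * inner (U t) (cls (indicator D))) \<le> g' t"
      by (simp only: g_def inner_scaleR_right inner_add_right)
    moreover have "inner (U t) (cls (indicator D)) \<le> norm (cls f) * (2 * \<rho>)"
      using norm_cauchy_schwarz[of "U t" "cls (indicator D)"] mult_mono[OF Ule[OF t] sD(2)] by simp
    then have "- N * (g t + E) \<le> - N * (g t + 2 * inner (U t) (cls (indicator D)))"
      using N by (intro mult_left_mono_neg) (simp_all add: E_def mult_ac)
    ultimately show ?thesis by linarith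
  qed
  \<comment> \<open>Monotonicity of \<open>g + E\<close> multiplied by the integrating factor
    \<open>exp (N t)\<close>.\<close>
  have "exp (N * 0) * (g 0 + E) \<le> exp (N * T) * (g T + E)"
  proof (rule DERIV_nonneg_imp_increasing_open[of 0 T "\<lambda>t. exp (N * t) * (g t + E)"])
    show "0 \<le> T" using T by simp
    fix t assume t: "0 < t" "t < T"
    have "at t within {0..} = at t" by (rule at_within_interior) (use t in simp)
    then have dt: "(g has_real_derivative g' t) (at t)" using dg[of t] t by simp
    have "((\<lambda>t. exp (N * t) * (g t + E)) has_real_derivative exp (N * t) * (N * (g t + E) + g' t)) (at t)"
      by (auto intro!: derivative_eq_intros dt simp: algebra_simps)
    moreover have "0 \<le> exp (N * t) * (N * (g t + E) + g' t)"
      using lower[of t] t by (intro mult_nonneg_nonneg) auto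
    ultimately show "\<exists>y. ((\<lambda>t. exp (N * t) * (g t + E)) has_real_derivative y) (at t) \<and> 0 \<le> y" by blast
  next
    have "continuous_on {0..} g" by (rule DERIV_continuous_on[OF dg]) simp
    then have "continuous_on {0..T} g" by (rule continuous_on_subset) auto
    then show "continuous_on {0..T} (\<lambda>t. exp (N * t) * (g t + E))" by (intro continuous_intros)
  qed
  then have "g 0 + E \<le> exp (1 + \<nu>) * (g T + E)" using T by (simp add: N_def)
  then have "exp (- (1 + \<nu>)) * (g 0 + E) \<le> exp (- (1 + \<nu>)) * (exp (1 + \<nu>) * (g T + E))" by (intro mult_left_mono) auto
  also have "\<dots> = g T + E" by (simp add: mult.assoc[symmetric] exp_add[symmetric])
  finally have 1: "exp (- (1 + \<nu>)) * g 0 - E \<le> g T + exp (- (1 + \<nu>)) * (- E)" by (simp add: algebra_simps)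
  \<comment> \<open>The initial copy of \<open>E\<close> has a favourable sign and is dropped; the
    copy at time \<open>T\<close> is the error in the conclusion.\<close>
  have "exp (- (1 + \<nu>)) * (- E) \<le> 0" using \<rho> by (simp add: E_def mult_nonneg_nonneg)
  with 1 have 2: "exp (- (1 + \<nu>)) * g 0 - E \<le> g T" by linarith
  have "norm (cls B) \<le> (\<Lambda> * \<rho> powr \<nu>) * norm (cls (indicator D))"
  proof (rule norm_cls_mono[OF sB sD(1)])
    show "\<bar>B x\<bar> \<le> \<Lambda> * \<rho> powr \<nu> * \<bar>indicator D x\<bar>" for x
      using bump_le[where x = x, OF L T tail] bump_nonneg[of \<Lambda> T x] by (simp add: B_def D_def)
  qed (use L in simp)
  also have "\<dots> \<le> (\<Lambda> * \<rho> powr \<nu>) * (2 * \<rho>)" using sD(2) L by (intro mult_left_mono) auto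
  also have "\<dots> = 2 * \<Lambda> * \<rho> powr (1 + \<nu>)" using \<rho> by (simp add: powr_add)
  finally have nB: "norm (cls B) \<le> 2 * \<Lambda> * \<rho> powr (1 + \<nu>)" .
  have "g T \<le> sqrt (enn2real (norm2 \<Omega> (rep (U T)))) * norm (cls B)"
    unfolding g_def by (rule inner_restr[OF \<Omega>(1) b(1)])
  also have "\<dots> \<le> sqrt (enn2real (norm2 \<Omega> (rep (U T)))) * (2 * \<Lambda> * \<rho> powr (1 + \<nu>))"
    by (rule mult_left_mono[OF nB]) simp
  finally have "g T \<le> sqrt (enn2real (norm2 \<Omega> (rep (U T)))) * (2 * \<Lambda> * \<rho> powr (1 + \<nu>))" .
  moreover have "g 0 = (\<integral>x. f x * bump \<Lambda> T x \<partial>lborel)"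
    unfolding g_def U0 inner_cls[OF test_fn_sqint(1)[OF f] sB] by (simp add: B_def)
  ultimately show ?thesis using 2 by (simp add: E_def)
qed

end

section \<open>Normalised initial data\<close>

lemma heat_opnorm_ge:
  assumes "in_L2w \<Omega> u0" "wnorm2 \<Omega> gauss_w u0 \<le> 1" "heat_orbit \<Omega> u0 u"
  shows "ereal (sqrt (enn2real (norm2 \<Omega> (u t)))) \<le> heat_opnorm \<Omega> t"
  unfolding heat_opnorm_def by (rule SUP_upper2[of "(u0, u)"]) (use assms in auto)

text \<open>The weight is continuous and the support compact, so the weighted norm is finite. The 1
  added under the root in \<open>c\<close> avoids a division by 0.\<close>

lemma test_fn_gauss_normalise:
  assumes f: "test_fn \<Omega> f f1 f2" and \<Omega>: "\<Omega> \<in> sets borel"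
  shows "\<exists>c>0. in_L2w \<Omega> (\<lambda>x. c * f x) \<and> wnorm2 \<Omega> gauss_w (\<lambda>x. c * f x) \<le> 1"
proof -
  have cf: "continuous_on UNIV f" by (rule smooth_on_UNIV_continuous[OF test_fnD(1)[OF f]])
  have i: "integrable lborel (\<lambda>x. gauss_w x * (f x)\<^sup>2)"
  proof (rule compact_support_integrable[OF _ test_fnD(3)[OF f]])
    show "continuous_on UNIV (\<lambda>x. gauss_w x * (f x)\<^sup>2)"
      unfolding gauss_w_def by (intro continuous_intros cf) auto
    show "gauss_w x * (f x)\<^sup>2 = 0" if "x \<notin> closure {x. f x \<noteq> 0}" for x
      using test_fnD(5)[OF f that] by simp
  qed
  define w where "w = (\<integral>x. gauss_w x * (f x)\<^sup>2 \<partial>lborel)"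
  have g0: "0 \<le> gauss_w x" for x by (simp add: gauss_w_def)
  have w0: "0 \<le> w" unfolding w_def by (rule integral_nonneg_AE) (simp add: g0)
  define c where "c = 1 / sqrt (1 + w)"
  have c: "0 < c" "c\<^sup>2 * w \<le> 1" using w0 by (auto simp: c_def power_divide)
  have "wnorm2 \<Omega> gauss_w (\<lambda>x. c * f x) \<le> (\<integral>\<^sup>+x. ennreal (c\<^sup>2 * (gauss_w x * (f x)\<^sup>2)) \<partial>lborel)"
    unfolding wnorm2_def by (rule nn_integral_mono) (auto simp: indicator_def power_mult_distrib mult_ac)
  also have "\<dots> = ennreal (\<integral>x. c\<^sup>2 * (gauss_w x * (f x)\<^sup>2) \<partial>lborel)"
    by (rule nn_integral_eq_integral) (use i g0 in auto)
  also have "\<dots> = ennreal (c\<^sup>2 * w)" by (simp add: w_def)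
  also have "\<dots> \<le> 1" using c(2) ennreal_leI[of "c\<^sup>2 * w" 1] by simp
  finally have le: "wnorm2 \<Omega> gauss_w (\<lambda>x. c * f x) \<le> 1" .
  have m: "(\<lambda>x. c * f x) \<in> borel_measurable lborel" using test_fn_sqint(1)[OF f] by (auto simp: sqint_def)
  have "wnorm2 \<Omega> gauss_w (\<lambda>x. c * f x) < \<infinity>" by (rule le_less_trans[OF le]) simp
  then show ?thesis using c le m unfolding in_L2w_def by blast
qed

lemma test_fn_integral_pos:
  assumes f: "test_fn \<Omega> f f1 f2" and "\<And>x. 0 \<le> f x" "0 < f x0"
  shows "0 < (\<integral>x. f x \<partial>lborel)"
proof -
  have cf: "continuous_on UNIV f" by (rule smooth_on_UNIV_continuous[OF test_fnD(1)[OF f]])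
  have "open {x. 0 < f x}" by (rule open_Collect_less[OF continuous_on_const cf])
  then have nn: "\<not> negligible {x. 0 < f x}" by (rule open_not_negligible) (use assms(3) in blast)
  have "(\<integral>x. f x \<partial>lborel) \<noteq> 0"
  proof
    assume "(\<integral>x. f x \<partial>lborel) = 0"
    then have "AE x in lborel. f x = 0"
      using integral_nonneg_eq_0_iff_AE[OF test_fn_integrable(1)[OF f]] assms(2) by simp
    then have "AE x in lborel. \<not> 0 < f x" by eventually_elim simp
    then have "{x. 0 < f x} \<in> null_sets lborel"
      using AE_iff_null_sets[of "{x. 0 < f x}" lborel] \<open>open {x. 0 < f x}\<close> by simp
    then have "{x. 0 < f x} \<in> null_sets lebesgue" by (rule null_sets_completionI)
    then show False using nn by (simp add: negligible_iff_null_sets)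
  qed
  moreover have "0 \<le> (\<integral>x. f x \<partial>lborel)" by (rule integral_nonneg_AE) (simp add: assms(2))
  ultimately show ?thesis by linarith
qed

context planar_sector
begin

text \<open>The point on the axis at distance 1 from the apex; it will show that the datum is not
  identically 0.\<close>

lemma prof_one_point: "\<exists>x\<in>sector. prof \<Lambda> T x = \<Lambda> * exp (- 1 / (4 * T))"
proof -
  define x where "x = (Re (cnj \<omega> * 1 + p), Im (cnj \<omega> * 1 + p))"
  have z: "zc x = 1" unfolding x_def by (rule zc_inverse)
  have "x \<in> sector" using \<nu> by (simp add: sector_def z)
  then show ?thesis using prof_eq[of x \<Lambda> T] by (intro bexI[of _ x]) (simp_all add: z)
qed

text \<open>Where the earlier bump is nonzero its profile exceeds 1. The Gaussian increases with the
  time parameter, so the later profile exceeds \<open>\<Lambda> / \<Lambda>0\<close>, and passing to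
  \<open>kap (prof - 1)\<close> costs at most 2. Hence the pairing with a fixed datum grows like
  \<open>\<Lambda>\<close>.\<close>

lemma bump_ge_on_support:
  assumes "0 < \<Lambda>0" "0 < T0" "T0 \<le> T" "0 < \<Lambda>" "bump \<Lambda>0 T0 x \<noteq> 0"
  shows "\<Lambda> / \<Lambda>0 - 2 \<le> bump \<Lambda> T x"
proof -
  have x: "x \<in> sector" using assms(5) by (auto simp: bump_def split: if_splits)
  have p1: "1 < prof \<Lambda>0 T0 x" using assms(5) kap_nonpos(1)[of "prof \<Lambda>0 T0 x - 1"] x by (force simp: bump_def)
  have h: "0 < pw 1 \<nu> x" using prof_pos[OF x, of 1 T0] by (simp add: prof_def gau_def zero_less_mult_iff)
  have "((fst x - Re p)\<^sup>2 + (snd x - Im p)\<^sup>2) / (4 * T) \<le> ((fst x - Re p)\<^sup>2 + (snd x - Im p)\<^sup>2) / (4 * T0)"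
    using assms by (intro divide_left_mono) auto
  then have "gau T0 x \<le> gau T x"
    unfolding gau_def minus_divide_left[symmetric] exp_le_cancel_iff neg_le_iff_le .
  then have "pw 1 \<nu> x * gau T0 x \<le> pw 1 \<nu> x * gau T x" using h by (intro mult_left_mono) auto
  then have "\<Lambda> / \<Lambda>0 * prof \<Lambda>0 T0 x \<le> prof \<Lambda> T x" using assms by (simp add: prof_def)
  moreover have "\<Lambda> / \<Lambda>0 * 1 \<le> \<Lambda> / \<Lambda>0 * prof \<Lambda>0 T0 x" using p1 assms by (intro mult_left_mono) auto
  moreover have "prof \<Lambda> T x - 2 \<le> bump \<Lambda> T x" using kap_ge[of "prof \<Lambda> T x - 1"] x by (simp add: bump_def)
  ultimately show ?thesis by linarith
qed

text \<open>Divided by \<open>\<Lambda> = T^2\<close>, the lower bound sets the positive limit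
  \<open>e m / T0^2\<close> against a multiple of
  \<open>T^((1 + \<nu>) / \<kappa> - \<gamma>)\<close>, while the error \<open>\<rho> / T^2\<close>
  vanishes because \<open>1 / \<kappa> < 2\<close>. A larger \<open>\<gamma>\<close> would send the
  upper side to 0.\<close>

lemma decay_rate_le:
  assumes \<Omega>: "\<Omega> \<in> sets borel" "sector \<subseteq> \<Omega>" and \<kappa>: "1 < \<kappa>" "\<kappa> < 2"
    and C: "\<And>t. 0 \<le> t \<Longrightarrow> heat_opnorm \<Omega> t \<le> ereal (C * (1 + t) powr (- \<gamma>))" "0 < C" "0 < \<gamma>"
  shows "\<gamma> \<le> (1 + \<nu>) / \<kappa>"
proof (rule ccontr)
  assume "\<not> \<gamma> \<le> (1 + \<nu>) / \<kappa>"
  then have gt: "(1 + \<nu>) / \<kappa> < \<gamma>" by simp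
  have \<nu>0: "0 < \<nu>" using \<nu> by simp
  obtain T1 where T1: "1 \<le> T1"
    and tail: "\<And>T r. T1 \<le> T \<Longrightarrow> T powr (1 / \<kappa>) < r \<Longrightarrow> T\<^sup>2 * r powr \<nu> * exp (- r\<^sup>2 / (4 * T)) < 1"
    using gaussian_tail[of \<nu> \<kappa>] \<nu>0 \<kappa> by auto
  \<comment> \<open>The lower bound 2 ensures
    \<open>T0^2 exp (- 1 / (4 T0)) \<ge> 4 * (7 / 8) > 1\<close>, so the datum is positive at
    \<open>x0\<close>.\<close>
  define T0 where "T0 = max T1 2"
  have T0: "T1 \<le> T0" "2 \<le> T0" by (auto simp: T0_def)
  then have T0s: "4 \<le> T0\<^sup>2" using power_mono[of 2 T0 2] by simp
  \<comment> \<open>The datum is itself a bump, so on its support all later bumps are bounded below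
    by \<open>bump_ge_on_support\<close>.\<close>
  define f0 where "f0 = bump (T0\<^sup>2) T0"
  obtain b1 b2 where t0: "test_fn \<Omega> f0 b1 b2"
    using bump_subsolution[of "T0\<^sup>2" T0 "T0 powr (1 / \<kappa>)" \<Omega>, OF _ _ tail[OF T0(1)] \<Omega>(2)] T0 unfolding f0_def by auto
  obtain c where c: "0 < c" "in_L2w \<Omega> (\<lambda>x. c * f0 x)" "wnorm2 \<Omega> gauss_w (\<lambda>x. c * f0 x) \<le> 1"
    using test_fn_gauss_normalise[OF t0 \<Omega>(1)] by blast
  define f where "f x = c * f0 x" for x
  have tf: "test_fn \<Omega> f (\<lambda>x. c * b1 x) (\<lambda>x. c * b2 x)"
    using test_fn_lincomb[OF t0 t0, of c 0] by (simp add: f_def[abs_def])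
  have fpos: "0 \<le> f x" for x using c(1) bump_nonneg[of "T0\<^sup>2" T0 x] by (simp add: f_def f0_def)
  obtain x0 where x0: "x0 \<in> sector" "prof (T0\<^sup>2) T0 x0 = T0\<^sup>2 * exp (- 1 / (4 * T0))"
    using prof_one_point by blast
  have "7 / 8 \<le> 1 + (- 1 / (4 * T0))" using T0 by (simp add: field_simps)
  also have "\<dots> \<le> exp (- 1 / (4 * T0))" by (rule exp_ge_add_one_self)
  finally have "4 * (7 / 8) \<le> T0\<^sup>2 * exp (- 1 / (4 * T0))" using T0s by (intro mult_mono) auto
  then have "1 < prof (T0\<^sup>2) T0 x0" by (simp add: x0(2))
  then have "0 < f x0" using c(1) x0(1) by (simp add: f_def f0_def bump_def kap_pos)
  define m where "m = (\<integral>x. f x \<partial>lborel)"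
  have m: "0 < m" unfolding m_def by (rule test_fn_integral_pos[OF tf fpos \<open>0 < f x0\<close>])
  obtain U where U: "U 0 = cls f"
    "heat_orbit \<Omega> f (\<lambda>t. if t = 0 then f else rep (U t))"
    "\<And>t. 0 \<le> t \<Longrightarrow> norm (U t) \<le> norm (cls f)"
    "\<And>t. 0 \<le> t \<Longrightarrow> AE x in lborel. 0 \<le> rep (U t) x"
    "\<And>q q1 q2 q11 q12 q21 q22 t. test_fn \<Omega> q q1 q2 \<Longrightarrow> test_fn \<Omega> q1 q11 q12 \<Longrightarrow> test_fn \<Omega> q2 q21 q22 \<Longrightarrow> 0 \<le> t \<Longrightarrow>
      ((\<lambda>t. inner (U t) (cls q)) has_real_derivative inner (U t) (cls (\<lambda>x. q11 x + q22 x))) (at t within {0..})"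
    by (rule heat_flow_exists[OF \<Omega>(1) tf fpos]) blast
  define e where "e = exp (- (1 + \<nu>))"
  define n where "n = norm (cls f)"
  \<comment> \<open>Lower bound and assumed decay combined and divided by \<open>T^2\<close>,
    arranged as one expression whose limit for large \<open>T\<close> would be negative.\<close>
  have main: "0 \<le> 2 * C * T powr ((1 + \<nu>) / \<kappa> - \<gamma>) - e * m * (1 / T0\<^sup>2 - 2 / T\<^sup>2) + 4 * n * T powr (1 / \<kappa> - 2)"
    if T: "T0 \<le> T" for T
  proof -
    have Tp: "0 < T" "T1 \<le> T" using T T0 by auto
    define \<rho> where "\<rho> = T powr (1 / \<kappa>)"
    have \<rho>: "0 < \<rho>" using Tp by (simp add: \<rho>_def)
    define s where "s = sqrt (enn2real (norm2 \<Omega> (rep (U T))))"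
    have "ereal s \<le> heat_opnorm \<Omega> T"
      using heat_opnorm_ge[OF c(2,3)[folded f_def] U(2), of T] Tp by (simp add: s_def)
    also have "\<dots> \<le> ereal (C * (1 + T) powr (- \<gamma>))" using C(1)[of T] Tp by simp
    finally have "s \<le> C * (1 + T) powr (- \<gamma>)" by simp
    also have "\<dots> \<le> C * T powr (- \<gamma>)" using C Tp by (intro mult_left_mono powr_mono2') auto
    finally have s: "s \<le> C * T powr (- \<gamma>)" .
    have tb: "\<exists>b1 b2. test_fn \<Omega> (bump (T\<^sup>2) T) b1 b2"
      using bump_subsolution[of "T\<^sup>2" T \<rho> \<Omega>, OF _ _ tail[OF Tp(2)] \<Omega>(2)] Tp unfolding \<rho>_def by auto
    have "(T\<^sup>2 / T0\<^sup>2 - 2) * m = (\<integral>x. (T\<^sup>2 / T0\<^sup>2 - 2) * f x \<partial>lborel)" by (simp add: m_def)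
    also have "\<dots> \<le> (\<integral>x. f x * bump (T\<^sup>2) T x \<partial>lborel)"
    proof (rule integral_mono)
      show "integrable lborel (\<lambda>x. (T\<^sup>2 / T0\<^sup>2 - 2) * f x)" using test_fn_integrable(1)[OF tf] by simp
      show "integrable lborel (\<lambda>x. f x * bump (T\<^sup>2) T x)"
        using tb test_fn_sqint(1) test_fn_sqint(1)[OF tf] by (blast intro: sqint_mult)
      show "(T\<^sup>2 / T0\<^sup>2 - 2) * f x \<le> f x * bump (T\<^sup>2) T x" for x
      proof (cases "f0 x = 0")
        case False
        then have "T\<^sup>2 / T0\<^sup>2 - 2 \<le> bump (T\<^sup>2) T x"
          using T T0 Tp unfolding f0_def by (intro bump_ge_on_support) auto
        then show ?thesis using fpos[of x] by (simp add: mult.commute mult_left_mono)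
      qed (simp add: f_def)
    qed
    finally have "e * ((T\<^sup>2 / T0\<^sup>2 - 2) * m) \<le> e * (\<integral>x. f x * bump (T\<^sup>2) T x \<partial>lborel)"
      by (intro mult_left_mono) (simp_all add: e_def)
    moreover have "e * (\<integral>x. f x * bump (T\<^sup>2) T x \<partial>lborel) - 4 * \<rho> * n \<le> s * (2 * T\<^sup>2 * \<rho> powr (1 + \<nu>))"
      unfolding e_def n_def s_def
      by (rule heat_lower_bound[OF \<Omega> tf U(1) U(3) U(4) U(5) _ Tp(1) \<rho> tail[OF Tp(2)]]) (use Tp \<rho>_def in auto)
    moreover have "s * (2 * T\<^sup>2 * \<rho> powr (1 + \<nu>)) \<le> C * T powr (- \<gamma>) * (2 * T\<^sup>2 * \<rho> powr (1 + \<nu>))"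
      by (rule mult_right_mono[OF s]) simp
    ultimately have "e * ((T\<^sup>2 / T0\<^sup>2 - 2) * m) - 4 * \<rho> * n \<le> C * T powr (- \<gamma>) * (2 * T\<^sup>2 * \<rho> powr (1 + \<nu>))" by linarith
    also have "\<dots> = T\<^sup>2 * (2 * C * T powr ((1 + \<nu>) / \<kappa> - \<gamma>))"
      using Tp by (simp add: \<rho>_def powr_powr powr_add[symmetric] powr_diff powr_minus field_simps)
    finally have le: "e * ((T\<^sup>2 / T0\<^sup>2 - 2) * m) - 4 * \<rho> * n \<le> T\<^sup>2 * (2 * C * T powr ((1 + \<nu>) / \<kappa> - \<gamma>))" .
    have r: "T\<^sup>2 * T powr (1 / \<kappa> - 2) = \<rho>" using Tp by (simp add: \<rho>_def powr_diff)
    have d: "T\<^sup>2 * (1 / T0\<^sup>2 - 2 / T\<^sup>2) = T\<^sup>2 / T0\<^sup>2 - 2" using Tp by (simp add: right_diff_distrib)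
    have "A * (e * m * d - 4 * n * q) = e * ((A * d) * m) - 4 * (A * q) * n" for A d q by (simp add: algebra_simps)
    then have "T\<^sup>2 * (e * m * (1 / T0\<^sup>2 - 2 / T\<^sup>2) - 4 * n * T powr (1 / \<kappa> - 2)) = e * ((T\<^sup>2 / T0\<^sup>2 - 2) * m) - 4 * \<rho> * n"
      by (simp only: d r)
    with le have "T\<^sup>2 * (e * m * (1 / T0\<^sup>2 - 2 / T\<^sup>2) - 4 * n * T powr (1 / \<kappa> - 2)) \<le> T\<^sup>2 * (2 * C * T powr ((1 + \<nu>) / \<kappa> - \<gamma>))"
      by simp
    then have "e * m * (1 / T0\<^sup>2 - 2 / T\<^sup>2) - 4 * n * T powr (1 / \<kappa> - 2) \<le> 2 * C * T powr ((1 + \<nu>) / \<kappa> - \<gamma>)"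
      using Tp by (simp add: mult_le_cancel_left_pos)
    then show ?thesis by linarith
  qed
  have l1: "((\<lambda>T. T powr ((1 + \<nu>) / \<kappa> - \<gamma>)) \<longlongrightarrow> 0) at_top"
    by (rule tendsto_neg_powr[OF _ filterlim_ident]) (use gt in simp)
  have "1 / \<kappa> < 1" using \<kappa> by simp
  then have l2: "((\<lambda>T. T powr (1 / \<kappa> - 2)) \<longlongrightarrow> 0) at_top"
    by (intro tendsto_neg_powr[OF _ filterlim_ident]) simp
  have l3: "((\<lambda>T::real. 2 / T\<^sup>2) \<longlongrightarrow> 0) at_top" by real_asymp
  have "((\<lambda>T. 2 * C * T powr ((1 + \<nu>) / \<kappa> - \<gamma>) - e * m * (1 / T0\<^sup>2 - 2 / T\<^sup>2) + 4 * n * T powr (1 / \<kappa> - 2))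
      \<longlongrightarrow> 2 * C * 0 - e * m * (1 / T0\<^sup>2 - 0) + 4 * n * 0) at_top"
    by (intro tendsto_intros l1 l2 l3)
  moreover have "\<forall>\<^sub>F T in at_top. 0 \<le> 2 * C * T powr ((1 + \<nu>) / \<kappa> - \<gamma>) - e * m * (1 / T0\<^sup>2 - 2 / T\<^sup>2) + 4 * n * T powr (1 / \<kappa> - 2)"
    using eventually_ge_at_top[of T0] by eventually_elim (rule main)
  ultimately have "0 \<le> 2 * C * 0 - e * m * (1 / T0\<^sup>2 - 0) + 4 * n * 0"
    by (rule tendsto_lowerbound) simp
  moreover have "0 < e * m * (1 / T0\<^sup>2)" using m T0 by (simp add: e_def)
  ultimately show False by simp
qed

end

theorem theorem2p6:
  fixes \<theta> \<theta>' :: "real \<Rightarrow> real" and a R :: real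
  assumes "0 < a" "a \<le> 1"
    and "\<forall>r>0. (\<theta> has_real_derivative \<theta>' r) (at r)"
    and "continuous_on {0<..} \<theta>'"
    and "\<exists>M. \<forall>r>0. \<bar>r * \<theta>' r\<bar> \<le> M"
    and "0 < R" "\<forall>r\<ge>R. \<theta>' r = 0"
  shows "Gamma \<theta> a \<le> ereal (1/2 + 1 / (4 * a))"
proof -
  have c: "continuous_on {0<..} \<theta>"
    by (rule DERIV_continuous_on) (use assms(3) in \<open>auto intro: has_field_derivative_at_within\<close>)
  have \<theta>: "\<theta> r = \<theta> R" if "R \<le> r" for r
  proof (cases "R = r")
    case False
    then have "R < r" using that by simp
    then show ?thesis
    proof (rule DERIV_isconst2)
      show "continuous_on {R..r} \<theta>" by (rule continuous_on_subset[OF c]) (use assms(6) in auto)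
      show "(\<theta> has_real_derivative 0) (at x)" if "R < x" "x < r" for x
        using assms(3)[rule_format, of x] assms(6,7) that by auto
    qed (use that in auto)
  qed simp
  have \<Omega>: "curved_wedge \<theta> a \<in> sets borel" using open_curved_wedge[OF assms(1,2) c] by simp
  show ?thesis
    unfolding Gamma_def
  proof (rule Sup_least)
    fix g assume "g \<in> ereal ` {\<gamma>. \<exists>C>0. \<forall>t\<ge>0. heat_opnorm (curved_wedge \<theta> a) t \<le> ereal (C * (1 + t) powr (- \<gamma>))}"
    then obtain \<gamma> C where g: "g = ereal \<gamma>" and C: "0 < C"
      "\<And>t. 0 \<le> t \<Longrightarrow> heat_opnorm (curved_wedge \<theta> a) t \<le> ereal (C * (1 + t) powr (- \<gamma>))" by blast
    have "\<gamma> \<le> 1/2 + 1 / (4 * a)"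
    proof (rule ccontr)
      assume neg: "\<not> \<gamma> \<le> 1/2 + 1 / (4 * a)"
      \<comment> \<open>\<open>M / 2\<close> is the claimed bound and \<open>M\<close> the limiting
        value of \<open>1 + \<nu>\<close>. The negated claim \<open>M < 2 * \<gamma>\<close> leaves
        room to replace 2 by some \<open>\<kappa> < 2\<close>.\<close>
      define M where "M = 1 + 1 / (2 * a)"
      have M: "0 < M" "M < 2 * \<gamma>" using neg assms(1) by (auto simp: M_def field_simps add_pos_pos)
      then have \<gamma>: "0 < \<gamma>" by simp
      have "M / \<gamma> < 2" using M \<gamma> by (simp add: field_simps)
      \<comment> \<open>The maximum with 1 secures \<open>1 < \<kappa>\<close> once
        \<open>\<kappa>\<close> is placed midway between \<open>q\<close> and 2.\<close>
      then obtain q where q: "q < 2" "1 \<le> q" "M / \<gamma> \<le> q" by (intro that[of "max 1 (M / \<gamma>)"]) auto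
      define \<kappa> where "\<kappa> = (q + 2) / 2"
      have "q < \<kappa>" using q(1) by (simp add: \<kappa>_def)
      then have "M / \<gamma> < \<kappa>" by (rule le_less_trans[OF q(3)])
      moreover have "1 < \<kappa>" "\<kappa> < 2" using q(1,2) by (simp_all add: \<kappa>_def)
      ultimately have \<kappa>: "1 < \<kappa>" "\<kappa> < 2" "M / \<gamma> < \<kappa>" by auto
      then have M\<kappa>: "M < \<kappa> * \<gamma>" using \<gamma> by (simp add: field_simps)
      \<comment> \<open>\<open>l\<close> is the value of \<open>1 + \<nu>\<close>: above
        \<open>M\<close> it makes the sector narrower than the wedge, below
        \<open>\<kappa> * \<gamma>\<close> it contradicts the decay bound.\<close>
      obtain l where l: "M < l" "l < \<kappa> * \<gamma>" using dense[OF M\<kappa>] by blast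
      define \<nu> where "\<nu> = l - 1"
      have \<nu>: "1 / (2 * a) < \<nu>" "1 + \<nu> < \<kappa> * \<gamma>" using l by (simp_all add: \<nu>_def M_def)
      obtain \<omega> p where ps: "planar_sector \<omega> \<nu>" and sub: "planar_sector.sector \<omega> p \<nu> \<subseteq> curved_wedge \<theta> a"
        using sector_in_curved_wedge[where \<theta> = \<theta>, OF assms(1,2) \<nu>(1) assms(6) \<theta>] by blast
      have "\<gamma> \<le> (1 + \<nu>) / \<kappa>"
        by (rule planar_sector.decay_rate_le[OF ps \<Omega> sub \<kappa>(1,2) C(2,1) \<gamma>])
      moreover have "(1 + \<nu>) / \<kappa> < \<gamma>" using \<nu>(2) \<kappa> by (simp add: field_simps)
      ultimately show False by simp
    qed
    then show "g \<le> ereal (1/2 + 1 / (4 * a))" by (simp add: g)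
  qed
qed

end
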